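(* Let $T_i x = A_i x + d_i$ ($1\le i\le m$) be affine maps of $\mathbb R^2$, where the $A_i$ are invertible $2\times 2$ real matrices with all entries strictly positive and $\|A_i\|_2<1$, and $d_i\in\mathbb R^2$. Let $E$ be the attractor (self-affine set) of the IFS $\{T_1,\dots,T_m\}$ and assume the strong separation condition, i.e. the sets $T_1(E),\dots,T_m(E)$ are pairwise disjoint. Let $\mu$ be the corresponding Käenmäki measure and assume that $\dim_H\mu>1$. If the Furstenberg measure $\mu_F$ is absolutely continuous with respect to Lebesgue measure on $\mathbb{RP}^1$, then $$\dim_H E=\dim_B E=\dim_A E .$$
   Context: The attractor $E$ is the unique non-empty compact set with $E=\bigcup_{i=1}^m T_i(E)$. For words, $A_{a_1\cdots a_n}=A_{a_1}\cdots A_{a_n}$ and $T_{a_1\cdots a_n}=T_{a_1}\cdots T_{a_n}$. For a matrix $A$ with singular values $\alpha_1\ge\alpha_2>0$ put $\phi^s(A)=\alpha_1^s$ for $0<s\le 1$ and $\phi^s(A)=\alpha_1\alpha_2^{s-1}$ for $s\ge 1$. The affinity dimension is $\dim_A E=\dim_A(A_1,\dots,A_m)=\inf\{s>0:\sum_{n\ge1}\sum_{a_1\cdots a_n\in\{1,\dots,m\}^n}\phi^s(A_{a_1\cdots a_n})<\infty\}$. $\Sigma=\{1,\dots,m\}^{\mathbb N}$ with left shift $\sigma$; $[a_1\cdots a_n]\subset\Sigma$ denotes a cylinder; $\pi:\Sigma\to E$, $\pi(a)=\lim_n T_{a_1\cdots a_n}(y)$ (independent of $y$), is a bijection under strong separation.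 The Käenmäki measure $\mu$ is the unique $\sigma$-invariant probability measure on $\Sigma$ (it is ergodic) for which, with $s=\dim_A(A_1,\dots,A_m)$, there is $C>0$ with $C^{-1}\phi^s(A_{a_1\cdots a_n})\le\mu[a_1\cdots a_n]\le C\phi^s(A_{a_1\cdots a_n})$ for all words. It is identified with the measure $\mu\circ\pi^{-1}$ on $E$, and $\dim_H\mu=\inf\{\dim_H A:\mu(A)=1\}$. $\mathbb{RP}^1$ is the set of directions (unit vectors up to sign) in $\mathbb R^2$; $\mathcal Q_2\subset\mathbb{RP}^1$ is the set of directions of non-zero vectors $(x,y)$ with $xy\le0$. Let $\phi_i:\mathbb{RP}^1\to\mathbb{RP}^1$, $\phi_i(\theta)=A_i^{-1}\theta/\|A_i^{-1}\theta\|$; $\phi_i$ maps $\mathcal Q_2$ into itself. Let $\overline\mu$ be the unique shift-invariant measure on $\Sigma^{\pm}=\{1,\dots,m\}^{\mathbb Z}$ that agrees with $\mu$ on cylinders depending only on positive coordinates, and let $\rho(\overline a)=\lim_{n\to\infty}\phi_{a_0}\phi_{a_{-1}}\cdots\phi_{a_{-n}}(\theta)$, which exists and is independent of $\theta\in\mathcal Q_2$. The Furstenberg measure is $\mu_F=\overline\mu\circ\rho^{-1}$ (the stationary measure on $\mathbb{RP}^1$ for the maps $\phi_i$ chosen according to $\mu$). $\dim_H,\dim_B$ denote Hausdorff and box-counting dimension (existence of $\dim_B E$ is part of the conclusion). *)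

theory Defs
  imports "HOL-Probability.Probability"
begin

section \<open>Hausdorff and box-counting dimension\<close>

text \<open>
  The gauge is written out because \<open>0 powr 0 = 0\<close>, whereas a singleton has
  zero-dimensional gauge 1. Boundedness of the covering sets is required explicitly since
  \<^const>\<open>diameter\<close> is unspecified on unbounded sets.
\<close>

definition diameter_gauge :: "real \<Rightarrow> 'a::metric_space set \<Rightarrow> ennreal" where
  "diameter_gauge s U =
     (if U = {} then 0 else if s = 0 then 1 else ennreal (diameter U powr s))"

definition hausdorff_content :: "real \<Rightarrow> real \<Rightarrow> 'a::metric_space set \<Rightarrow> ennreal" where
  "hausdorff_content \<delta> s F =
     (INF U \<in> {U :: nat \<Rightarrow> 'a set. F \<subseteq> (\<Union>i. U i) \<and> (\<forall>i. bounded (U i) \<and> diameter (U i) \<le> \<delta>)}.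
        \<Sum>i. diameter_gauge s (U i))"

definition hausdorff_measure :: "real \<Rightarrow> 'a::metric_space set \<Rightarrow> ennreal" where
  "hausdorff_measure s F = (SUP \<delta>\<in>{0<..}. hausdorff_content \<delta> s F)"

definition hausdorff_dim :: "'a::metric_space set \<Rightarrow> ereal" where
  "hausdorff_dim F = Inf {ereal s |s. 0 \<le> s \<and> hausdorff_measure s F = 0}"

definition hausdorff_dim_measure :: "'a::metric_space measure \<Rightarrow> ereal" where
  "hausdorff_dim_measure M = (INF X \<in> {X \<in> sets M. emeasure M X = 1}. hausdorff_dim X)"

text \<open>Only meaningful for totally bounded sets (otherwise the \<open>LEAST\<close> may be vacuous).\<close>

definition covering_number :: "real \<Rightarrow> 'a::metric_space set \<Rightarrow> nat" where
  "covering_number \<delta> F =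
     (LEAST n. \<exists>\<U>. finite \<U> \<and> card \<U> = n \<and> F \<subseteq> \<Union>\<U> \<and>
        (\<forall>U\<in>\<U>. bounded U \<and> diameter U \<le> \<delta>))"

text \<open>The box-counting dimension exists and equals \<open>D\<close>.\<close>

definition has_box_dim :: "'a::metric_space set \<Rightarrow> real \<Rightarrow> bool" where
  "has_box_dim F D \<longleftrightarrow>
     ((\<lambda>\<delta>. ln (real (covering_number \<delta> F)) / (- ln \<delta>)) \<longlongrightarrow> D) (at_right 0)"

section \<open>Self-affine sets and the affinity dimension\<close>

text \<open>
  The alphabet \<open>{1,\<dots>,m}\<close> is a finite type \<open>'m\<close>; finite words are lists over it.
\<close>

definition affine_map :: "('m \<Rightarrow> real^2^2) \<Rightarrow> ('m \<Rightarrow> real^2) \<Rightarrow> 'm \<Rightarrow> real^2 \<Rightarrow> real^2" where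
  "affine_map A d i x = A i *v x + d i"

definition is_attractor :: "('m \<Rightarrow> 'a::topological_space \<Rightarrow> 'a) \<Rightarrow> 'a set \<Rightarrow> bool" where
  "is_attractor T E \<longleftrightarrow> compact E \<and> E \<noteq> {} \<and> E = (\<Union>i. T i ` E)"

definition word_matrix :: "('m \<Rightarrow> real^2^2) \<Rightarrow> 'm list \<Rightarrow> real^2^2" where
  "word_matrix A w = foldr (\<lambda>i B. A i ** B) w (mat 1)"

definition word_map :: "('m \<Rightarrow> 'a \<Rightarrow> 'a) \<Rightarrow> 'm list \<Rightarrow> 'a \<Rightarrow> 'a" where
  "word_map T w = foldr (\<lambda>i f. T i \<circ> f) w id"

text \<open>Square roots of the eigenvalues of the Gram matrix; for a \<open>2 \<times> 2\<close> matrix, one or two values.\<close>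

definition singular_values :: "real^2^2 \<Rightarrow> real set" where
  "singular_values A =
     {\<alpha>. 0 \<le> \<alpha> \<and> (\<exists>v. v \<noteq> 0 \<and> (transpose A ** A) *v v = \<alpha>\<^sup>2 *s v)}"

definition sing1 :: "real^2^2 \<Rightarrow> real" where
  "sing1 A = Max (singular_values A)"

definition sing2 :: "real^2^2 \<Rightarrow> real" where
  "sing2 A = Min (singular_values A)"

definition sv_function :: "real \<Rightarrow> real^2^2 \<Rightarrow> real" where
  "sv_function s A =
     (if s \<le> 1 then sing1 A powr s else sing1 A * sing2 A powr (s - 1))"

definition affinity_dim :: "('m::finite \<Rightarrow> real^2^2) \<Rightarrow> real" where
  "affinity_dim A =
     Inf {s. 0 < s \<and>
       summable (\<lambda>n. \<Sum>w | length w = Suc n. sv_function s (word_matrix A w))}"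

section \<open>Symbolic space and the Kaenmaki measure\<close>

text \<open>
  A one-sided sequence \<open>a\<^sub>1 a\<^sub>2 \<dots>\<close> is a function on \<^typ>\<open>nat\<close> with \<open>a k\<close> standing for
  \<open>a\<^sub>k\<^sub>+\<^sub>1\<close>. Two-sided sequences are functions on \<^typ>\<open>int\<close> without index change.
\<close>

definition seq_algebra :: "('n \<Rightarrow> 'm) measure" where
  "seq_algebra = PiM UNIV (\<lambda>_. count_space UNIV)"

definition shift :: "('n::{plus,one} \<Rightarrow> 'm) \<Rightarrow> 'n \<Rightarrow> 'm" where
  "shift a = (\<lambda>k. a (k + 1))"

definition cylinder :: "'m list \<Rightarrow> (nat \<Rightarrow> 'm) set" where
  "cylinder w = {a. \<forall>k<length w. a k = w ! k}"

definition shift_invariant_prob :: "('n::{plus,one} \<Rightarrow> 'm) measure \<Rightarrow> bool" where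
  "shift_invariant_prob M \<longleftrightarrow>
     prob_space M \<and> sets M = sets seq_algebra \<and> distr M M shift = M"

definition is_kaenmaki_measure ::
    "('m::finite \<Rightarrow> real^2^2) \<Rightarrow> (nat \<Rightarrow> 'm) measure \<Rightarrow> bool" where
  "is_kaenmaki_measure A \<mu> \<longleftrightarrow> shift_invariant_prob \<mu> \<and>
     (\<exists>C>0. \<forall>w. sv_function (affinity_dim A) (word_matrix A w) / C \<le> measure \<mu> (cylinder w) \<and>
               measure \<mu> (cylinder w) \<le> C * sv_function (affinity_dim A) (word_matrix A w))"

definition coding_map ::
    "('m \<Rightarrow> 'a::topological_space \<Rightarrow> 'a) \<Rightarrow> (nat \<Rightarrow> 'm) \<Rightarrow> 'a" where
  "coding_map T a = (THE x. \<forall>y. (\<lambda>n. word_map T (map a [0..<n]) y) \<longlonglongrightarrow> x)"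

text \<open>
  The two-sided extension: shift-invariant, and equal to \<open>\<mu>\<close> on the cylinders
  that depend on the coordinates \<open>1, 2, \<dots>\<close>.
\<close>

definition is_two_sided_extension ::
    "(nat \<Rightarrow> 'm) measure \<Rightarrow> (int \<Rightarrow> 'm) measure \<Rightarrow> bool" where
  "is_two_sided_extension \<mu> \<nu> \<longleftrightarrow> shift_invariant_prob \<nu> \<and>
     (\<forall>w. measure \<nu> {a. (\<lambda>k. a (int k + 1)) \<in> cylinder w} = measure \<mu> (cylinder w))"

section \<open>The projective line and the Furstenberg measure\<close>

quotient_type rp1 = "real^2" / partial:
    "\<lambda>u v. norm u = 1 \<and> norm v = 1 \<and> (u = v \<or> u = - v)"
proof (rule part_equivpI)
  show "\<exists>x::real^2. norm x = 1 \<and> norm x = 1 \<and> (x = x \<or> x = - x)"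
    by (rule exI[of _ "axis 1 1"]) simp
qed (auto simp: symp_def transp_def)

instantiation rp1 :: metric_space
begin

lift_definition dist_rp1 :: "rp1 \<Rightarrow> rp1 \<Rightarrow> real"
  is "\<lambda>u v. min (norm (u - v)) (norm (u + v))"
  by (auto simp: min.commute norm_minus_commute add.commute)

definition uniformity_rp1 :: "(rp1 \<times> rp1) filter" where
  "uniformity_rp1 = (INF e\<in>{0<..}. principal {(x, y). dist x y < e})"

definition open_rp1 :: "rp1 set \<Rightarrow> bool" where
  "open_rp1 U \<longleftrightarrow> (\<forall>x\<in>U. \<forall>\<^sub>F (x', y) in uniformity. x' = x \<longrightarrow> y \<in> U)"

instance
proof
  show "dist x y = 0 \<longleftrightarrow> x = y" for x y :: rp1
    by transfer (auto simp: min_def eq_neg_iff_add_eq_0)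
  show "dist x y \<le> dist x z + dist y z" for x y z :: rp1
  proof transfer
    fix x y z :: "real^2"
    have "norm (x - y) \<le> norm (x - z) + norm (y - z)"
      using norm_triangle_ineq4[of "x - z" "y - z"] by simp
    moreover have "norm (x + y) \<le> norm (x - z) + norm (y + z)"
      using norm_triangle_ineq[of "x - z" "y + z"] by simp
    moreover have "norm (x + y) \<le> norm (x + z) + norm (y - z)"
      using norm_triangle_ineq[of "x + z" "y - z"] by simp
    moreover have "norm (x - y) \<le> norm (x + z) + norm (y + z)"
      using norm_triangle_ineq4[of "x + z" "y + z"] by simp
    ultimately show "min (norm (x - y)) (norm (x + y))
        \<le> min (norm (x - z)) (norm (x + z)) + min (norm (y - z)) (norm (y + z))"
      by linarith
  qed
qed (simp_all add: uniformity_rp1_def open_rp1_def)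

end

text \<open>Meaningful for non-zero vectors.\<close>

definition direction :: "real^2 \<Rightarrow> rp1" where
  "direction v = abs_rp1 (sgn v)"

definition rp1_lebesgue :: "rp1 measure" where
  "rp1_lebesgue =
     distr (restrict_space lborel {0..<pi}) borel (\<lambda>t. direction (vector [cos t, sin t]))"

definition Q2 :: "rp1 set" where
  "Q2 = direction ` {v. v \<noteq> 0 \<and> v $ 1 * v $ 2 \<le> 0}"

text \<open>For invertible \<open>A i\<close> the value does not depend on the representative.\<close>

definition inverse_action :: "('m \<Rightarrow> real^2^2) \<Rightarrow> 'm \<Rightarrow> rp1 \<Rightarrow> rp1" where
  "inverse_action A i \<theta> = direction (matrix_inv (A i) *v rep_rp1 \<theta>)"

definition furstenberg_map :: "('m \<Rightarrow> real^2^2) \<Rightarrow> (int \<Rightarrow> 'm) \<Rightarrow> rp1" where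
  "furstenberg_map A a =
     (THE p. \<forall>\<theta>\<in>Q2.
        (\<lambda>n. word_map (inverse_action A) (map (\<lambda>k. a (- int k)) [0..<Suc n]) \<theta>) \<longlonglongrightarrow> p)"

definition furstenberg_measure ::
    "('m \<Rightarrow> real^2^2) \<Rightarrow> (int \<Rightarrow> 'm) measure \<Rightarrow> rp1 measure" where
  "furstenberg_measure A \<nu> = distr \<nu> borel (furstenberg_map A)"

end

theory Submission
  imports Defs
begin

text \<open>
  Write \<open>s\<close> for the affinity dimension. By positivity of the matrices, the entry sum \<open>S w\<close> and
  \<open>\<bar>det A\<^sub>w\<bar> / S w\<close> are, up to constants, the singular values of \<open>A\<^sub>w\<close> and are almost
  multiplicative in \<open>w\<close>. The Gibbs property of \<open>\<mu>\<close> then gives coverings of \<open>E\<close> by about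
  \<open>\<delta>\<close> to the power \<open>-s\<close> sets of diameter \<open>\<delta>\<close>, hence all upper bounds, and also \<open>s > 1\<close>,
  since otherwise \<open>\<mu>\<close> would have dimension at most 1.

  For the lower bounds it suffices that for each \<open>t < s\<close> the projection of \<open>\<mu>\<close> satisfies
  \<open>M (cball x r) \<le> j * r powr t\<close> for all \<open>r\<close> on a set of \<open>x\<close> of positive measure. A Vitali covering
  argument and the dimension assumption give this for \<open>t = 1\<close>. For such \<open>x\<close>, Fubini shows
  that in almost every direction, hence in almost every direction for the Furstenberg
  measure, strips through \<open>x\<close> of width \<open>\<delta>\<close> have measure \<open>O(\<delta> powr (1 - \<epsilon>))\<close>. Past and future are
  quasi-independent, so this holds with a uniform constant on a set of positive measure of
  two-sided sequences. Its return times to this set have gaps \<open>o(n)\<close> almost surely. At a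
  return time \<open>n\<close>, strong separation places the part of \<open>E\<close> within distance \<open>c * width w\<close> of \<open>x\<close> in
  the cylinder of the first \<open>n\<close> symbols \<open>w\<close>, and pulling back by \<open>A\<^sub>w\<close> turns the ball into
  a strip in exactly the Furstenberg direction; its measure is therefore at most
  about \<open>S w * width w powr (s - 1) * (width w / S w) powr (1 - \<epsilon>) \<le> C * width w powr (s - \<epsilon>)\<close>.
\<close>

section \<open>Two-by-two matrices\<close>

text \<open>Absolute continuity only makes the exceptional directions of a point a null set; it
  gives no bound uniform in point and direction. Hence the strip estimate has a single constant only
  on a set of positive measure, and a ball is controlled only at times when the shifted sequence
  lies in this set. Gaps between such times are harmless when they are o(n): each symbol reduces
  \<open>width\<close> at most by a fixed factor, while \<open>width\<close> is itself exponentially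
  small in n, so skipping n div q symbols changes the radius at most by a power
  \<open>\<eta>\<close> of itself, and \<open>\<eta>\<close> is arbitrarily small for large q. The
  exceptional set is null for the product of the law of the future, which determines the point, and
  that of the past, which determines the direction; this is why their joint law has to be dominated
  by the product. Two losses make the exponent fall short of s: \<open>\<epsilon>\<close>, needed
  for convergence of a dyadic series of strip measures, and \<open>\<eta>\<close>, caused by the
  gaps.\<close>

definition entry_sum :: "real^2^2 \<Rightarrow> real" where
  "entry_sum B = B$1$1 + B$1$2 + B$2$1 + B$2$2"

text \<open>The inverse up to the factor \<open>det B\<close>, hence with the same action on
  directions, but polynomial in the entries, so that signs and sizes can be read off.\<close>

definition adjugate2 :: "real^2^2 \<Rightarrow> real^2^2" where
  "adjugate2 B = vector [vector [B$2$2, - B$1$2], vector [- B$2$1, B$1$1]]"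

text \<open>The determinant with columns u and v. For a unit vector u its absolute value is the
  distance of v from the line spanned by u, so it describes strips.\<close>

definition cross2 :: "real^2 \<Rightarrow> real^2 \<Rightarrow> real" where
  "cross2 u v = u$1 * v$2 - u$2 * v$1"

lemma vec2_eq_iff: "(u::'a^2) = v \<longleftrightarrow> u$1 = v$1 \<and> u$2 = v$2"
  by (simp add: vec_eq_iff forall_2)

lemma matrix_mult_2:
  fixes B C :: "'a::semiring_1^2^2"
  shows "(B ** C)$i$j = B$i$1 * C$1$j + B$i$2 * C$2$j"
  by (simp add: matrix_matrix_mult_def sum_2)

lemma matrix_vector_2:
  fixes B :: "'a::semiring_1^2^2"
  shows "(B *v v)$i = B$i$1 * v$1 + B$i$2 * v$2"
  by (simp add: matrix_vector_mult_def sum_2)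

lemma norm_vec2: "norm (v::real^2) = sqrt ((v$1)\<^sup>2 + (v$2)\<^sup>2)"
  by (simp add: norm_vec_def L2_set_def sum_2)

lemma norm_vec2_le: "norm (v::real^2) \<le> \<bar>v$1\<bar> + \<bar>v$2\<bar>"
  unfolding norm_vec2 by (rule sqrt_sum_squares_le_sum_abs)

lemma abs_sum_le_norm_vec2: "\<bar>v$1\<bar> + \<bar>v$2\<bar> \<le> 2 * norm (v::real^2)"
  using component_le_norm_cart[of v 1] component_le_norm_cart[of v 2] by simp

lemma adjugate2_mult: "adjugate2 (B ** C) = adjugate2 C ** adjugate2 B"
  by (simp add: vec2_eq_iff matrix_mult_2 adjugate2_def algebra_simps)

lemma adjugate2_mat1: "adjugate2 (mat 1) = mat 1"
  by (simp add: vec2_eq_iff adjugate2_def mat_def)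

lemma adjugate2_apply: "adjugate2 B *v (B *v v) = det B *\<^sub>R v"
  by (simp add: vec2_eq_iff matrix_vector_2 adjugate2_def det_2 algebra_simps)

lemma matrix_inv_adjugate2:
  assumes "invertible (B::real^2^2)"
  shows "matrix_inv B *v v = (1 / det B) *\<^sub>R (adjugate2 B *v v)"
proof -
  have d: "det B \<noteq> 0" using assms invertible_det_nz by blast
  have "v = B *v (matrix_inv B *v v)"
    using someI_ex[of "\<lambda>C. B ** C = mat 1 \<and> C ** B = mat 1"] assms
    by (simp add: matrix_vector_mul_assoc matrix_inv_def invertible_def)
  then have "adjugate2 B *v v = det B *\<^sub>R (matrix_inv B *v v)"
    by (metis adjugate2_apply)
  then show ?thesis using d by simp
qed

lemma cross2_adjugate2: "cross2 (adjugate2 B *v u) (adjugate2 B *v v) = det B * cross2 u v"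
  by (simp add: cross2_def matrix_vector_2 adjugate2_def det_2 algebra_simps)

lemma cross2_adjugate2_left: "cross2 (adjugate2 B *v q) v = cross2 q (B *v v)"
  by (simp add: cross2_def matrix_vector_2 adjugate2_def algebra_simps)

lemma cross2_scaleR_left: "cross2 (c *\<^sub>R u) v = c * cross2 u v"
  by (simp add: cross2_def algebra_simps)

lemma cross2_scaleR_right: "cross2 u (c *\<^sub>R v) = c * cross2 u v"
  by (simp add: cross2_def algebra_simps)

lemma abs_cross2_le: "\<bar>cross2 u v\<bar> \<le> norm u * norm v"
proof -
  have "(cross2 u v)\<^sup>2 \<le> (norm u * norm v)\<^sup>2"
  proof -
    have "(norm u * norm v)\<^sup>2 - (cross2 u v)\<^sup>2 = (u$1 * v$1 + u$2 * v$2)\<^sup>2"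
      by (simp add: norm_vec2 cross2_def power_mult_distrib) (simp add: power2_eq_square algebra_simps)
    then show ?thesis using zero_le_power2[of "u$1 * v$1 + u$2 * v$2"] by linarith
  qed
  then show ?thesis
    by (meson abs_le_square_iff abs_of_nonneg mult_nonneg_nonneg norm_ge_zero order_trans
        power2_le_iff_abs_le)
qed

lemma norm_mult_le_entry_sum:
  assumes "\<And>i j. 0 \<le> B$i$j"
  shows "norm (B *v v) \<le> entry_sum B * norm v"
proof -
  have 1: "\<bar>v$1\<bar> \<le> norm v" "\<bar>v$2\<bar> \<le> norm v" by (rule component_le_norm_cart)+
  have c: "\<bar>B$i$1 * v$1 + B$i$2 * v$2\<bar> \<le> (B$i$1 + B$i$2) * norm v" for i
  proof -
    have "\<bar>B$i$1 * v$1 + B$i$2 * v$2\<bar> \<le> B$i$1 * \<bar>v$1\<bar> + B$i$2 * \<bar>v$2\<bar>"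
      using abs_triangle_ineq[of "B$i$1 * v$1" "B$i$2 * v$2"] assms by (simp add: abs_mult)
    also have "\<dots> \<le> B$i$1 * norm v + B$i$2 * norm v"
      using 1 assms by (intro add_mono mult_left_mono) auto
    finally show ?thesis by (simp add: algebra_simps)
  qed
  have "norm (B *v v) \<le> \<bar>(B *v v)$1\<bar> + \<bar>(B *v v)$2\<bar>" by (rule norm_vec2_le)
  also have "\<dots> \<le> (B$1$1 + B$1$2) * norm v + (B$2$1 + B$2$2) * norm v"
    unfolding matrix_vector_2 using c by (intro add_mono) auto
  finally show ?thesis by (simp add: entry_sum_def algebra_simps)
qed

lemma norm_adjugate2_mult_le:
  assumes "\<And>i j. 0 \<le> B$i$j"
  shows "norm (adjugate2 B *v v) \<le> entry_sum B * norm v"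
proof -
  \<comment> \<open>Up to the sign of the second coordinate, \<open>adjugate2 B *v v\<close> is
    \<open>C *v w\<close>, where C is nonnegative and has the same entry sum as B.\<close>
  define C :: "real^2^2" where "C = vector [vector [B$2$2, B$1$2], vector [B$2$1, B$1$1]]"
  define w :: "real^2" where "w = vector [v$1, - v$2]"
  have "norm (adjugate2 B *v v) = norm (C *v w)"
    by (simp add: norm_vec2 matrix_vector_2 adjugate2_def C_def w_def)
      (metis (no_types, opaque_lifting) power2_commute)
  also have "\<dots> \<le> entry_sum C * norm w"
  proof (rule norm_mult_le_entry_sum)
    show "0 \<le> C$i$j" for i j
      using exhaust_2[of i] exhaust_2[of j] assms by (auto simp: C_def)
  qed
  also have "\<dots> = entry_sum B * norm v"
    by (simp add: entry_sum_def C_def w_def norm_vec2 algebra_simps)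
  finally show ?thesis .
qed

text \<open>The adjugate undoes B up to \<open>det B\<close>, so an upper bound for the adjugate is
  a lower bound for B.\<close>

lemma abs_det_le_norm_mult:
  assumes "\<And>i j. 0 \<le> B$i$j"
  shows "\<bar>det B\<bar> * norm v \<le> entry_sum B * norm (B *v v)"
  using norm_adjugate2_mult_le[OF assms, of "B *v v"] by (simp add: adjugate2_apply)

text \<open>\<open>singular_values\<close> is a set and forgets multiplicity. The numbers x and y
  keep it: they may coincide, and their sum and product are the trace and determinant of the Gram
  matrix.\<close>

lemma singular_values_2:
  fixes B :: "real^2^2"
  obtains x y where "0 \<le> y" "y \<le> x" "x + y = (B$1$1)\<^sup>2 + (B$1$2)\<^sup>2 + (B$2$1)\<^sup>2 + (B$2$2)\<^sup>2"
    "x * y = (det B)\<^sup>2" "singular_values B = {sqrt x, sqrt y}"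
proof -
  define p q r where "p = (B$1$1)\<^sup>2 + (B$2$1)\<^sup>2" and "q = B$1$1 * B$1$2 + B$2$1 * B$2$2"
    and "r = (B$1$2)\<^sup>2 + (B$2$2)\<^sup>2"
  \<comment> \<open>The Gram matrix has rows (p, q) and (q, r); z is the square root of the
    discriminant of its characteristic polynomial, and x, y are the roots.\<close>
  define z where "z = sqrt ((p - r)\<^sup>2 + 4 * q\<^sup>2)"
  define x y where "x = (p + r + z) / 2" and "y = (p + r - z) / 2"
  have z2: "z\<^sup>2 = (p - r)\<^sup>2 + 4 * q\<^sup>2" and z0: "0 \<le> z" by (simp_all add: z_def)
  have sum: "x + y = p + r" by (simp add: x_def y_def field_simps)
  have prod: "x * y = p * r - q\<^sup>2"
  proof -
    have "4 * (x * y) = (p + r + z) * (p + r - z)" by (simp add: x_def y_def)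
    also have "\<dots> = (p + r)\<^sup>2 - z\<^sup>2" by (simp add: power2_eq_square algebra_simps)
    finally show ?thesis unfolding z2 by (simp add: power2_eq_square algebra_simps)
  qed
  have det: "p * r - q\<^sup>2 = (det B)\<^sup>2"
    by (simp add: p_def q_def r_def det_2 power2_eq_square algebra_simps)
  have p0: "0 \<le> p" "0 \<le> r" by (simp_all add: p_def r_def)
  have yx: "y \<le> x" using z0 by (simp add: x_def y_def)
  have x0: "0 \<le> x" using p0 z0 by (simp add: x_def)
  have y0: "0 \<le> y"
  proof (rule ccontr)
    assume n: "\<not> 0 \<le> y"
    then have "x > 0" using sum p0 by linarith
    then have "x * y < 0" using n by (simp add: mult_pos_neg)
    then show False using prod det zero_le_power2[of "det B"] by linarith
  qed
  have G: "(transpose B ** B) *v v = vector [p * v$1 + q * v$2, q * v$1 + r * v$2]" for v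
    by (simp add: vec2_eq_iff matrix_vector_2 matrix_mult_2 transpose_def p_def q_def r_def
        power2_eq_square algebra_simps)
  have roots: "(p - c) * (r - c) = q\<^sup>2 \<longleftrightarrow> c = x \<or> c = y" for c
  proof -
    have "(p - c) * (r - c) - q\<^sup>2 = (c - x) * (c - y)"
    proof -
      have "(p - c) * (r - c) - q\<^sup>2 = (p * r - q\<^sup>2) - (p + r) * c + c * c"
        by (simp add: algebra_simps)
      also have "\<dots> = x * y - (x + y) * c + c * c" by (simp add: sum prod)
      finally show ?thesis by (simp add: algebra_simps)
    qed
    then show ?thesis by (metis eq_iff_diff_eq_0 mult_eq_0_iff)
  qed
  have eig: "(\<exists>v. v \<noteq> 0 \<and> (transpose B ** B) *v v = c *s v) \<longleftrightarrow> (p - c) * (r - c) = q\<^sup>2" for c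
  proof
    assume "\<exists>v. v \<noteq> 0 \<and> (transpose B ** B) *v v = c *s v"
    then obtain v :: "real^2" where v: "v \<noteq> 0" "(transpose B ** B) *v v = c *s v" by blast
    have e: "(p - c) * v$1 = - q * v$2" "(r - c) * v$2 = - q * v$1"
      using v(2) by (simp_all add: G vec2_eq_iff algebra_simps)
    have "((p - c) * (r - c) - q\<^sup>2) * v$1 = 0"
      using arg_cong[OF e(1), of "\<lambda>t. (r - c) * t"] arg_cong[OF e(2), of "\<lambda>t. q * t"]
      by (simp add: algebra_simps power2_eq_square)
    moreover have "((p - c) * (r - c) - q\<^sup>2) * v$2 = 0"
      using arg_cong[OF e(1), of "\<lambda>t. q * t"] arg_cong[OF e(2), of "\<lambda>t. (p - c) * t"]
      by (simp add: algebra_simps power2_eq_square)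
    ultimately show "(p - c) * (r - c) = q\<^sup>2" using v(1) by (auto simp: vec2_eq_iff)
  next
    assume a: "(p - c) * (r - c) = q\<^sup>2"
    show "\<exists>v. v \<noteq> 0 \<and> (transpose B ** B) *v v = c *s v"
    \<comment> \<open>The general eigenvector (q, c - p) vanishes exactly in this case, and then (1,
      0) is an eigenvector.\<close>
    proof (cases "q = 0 \<and> c = p")
      case True
      then show ?thesis
        by (intro exI[of _ "vector [1, 0]"]) (simp add: G vec2_eq_iff)
    next
      case False
      then show ?thesis using a
        by (intro exI[of _ "vector [q, c - p]"])
          (auto simp: G vec2_eq_iff algebra_simps power2_eq_square)
    qed
  qed
  have "singular_values B = {\<alpha>. 0 \<le> \<alpha> \<and> (\<alpha>\<^sup>2 = x \<or> \<alpha>\<^sup>2 = y)}"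
    unfolding singular_values_def eig roots ..
  also have "\<dots> = {sqrt x, sqrt y}" using x0 y0 by (auto simp: real_sqrt_unique)
  finally have "singular_values B = {sqrt x, sqrt y}" .
  moreover have "x + y = (B$1$1)\<^sup>2 + (B$1$2)\<^sup>2 + (B$2$1)\<^sup>2 + (B$2$2)\<^sup>2"
    by (simp add: sum p_def r_def)
  ultimately show ?thesis using that[of y x] y0 yx prod det by metis
qed

lemma singular_values_entry_sum:
  fixes B :: "real^2^2"
  assumes nonneg: "\<And>i j. 0 \<le> B$i$j"
  shows "sing1 B \<le> entry_sum B" "entry_sum B / 3 \<le> sing1 B" "sing1 B * sing2 B = \<bar>det B\<bar>"
    "0 \<le> sing2 B"
proof -
  obtain x y where xy: "0 \<le> y" "y \<le> x"
    "x + y = (B$1$1)\<^sup>2 + (B$1$2)\<^sup>2 + (B$2$1)\<^sup>2 + (B$2$2)\<^sup>2"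
    "x * y = (det B)\<^sup>2" "singular_values B = {sqrt x, sqrt y}"
    by (rule singular_values_2)
  have s1: "sing1 B = sqrt x" and s2: "sing2 B = sqrt y"
    using xy by (simp_all add: sing1_def sing2_def max_def min_def)
  show "sing1 B * sing2 B = \<bar>det B\<bar>"
    unfolding s1 s2 real_sqrt_mult[symmetric] xy(4) by simp
  show "0 \<le> sing2 B" using xy(1) s2 by simp
  define a b c e where "a = B$1$1" and "b = B$1$2" and "c = B$2$1" and "e = B$2$2"
  have n: "0 \<le> a" "0 \<le> b" "0 \<le> c" "0 \<le> e" using nonneg by (simp_all add: a_def b_def c_def e_def)
  have S: "entry_sum B = a + b + c + e" by (simp add: entry_sum_def a_def b_def c_def e_def)
  have S0: "0 \<le> entry_sum B" using n S by simp
  have xs: "x + y = a\<^sup>2 + b\<^sup>2 + c\<^sup>2 + e\<^sup>2" using xy(3) by (simp add: a_def b_def c_def e_def)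
  have "x \<le> (entry_sum B)\<^sup>2"
  proof -
    have "(entry_sum B)\<^sup>2 = (a\<^sup>2 + b\<^sup>2 + c\<^sup>2 + e\<^sup>2) + 2 * (a*b + a*c + a*e + b*c + b*e + c*e)"
      unfolding S by (simp add: power2_eq_square algebra_simps)
    also have "\<dots> \<ge> a\<^sup>2 + b\<^sup>2 + c\<^sup>2 + e\<^sup>2" using n by simp
    finally show ?thesis using xs xy(1) by linarith
  qed
  then show "sing1 B \<le> entry_sum B" unfolding s1 using S0 real_le_lsqrt by blast
  \<comment> \<open>By Cauchy-Schwarz the squared entry sum is at most 4 (x + y) <= 8 x; the
    constant 3 is a rational bound for the square root of 8.\<close>
  have "(entry_sum B / 3)\<^sup>2 \<le> x"
  proof -
    have "4 * (a\<^sup>2 + b\<^sup>2 + c\<^sup>2 + e\<^sup>2) - (entry_sum B)\<^sup>2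
        = (a-b)\<^sup>2 + (a-c)\<^sup>2 + (a-e)\<^sup>2 + (b-c)\<^sup>2 + (b-e)\<^sup>2 + (c-e)\<^sup>2"
      unfolding S by (simp add: power2_eq_square algebra_simps)
    moreover have "0 \<le> (a-b)\<^sup>2 + (a-c)\<^sup>2 + (a-e)\<^sup>2 + (b-c)\<^sup>2 + (b-e)\<^sup>2 + (c-e)\<^sup>2"
      by simp
    ultimately have "(entry_sum B)\<^sup>2 \<le> 4 * (a\<^sup>2 + b\<^sup>2 + c\<^sup>2 + e\<^sup>2)" by linarith
    then have "(entry_sum B)\<^sup>2 \<le> 4 * (x + y)" unfolding xs .
    then have "(entry_sum B)\<^sup>2 \<le> 8 * x" using xy(2) by simp
    then show ?thesis using xy(1,2) by (simp add: power_divide)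
  qed
  then show "entry_sum B / 3 \<le> sing1 B" unfolding s1 by (rule real_le_rsqrt)
qed

section \<open>Products of positive matrices\<close>

lemma word_matrix_simps [simp]:
  "word_matrix A [] = mat 1"
  "word_matrix A (i # w) = A i ** word_matrix A w"
  by (simp_all add: word_matrix_def)

lemma word_matrix_append: "word_matrix A (u @ v) = word_matrix A u ** word_matrix A v"
  by (induction u) (simp_all add: matrix_mul_assoc)

locale positive_matrices =
  fixes A :: "'m::finite \<Rightarrow> real^2^2"
  assumes invertible: "invertible (A i)"
    and positive: "0 < A i $ j $ k"
    and contracting: "onorm ((*v) (A i)) < 1"
begin

text \<open>The entry sum is linear on matrices, so for nonnegative ones products can be estimated
  through row and column sums.\<close>

definition S :: "'m list \<Rightarrow> real" where
  "S w = entry_sum (word_matrix A w)"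

definition D :: "'m list \<Rightarrow> real" where
  "D w = \<bar>det (word_matrix A w)\<bar>"

text \<open>Up to constants, \<^term>\<open>S w\<close> and \<^term>\<open>D w / S w\<close> are the two singular values.\<close>

definition width :: "'m list \<Rightarrow> real" where
  "width w = D w / S w"

definition row :: "'m list \<Rightarrow> 2 \<Rightarrow> real" where
  "row w j = word_matrix A w $ j $ 1 + word_matrix A w $ j $ 2"

definition kappa :: real where
  "kappa = Max (range (\<lambda>(i, j, k). A i $ j $ k)) / Min (range (\<lambda>(i, j, k). A i $ j $ k))"

lemma nonneg: "0 \<le> word_matrix A w $ j $ k"
proof (induction w arbitrary: j k)
  case Nil then show ?case by (simp add: mat_def)
next
  case (Cons i w)
  then show ?case using positive[THEN less_imp_le]
    by (simp add: matrix_mult_2)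
qed

lemma S_row: "S w = row w 1 + row w 2"
  by (simp add: S_def entry_sum_def row_def)

lemma row_nonneg: "0 \<le> row w j"
  using nonneg by (simp add: row_def)

lemma kappa_bound: "A i $ j $ k \<le> kappa * A i' $ j' $ k'"
proof -
  define X where "X = range (\<lambda>(i, j, k). A i $ j $ k)"
  have fin: "finite X" "X \<noteq> {}" by (auto simp: X_def)
  have mem: "A i $ j $ k \<in> X" for i j k unfolding X_def by (rule image_eqI[of _ _ "(i,j,k)"]) auto
  have "0 < Min X" using fin positive by (subst Min_gr_iff) (auto simp: X_def)
  moreover have "A i $ j $ k \<le> Max X" using fin mem by simp
  moreover have "Min X \<le> A i' $ j' $ k'" using fin mem by simp
  moreover have "0 < Max X" using \<open>0 < Min X\<close> fin by (meson Max_in Min_le less_le_trans)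
  ultimately have "A i $ j $ k * Min X \<le> Max X * A i' $ j' $ k'"
    by (intro mult_mono) auto
  then show ?thesis using \<open>0 < Min X\<close>
    by (simp add: kappa_def X_def[symmetric] field_simps)
qed

lemma kappa_ge_1: "1 \<le> kappa"
  using kappa_bound[of undefined 1 1 undefined 1 1] positive[of undefined 1 1] by simp

text \<open>The first letter decides: each row sum of \<open>A i ** B\<close> combines the two row
  sums of B with the entries of one row of \<open>A i\<close> as coefficients, and passing to
  another row changes each coefficient at most by the factor \<open>kappa\<close>.\<close>

lemma row_le: "row w j \<le> kappa * row w j'"
proof (cases w)
  case Nil
  then show ?thesis using kappa_ge_1 exhaust_2[of j] exhaust_2[of j'] by (auto simp: row_def mat_def)
next
  case (Cons i v)
  have *: "row w l = A i $ l $ 1 * row v 1 + A i $ l $ 2 * row v 2" for l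
    by (simp add: row_def Cons matrix_mult_2 algebra_simps)
  have "A i $ j $ k * row v k \<le> kappa * A i $ j' $ k * row v k" for k
    using kappa_bound row_nonneg by (intro mult_right_mono) auto
  then have "row w j \<le> kappa * A i $ j' $ 1 * row v 1 + kappa * A i $ j' $ 2 * row v 2"
    unfolding * by (intro add_mono)
  then show ?thesis unfolding * by (simp add: algebra_simps)
qed

lemma S_le_row: "S w \<le> (1 + kappa) * row w j"
  using row_le[of w 1 j] row_le[of w 2 j] exhaust_2[of j] by (auto simp: S_row algebra_simps)

lemma det_nz: "det (word_matrix A w) \<noteq> 0"
  using invertible invertible_det_nz by (induction w) (auto simp: det_mul det_I)

lemma D_pos: "0 < D w" by (simp add: D_def det_nz)

lemma D_append: "D (u @ v) = D u * D v"
  by (simp add: D_def word_matrix_append det_mul abs_mult)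

lemma S_pos: "0 < S w"
proof -
  have "S w \<noteq> 0"
  proof
    assume "S w = 0"
    then have "word_matrix A w $ 1 $ 1 = 0" "word_matrix A w $ 1 $ 2 = 0"
      using nonneg[of w 1 1] nonneg[of w 1 2] nonneg[of w 2 1] nonneg[of w 2 2]
      by (simp_all add: S_def entry_sum_def)
    then show False using det_nz[of w] by (simp add: det_2)
  qed
  moreover have "0 \<le> S w" using row_nonneg by (simp add: S_row)
  ultimately show ?thesis by simp
qed

lemma width_pos: "0 < width w" by (simp add: width_def D_pos S_pos)

lemma width_Nil: "width [] = 1 / 2"
  by (simp add: width_def D_def S_def entry_sum_def mat_def det_2)

lemma D_eq: "D w = S w * width w"
  using S_pos[of w] by (simp add: width_def)

section \<open>Almost multiplicativity of \<open>S\<close> and \<open>width\<close>\<close>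

lemma S_append:
  "S (u @ v) = (word_matrix A u $ 1 $ 1 + word_matrix A u $ 2 $ 1) * row v 1
     + (word_matrix A u $ 1 $ 2 + word_matrix A u $ 2 $ 2) * row v 2"
  by (simp add: S_def entry_sum_def row_def word_matrix_append matrix_mult_2 algebra_simps)

lemma S_append_le: "S (u @ v) \<le> S u * S v"
proof -
  have r: "row v j \<le> S v" for j
    using exhaust_2[of j] row_nonneg[of v 1] row_nonneg[of v 2] by (auto simp: S_row)
  have "S (u @ v) \<le> (word_matrix A u $ 1 $ 1 + word_matrix A u $ 2 $ 1) * S v
     + (word_matrix A u $ 1 $ 2 + word_matrix A u $ 2 $ 2) * S v"
    unfolding S_append using nonneg r by (intro add_mono mult_left_mono) auto
  then show ?thesis by (simp add: S_def entry_sum_def algebra_simps)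
qed

text \<open>The product \<open>S u * S v\<close> exceeds \<open>S (u @ v)\<close> only because a row
  sum of v is smaller than \<open>S v\<close>, and \<open>S_le_row\<close> bounds this loss
  uniformly.\<close>

lemma S_append_ge: "S u * S v \<le> (1 + kappa) * S (u @ v)"
proof -
  have "(word_matrix A u $ 1 $ 1 + word_matrix A u $ 2 $ 1) * S v
     + (word_matrix A u $ 1 $ 2 + word_matrix A u $ 2 $ 2) * S v \<le>
     (word_matrix A u $ 1 $ 1 + word_matrix A u $ 2 $ 1) * ((1 + kappa) * row v 1)
     + (word_matrix A u $ 1 $ 2 + word_matrix A u $ 2 $ 2) * ((1 + kappa) * row v 2)"
    using nonneg S_le_row by (intro add_mono mult_left_mono) auto
  then show ?thesis unfolding S_append by (simp add: S_def entry_sum_def algebra_simps)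
qed

text \<open>\<open>D\<close> is multiplicative, so each bound for \<open>S\<close> turns into the
  opposite bound for \<open>width\<close>.\<close>

lemma width_append_ge: "width u * width v \<le> width (u @ v)"
proof -
  have "D u * D v / (S u * S v) \<le> D u * D v / S (u @ v)"
    using S_append_le S_pos D_pos[THEN less_imp_le] by (intro divide_left_mono) auto
  then show ?thesis by (simp add: width_def D_append)
qed

lemma width_append_le: "width (u @ v) \<le> (1 + kappa) * width u * width v"
proof -
  have "D u * D v * (S u * S v) \<le> D u * D v * ((1 + kappa) * S (u @ v))"
    using S_append_ge D_pos[THEN less_imp_le] by (intro mult_left_mono) auto
  then show ?thesis using S_pos[of "u @ v"] S_pos[of u] S_pos[of v]
    by (simp add: width_def D_append divide_simps) (simp add: algebra_simps)
qed

lemma width_le_S: "width w \<le> S w"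
proof -
  define B where "B = word_matrix A w"
  have n: "0 \<le> B$i$j" for i j using nonneg by (simp add: B_def)
  have "D w \<le> B$1$1 * B$2$2 + B$1$2 * B$2$1"
    using n[of 1 1] n[of 1 2] n[of 2 1] n[of 2 2]
    unfolding D_def B_def[symmetric] det_2 by (simp add: abs_le_iff algebra_simps)
  also have "\<dots> \<le> (B$1$1 + B$1$2) * (B$2$1 + B$2$2)"
    using n by (simp add: algebra_simps)
  also have "\<dots> \<le> S w * S w"
    unfolding S_def entry_sum_def B_def[symmetric] using n by (intro mult_mono) auto
  finally show ?thesis using S_pos[of w] by (simp add: width_def field_simps)
qed

lemma norm_word_le: "norm (word_matrix A w *v v) \<le> S w * norm v"
  unfolding S_def by (rule norm_mult_le_entry_sum[OF nonneg])

lemma norm_word_ge: "width w * norm v \<le> norm (word_matrix A w *v v)"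
  using abs_det_le_norm_mult[of "word_matrix A w" v, OF nonneg] S_pos[of w]
  by (simp add: width_def D_def S_def[symmetric] field_simps)

text \<open>The image of a bounded set lies within about \<open>width w\<close> of a line, and
  comparable row sums keep this line away from the vertical. Hence the first coordinate controls the
  norm up to an error of order \<open>width w\<close>. The proof solves for the second coordinate by
  Cramer's rule.\<close>

lemma norm_word_first_coord:
  "norm (word_matrix A w *v v)
     \<le> (1 + kappa) * (\<bar>(word_matrix A w *v v) $ 1\<bar> + 2 * width w * norm v)"
proof -
  define B where "B = word_matrix A w"
  define u where "u = B *v v"
  have n: "0 \<le> B$i$j" for i j using nonneg by (simp add: B_def)
  have d: "\<bar>det B\<bar> = D w" by (simp add: D_def B_def)
  have "B$1$1 * u$2 - B$2$1 * u$1 = det B * v$2" "B$1$2 * u$2 - B$2$2 * u$1 = - (det B * v$1)"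
    by (simp_all add: u_def matrix_vector_2 det_2 algebra_simps)
  then have "\<bar>B$1$1 * u$2\<bar> \<le> \<bar>B$2$1 * u$1\<bar> + \<bar>det B * v$2\<bar>"
      "\<bar>B$1$2 * u$2\<bar> \<le> \<bar>B$2$2 * u$1\<bar> + \<bar>det B * v$1\<bar>"
    by linarith+
  then have "(B$1$1 + B$1$2) * \<bar>u$2\<bar> \<le> (B$2$1 + B$2$2) * \<bar>u$1\<bar> + D w * (\<bar>v$1\<bar> + \<bar>v$2\<bar>)"
    using n by (simp add: abs_mult d algebra_simps)
  then have 1: "row w 1 * \<bar>u$2\<bar> \<le> row w 2 * \<bar>u$1\<bar> + D w * (\<bar>v$1\<bar> + \<bar>v$2\<bar>)"
    by (simp add: row_def B_def)
  have "D w * (\<bar>v$1\<bar> + \<bar>v$2\<bar>) \<le> D w * (2 * norm v)"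
    using D_pos[of w] abs_sum_le_norm_vec2 by (intro mult_left_mono) auto
  also have "\<dots> \<le> ((1 + kappa) * row w 1) * width w * (2 * norm v)"
    unfolding D_eq using S_le_row width_pos[of w] by (intro mult_right_mono) auto
  finally have 2: "D w * (\<bar>v$1\<bar> + \<bar>v$2\<bar>) \<le> row w 1 * ((1 + kappa) * (2 * width w * norm v))"
    by (simp add: algebra_simps)
  have 3: "row w 2 * \<bar>u$1\<bar> \<le> row w 1 * (kappa * \<bar>u$1\<bar>)"
    using mult_right_mono[OF row_le[of w 2 1], of "\<bar>u$1\<bar>"] by (simp add: algebra_simps)
  have r: "0 < row w 1"
  proof (rule ccontr)
    assume "\<not> 0 < row w 1"
    then have "row w 1 = 0" using row_nonneg[of w 1] by simp
    then show False using S_le_row[of w 1] S_pos[of w] by simp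
  qed
  have "row w 1 * \<bar>u$2\<bar> \<le> row w 1 * (kappa * \<bar>u$1\<bar> + (1 + kappa) * (2 * width w * norm v))"
    using 1 2 3 by (simp add: distrib_left)
  then have "\<bar>u$2\<bar> \<le> kappa * \<bar>u$1\<bar> + (1 + kappa) * (2 * width w * norm v)"
    using r by simp
  then have "norm u \<le> (1 + kappa) * (\<bar>u$1\<bar> + 2 * width w * norm v)"
    using norm_vec2_le[of u] by (simp add: algebra_simps)
  then show ?thesis by (simp add: u_def B_def)
qed

lemma norm_word_contraction:
  obtains \<theta> where "0 < \<theta>" "\<theta> < 1" "\<And>w v. norm (word_matrix A w *v v) \<le> \<theta> ^ length w * norm v"
proof -
  define \<theta> where "\<theta> = Max (range (\<lambda>i. onorm ((*v) (A i))))"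
  have fin: "finite (range (\<lambda>i. onorm ((*v) (A i))))" by simp
  have le: "onorm ((*v) (A i)) \<le> \<theta>" for i unfolding \<theta>_def by (rule Max_ge) auto
  have "\<theta> < 1" unfolding \<theta>_def using contracting by (subst Max_less_iff) auto
  have step: "norm (A i *v v) \<le> \<theta> * norm v" for i v
    using onorm[OF matrix_vector_mul_bounded_linear[of "A i"], of v]
      mult_right_mono[OF le norm_ge_zero] by (meson order_trans)
  have "0 < \<theta>"
  proof -
    have "(A undefined *v axis 1 1) $ 1 \<noteq> 0"
      using positive[of undefined 1 1] by (simp add: matrix_vector_2 axis_def)
    then have "A undefined *v axis 1 1 \<noteq> 0" by (metis zero_index)
    then have "0 < norm (A undefined *v axis 1 1)" by simp
    also have "\<dots> \<le> \<theta>" using step[of undefined "axis 1 1"] by simp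
    finally show ?thesis .
  qed
  moreover have "norm (word_matrix A w *v v) \<le> \<theta> ^ length w * norm v" for w v
  proof (induction w)
    case Nil then show ?case by simp
  next
    case (Cons i w)
    have "norm (word_matrix A (i # w) *v v) \<le> \<theta> * norm (word_matrix A w *v v)"
      using step by (simp add: matrix_vector_mul_assoc[symmetric])
    also have "\<dots> \<le> \<theta> * (\<theta> ^ length w * norm v)"
      using Cons \<open>0 < \<theta>\<close> by (intro mult_left_mono) auto
    finally show ?case by simp
  qed
  ultimately show ?thesis using that \<open>\<theta> < 1\<close> by blast
qed

lemma S_decay: obtains \<theta> where "0 < \<theta>" "\<theta> < 1" "\<And>w. S w \<le> 4 * \<theta> ^ length w"
proof -
  obtain \<theta> where \<theta>: "0 < \<theta>" "\<theta> < 1" "\<And>w v. norm (word_matrix A w *v v) \<le> \<theta> ^ length w * norm v"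
    by (rule norm_word_contraction) blast
  have "word_matrix A w $ i $ j \<le> \<theta> ^ length w" for w i j
  proof -
    have "word_matrix A w $ i $ j = (word_matrix A w *v axis j 1) $ i"
      using exhaust_2[of j] by (auto simp: matrix_vector_2 axis_def)
    also have "\<dots> \<le> norm (word_matrix A w *v axis j 1)"
      using component_le_norm_cart abs_le_iff by blast
    also have "\<dots> \<le> \<theta> ^ length w" using \<theta>(3)[of w "axis j 1"] by simp
    finally show ?thesis .
  qed
  then have "S w \<le> 4 * \<theta> ^ length w" for w
    unfolding S_def entry_sum_def by (smt (verit))
  then show ?thesis using that \<theta>(1,2) by blast
qed

lemma S_le_4: "S w \<le> 4"
proof -
  obtain \<theta> where "0 < \<theta>" "\<theta> < 1" "\<And>w. S w \<le> 4 * \<theta> ^ length w"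
    by (rule S_decay) blast
  then show ?thesis
    using power_le_one[of \<theta> "length w"] by (smt (verit))
qed

text \<open>\<open>D w / (S w)^2\<close> is the rate at which directions contract. The determinant
  is multiplicative and the permanent supermultiplicative on nonnegative matrices; for a positive
  matrix the absolute determinant is strictly smaller than the permanent, with a uniform ratio over
  the finite alphabet.\<close>

lemma D_decay: obtains \<gamma> where "0 < \<gamma>" "\<gamma> < 1" "\<And>w. D w \<le> \<gamma> ^ length w * (S w)\<^sup>2"
proof -
  define perm :: "real^2^2 \<Rightarrow> real" where "perm B = B$1$1 * B$2$2 + B$1$2 * B$2$1" for B
  define \<gamma> where "\<gamma> = Max (range (\<lambda>i. \<bar>det (A i)\<bar> / perm (A i)))"
  have perm_pos: "0 < perm (A i)" for i using positive by (simp add: perm_def add_pos_pos)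
  have less: "\<bar>det (A i)\<bar> < perm (A i)" for i
  proof -
    have "0 < A i$1$1 * A i$2$2" "0 < A i$1$2 * A i$2$1" using positive by simp_all
    then show ?thesis unfolding det_2 perm_def by linarith
  qed
  have "\<gamma> < 1" unfolding \<gamma>_def using less perm_pos by (subst Max_less_iff) (auto simp: field_simps)
  have le: "\<bar>det (A i)\<bar> \<le> \<gamma> * perm (A i)" for i
  proof -
    have "\<bar>det (A i)\<bar> / perm (A i) \<le> \<gamma>" unfolding \<gamma>_def by (rule Max_ge) auto
    then show ?thesis using perm_pos[of i] by (simp add: field_simps)
  qed
  have "0 < \<gamma>" using le[of undefined] perm_pos[of undefined] invertible[of undefined]
    by (metis invertible_det_nz less_le_trans zero_less_abs_iff zero_less_mult_pos2)
  have perm_nonneg: "0 \<le> perm (word_matrix A w)" for w using nonneg by (simp add: perm_def)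
  have perm_mult: "perm (A i) * perm (word_matrix A w) \<le> perm (word_matrix A (i # w))" for i w
  proof -
    define B C where "B = A i" and "C = word_matrix A w"
    have "0 \<le> B$1$1 * C$1$1 * (B$2$1 * C$1$2)" "0 \<le> B$1$2 * C$2$1 * (B$2$2 * C$2$2)"
      using positive[of i, THEN less_imp_le] nonneg[of w] by (simp_all add: B_def C_def)
    then have "perm B * perm C \<le> perm (B ** C)"
      by (simp add: perm_def matrix_mult_2 algebra_simps)
    then show ?thesis by (simp add: B_def C_def)
  qed
  have "D w \<le> \<gamma> ^ length w * perm (word_matrix A w)" for w
  proof (induction w)
    case Nil then show ?case by (simp add: D_def perm_def mat_def det_2)
  next
    case (Cons i w)
    have "D (i # w) = \<bar>det (A i)\<bar> * D w" by (simp add: D_def det_mul abs_mult)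
    also have "\<dots> \<le> (\<gamma> * perm (A i)) * (\<gamma> ^ length w * perm (word_matrix A w))"
      using Cons le D_pos[of w] \<open>0 < \<gamma>\<close> perm_pos[of i] by (intro mult_mono) auto
    also have "\<dots> = \<gamma> ^ length (i # w) * (perm (A i) * perm (word_matrix A w))" by simp
    also have "\<dots> \<le> \<gamma> ^ length (i # w) * perm (word_matrix A (i # w))"
      using perm_mult \<open>0 < \<gamma>\<close> by (intro mult_left_mono) auto
    finally show ?case .
  qed
  moreover have "\<gamma> ^ length w * perm (word_matrix A w) \<le> \<gamma> ^ length w * (S w)\<^sup>2" for w
  proof (rule mult_left_mono)
    define B where "B = word_matrix A w"
    have n: "0 \<le> B$i$j" for i j using nonneg by (simp add: B_def)
    have "perm B \<le> (B$1$1 + B$1$2) * (B$2$1 + B$2$2)"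
      using n by (simp add: perm_def algebra_simps)
    also have "\<dots> \<le> S w * S w"
      unfolding S_def entry_sum_def B_def[symmetric] using n by (intro mult_mono) auto
    finally show "perm (word_matrix A w) \<le> (S w)\<^sup>2" by (simp add: B_def power2_eq_square)
  qed (use \<open>0 < \<gamma>\<close> in auto)
  ultimately show ?thesis using that \<open>0 < \<gamma>\<close> \<open>\<gamma> < 1\<close> by (meson order_trans)
qed

lemma width_decay_ge: obtains \<beta> where "0 < \<beta>" "\<beta> < 1" "\<And>u v. width u * \<beta> ^ length v \<le> width (u @ v)"
proof -
  \<comment> \<open>The bound 1/2 ensures \<open>\<beta> < 1\<close>.\<close>
  define \<beta> where "\<beta> = min (1/2) (Min (range (\<lambda>i. width [i])))"
  have "0 < \<beta>" unfolding \<beta>_def using width_pos by (simp add: Min_gr_iff)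
  moreover have "\<beta> < 1" by (simp add: \<beta>_def)
  moreover have "width u * \<beta> ^ length v \<le> width (u @ v)" for u v
  proof (induction v arbitrary: u)
    case Nil then show ?case by simp
  next
    case (Cons i v)
    have "\<beta> \<le> width [i]" unfolding \<beta>_def by (rule min.coboundedI2) (rule Min_le, auto)
    then have "width u * \<beta> \<le> width (u @ [i])"
      using width_append_ge[of u "[i]"] width_pos[of u] by (smt (verit) mult_left_mono)
    then have "width u * \<beta> * \<beta> ^ length v \<le> width (u @ [i]) * \<beta> ^ length v"
      using \<open>0 < \<beta>\<close> by (intro mult_right_mono) auto
    also have "\<dots> \<le> width ((u @ [i]) @ v)" by (rule Cons)
    finally show ?case by (simp add: mult.assoc)
  qed
  ultimately show ?thesis using that by blast
qed

text \<open>On the fourth quadrant the adjugate of a nonnegative matrix acts without cancellation,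
  so it preserves the quadrant and stretches each of its vectors by about \<open>S w\<close>. Up to
  sign, this quadrant represents the directions in \<open>Q2\<close>.\<close>

lemma adjugate2_cone:
  assumes "0 \<le> q $ 1" "q $ 2 \<le> 0"
    and p_def: "p = adjugate2 (word_matrix A w) *v q"
  shows "0 \<le> p $ 1" "p $ 2 \<le> 0" "S w * norm q \<le> 2 * (1 + kappa) * norm p"
proof -
  define B where "B = word_matrix A w"
  have n: "0 \<le> B$i$j" for i j using nonneg by (simp add: B_def)
  have p1: "p$1 = B$2$2 * q$1 + B$1$2 * (- q$2)" and p2: "- p$2 = B$2$1 * q$1 + B$1$1 * (- q$2)"
    by (simp_all add: p_def B_def adjugate2_def matrix_vector_2)
  have s: "0 \<le> - q$2" using assms by simp
  show 1: "0 \<le> p$1" unfolding p1 using n assms(1) s by (intro add_nonneg_nonneg mult_nonneg_nonneg)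
  have "0 \<le> - p$2" unfolding p2 using n assms(1) s by (intro add_nonneg_nonneg mult_nonneg_nonneg)
  then show 2: "p$2 \<le> 0" by simp
  have "S w * norm q \<le> S w * (q$1 + (- q$2))"
    using norm_vec2_le[of q] S_pos[of w] assms by (intro mult_left_mono) auto
  also have "\<dots> = S w * q$1 + S w * (- q$2)" by (simp add: algebra_simps)
  also have "\<dots> \<le> ((1 + kappa) * row w 2) * q$1 + ((1 + kappa) * row w 1) * (- q$2)"
    using S_le_row assms(1) s by (intro add_mono mult_right_mono) auto
  also have "\<dots> = (1 + kappa) * (p$1 + - p$2)"
    unfolding p1 p2 by (simp add: row_def B_def algebra_simps)
  also have "\<dots> \<le> (1 + kappa) * (2 * norm p)"
    using abs_sum_le_norm_vec2[of p] 1 2 kappa_ge_1 by (intro mult_left_mono) auto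
  finally show "S w * norm q \<le> 2 * (1 + kappa) * norm p" by (simp only: mult_ac)
qed

end

section \<open>Dimension estimates\<close>

text \<open>A quantitative form of "upper box dimension at most t". It serves twice: for vanishing
  Hausdorff measures of exponent above t, and for the upper bound on covering numbers.\<close>

definition covered_with_exponent :: "real \<Rightarrow> 'a::metric_space set \<Rightarrow> bool" where
  "covered_with_exponent t F \<longleftrightarrow> (\<exists>C. \<forall>\<delta>. 0 < \<delta> \<longrightarrow> \<delta> \<le> 1 \<longrightarrow>
     (\<exists>\<U>. finite \<U> \<and> real (card \<U>) \<le> C * \<delta> powr (- t) \<and> F \<subseteq> \<Union>\<U> \<and>
        (\<forall>U\<in>\<U>. bounded U \<and> diameter U \<le> \<delta>)))"

lemma hausdorff_content_le_suminf:
  assumes "F \<subseteq> (\<Union>i. U i)" "\<And>i. bounded (U i)" "\<And>i. diameter (U i) \<le> \<delta>"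
  shows "hausdorff_content \<delta> s F \<le> (\<Sum>i. diameter_gauge s (U i))"
  unfolding hausdorff_content_def using assms by (intro INF_lower) auto

lemma hausdorff_content_le_card:
  assumes "finite \<U>" "F \<subseteq> \<Union>\<U>" "\<And>U. U \<in> \<U> \<Longrightarrow> bounded U \<and> diameter U \<le> \<epsilon>" "0 \<le> \<epsilon>" "\<epsilon> \<le> \<delta>" "0 < u"
  shows "hausdorff_content \<delta> u F \<le> of_nat (card \<U>) * ennreal (\<epsilon> powr u)"
proof -
  obtain f where f: "bij_betw f {0..<card \<U>} \<U>"
    using ex_bij_betw_nat_finite[OF assms(1)] by blast
  \<comment> \<open>The content is defined through sequences of sets; padding with \<open>{}\<close>
    is free, since its gauge is 0.\<close>
  define U where "U i = (if i < card \<U> then f i else {})" for i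
  have U: "U i \<in> \<U>" if "i < card \<U>" for i
    using that f by (auto simp: U_def bij_betw_def)
  have "F \<subseteq> (\<Union>i. U i)"
  proof
    fix x assume "x \<in> F"
    then obtain V where "V \<in> \<U>" "x \<in> V" using assms(2) by blast
    moreover have "V \<in> f ` {0..<card \<U>}" using f \<open>V \<in> \<U>\<close> by (simp add: bij_betw_def)
    ultimately obtain i where "i < card \<U>" "f i = V" by auto
    then show "x \<in> (\<Union>i. U i)" using \<open>x \<in> V\<close> by (auto simp: U_def)
  qed
  moreover have "bounded (U i) \<and> diameter (U i) \<le> \<delta>" for i
    using U[of i] assms(3,4,5) by (cases "i < card \<U>") (fastforce, auto simp: U_def)
  ultimately have "hausdorff_content \<delta> u F \<le> (\<Sum>i. diameter_gauge u (U i))"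
    by (intro hausdorff_content_le_suminf) auto
  also have "\<dots> = (\<Sum>i<card \<U>. diameter_gauge u (U i))"
    by (rule suminf_finite) (auto simp: U_def diameter_gauge_def)
  also have "\<dots> \<le> (\<Sum>i<card \<U>. ennreal (\<epsilon> powr u))"
  proof (rule sum_mono)
    fix i assume "i \<in> {..<card \<U>}"
    then have "bounded (U i)" "diameter (U i) \<le> \<epsilon>" using U assms(3) by auto
    then have "diameter (U i) powr u \<le> \<epsilon> powr u"
      using assms(6) diameter_ge_0 by (intro powr_mono2) auto
    then show "diameter_gauge u (U i) \<le> ennreal (\<epsilon> powr u)"
      using assms(6) by (auto simp: diameter_gauge_def intro: ennreal_leI)
  qed
  finally show ?thesis by simp
qed

lemma covered_hausdorff_measure_zero:
  assumes cov: "covered_with_exponent t F" and "0 \<le> t" "t < u"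
  shows "hausdorff_measure u F = 0"
proof -
  obtain C where C: "\<And>\<delta>. 0 < \<delta> \<Longrightarrow> \<delta> \<le> 1 \<Longrightarrow>
     (\<exists>\<U>. finite \<U> \<and> real (card \<U>) \<le> C * \<delta> powr (- t) \<and> F \<subseteq> \<Union>\<U> \<and>
        (\<forall>U\<in>\<U>. bounded U \<and> diameter U \<le> \<delta>))"
    using cov unfolding covered_with_exponent_def by blast
  have "hausdorff_content \<delta> u F \<le> 0" if "0 < \<delta>" for \<delta>
  proof (rule tendsto_lowerbound)
    have "((\<lambda>\<epsilon>. C * \<epsilon> powr (u - t)) \<longlongrightarrow> C * 0 powr (u - t)) (at_right 0)"
      using assms by (intro tendsto_mult tendsto_const tendsto_powr')
        (auto intro: tendsto_ident_at simp: eventually_at_right_field intro!: exI[of _ 1])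
    then show "((\<lambda>\<epsilon>. ennreal (C * \<epsilon> powr (u - t))) \<longlongrightarrow> 0) (at_right 0)"
      using tendsto_ennrealI by fastforce
    show "\<forall>\<^sub>F \<epsilon> in at_right 0. hausdorff_content \<delta> u F \<le> ennreal (C * \<epsilon> powr (u - t))"
      unfolding eventually_at_right_field
    proof (intro exI conjI allI impI)
      show "0 < min \<delta> 1" using that by simp
      fix \<epsilon> :: real assume e: "0 < \<epsilon>" "\<epsilon> < min \<delta> 1"
      then obtain \<U> where \<U>: "finite \<U>" "real (card \<U>) \<le> C * \<epsilon> powr (- t)" "F \<subseteq> \<Union>\<U>"
        "\<And>U. U \<in> \<U> \<Longrightarrow> bounded U \<and> diameter U \<le> \<epsilon>" using C[of \<epsilon>] by auto
      have "hausdorff_content \<delta> u F \<le> of_nat (card \<U>) * ennreal (\<epsilon> powr u)"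
        using e assms \<U> by (intro hausdorff_content_le_card) auto
      also have "\<dots> = ennreal (real (card \<U>) * \<epsilon> powr u)"
        by (simp add: ennreal_mult ennreal_of_nat_eq_real_of_nat)
      also have "\<dots> \<le> ennreal ((C * \<epsilon> powr (- t)) * \<epsilon> powr u)"
        using \<U>(2) by (intro ennreal_leI mult_right_mono) auto
      also have "(C * \<epsilon> powr (- t)) * \<epsilon> powr u = C * \<epsilon> powr (u - t)"
        by (simp add: powr_add[symmetric])
      finally show "hausdorff_content \<delta> u F \<le> ennreal (C * \<epsilon> powr (u - t))" .
    qed
  qed simp
  then show ?thesis unfolding hausdorff_measure_def by (auto intro!: antisym SUP_least)
qed

lemma hausdorff_dim_le:
  assumes "\<And>u. s < u \<Longrightarrow> hausdorff_measure u F = 0" "0 \<le> s"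
  shows "hausdorff_dim F \<le> ereal s"
proof (rule ereal_le_epsilon2)
  fix e :: real assume "0 < e"
  then have "hausdorff_measure (s + e) F = 0" using assms by simp
  then have "hausdorff_dim F \<le> ereal (s + e)"
    unfolding hausdorff_dim_def using assms(2) \<open>0 < e\<close> by (intro Inf_lower) auto
  then show "hausdorff_dim F \<le> ereal s + ereal e" by simp
qed

lemma hausdorff_dim_ge:
  assumes "\<And>u. 0 \<le> u \<Longrightarrow> u < s \<Longrightarrow> hausdorff_measure u F \<noteq> 0"
  shows "ereal s \<le> hausdorff_dim F"
  unfolding hausdorff_dim_def using assms by (intro Inf_greatest) force

text \<open>Choose for each point a ball of mass more than q times its radius; this forces the
  radius below K / q. Disjoint balls from the Vitali lemma have radii of sum at most K / q, and
  their fivefold enlargements cover X, with diameters 10 times the radii. Then let q tend to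
  infinity.\<close>

lemma vitali_hausdorff_measure_1:
  fixes X :: "'a::euclidean_space set"
    and M :: "'a measure"
  assumes fin: "finite_measure M" and sets: "sets M = sets borel"
    and X: "\<And>x j. x \<in> X \<Longrightarrow> \<exists>r>0. real j * r < measure M (cball x r)"
  shows "hausdorff_measure 1 X = 0"
proof -
  interpret finite_measure M by (rule fin)
  define K where "K = measure M UNIV"
  have spc: "space M = UNIV" using sets_eq_imp_space_eq[OF sets] by simp
  have K: "measure M Y \<le> K" for Y using bounded_measure[of Y] by (simp add: K_def spc)
  have "hausdorff_content \<delta> 1 X \<le> ennreal (10 * K / real (Suc j))"
    if \<delta>: "0 < \<delta>" and j: "10 * K / real (Suc j) \<le> \<delta>" for \<delta> j
  proof -
    define q where "q = real (Suc j)"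
    have q: "0 < q" by (simp add: q_def)
    have "\<forall>x\<in>X. \<exists>r>0. q * r < measure M (cball x r)" using X q_def by blast
    then obtain r where r: "\<And>x. x \<in> X \<Longrightarrow> 0 < r x" "\<And>x. x \<in> X \<Longrightarrow> q * r x < measure M (cball x (r x))"
      by metis
    have rK: "r x \<le> K / q" if "x \<in> X" for x
      using r(2)[OF that] K[of "cball x (r x)"] q by (simp add: field_simps)
    have cov: "X \<subseteq> (\<Union>x\<in>X. cball x (r x))"
    proof
      fix x assume "x \<in> X"
      then show "x \<in> (\<Union>x\<in>X. cball x (r x))" using less_imp_le[OF r(1)] by (intro UN_I[of x]) auto
    qed
    have rr: "0 < r x \<and> r x \<le> K / q" if "x \<in> X" for x using r(1) rK that by blast
    obtain C where C: "countable C" "C \<subseteq> X"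
      "pairwise (\<lambda>x y. disjnt (cball x (r x)) (cball y (r y))) C"
      "X \<subseteq> (\<Union>x\<in>C. cball x (5 * r x))"
      by (rule Vitali_covering_lemma_cballs[where a = "\<lambda>x. x", OF cov rr]) blast+
    define P where "P = to_nat_on C ` C"
    define c where "c n = inv_into C (to_nat_on C) n" for n
    have c: "c n \<in> C" if "n \<in> P" for n using that by (simp add: c_def P_def inv_into_into)
    have c_inj: "n = m" if "n \<in> P" "m \<in> P" "c n = c m" for n m
      using that by (metis P_def c_def f_inv_into_f)
    have c_surj: "\<exists>n\<in>P. c n = x" if "x \<in> C" for x
    proof (rule bexI)
      show "c (to_nat_on C x) = x"
        unfolding c_def by (rule inv_into_f_f[OF inj_on_to_nat_on[OF C(1)] that])
      show "to_nat_on C x \<in> P" using that by (simp add: P_def)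
    qed
    define B where "B n = (if n \<in> P then cball (c n) (r (c n)) else {})" for n
    define U where "U n = (if n \<in> P then cball (c n) (5 * r (c n)) else {})" for n
    have "disjoint_family B"
      unfolding disjoint_family_on_def
    proof (intro ballI impI)
      fix m n :: nat assume "m \<noteq> n"
      show "B m \<inter> B n = {}"
      proof (cases "m \<in> P \<and> n \<in> P")
        case True
        then have "c m \<noteq> c n" "c m \<in> C" "c n \<in> C" using c_inj c \<open>m \<noteq> n\<close> by auto
        then show ?thesis using pairwiseD[OF C(3)] True unfolding B_def disjnt_def by metis
      qed (auto simp: B_def)
    qed
    have Bs: "range B \<subseteq> sets M" by (auto simp: B_def sets)
    have dU: "diameter (U n) \<le> 10 * r (c n)" if "n \<in> P" for n
      using that r(1)[of "c n"] c[OF that] C(2) by (auto simp: U_def)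
    have "X \<subseteq> (\<Union>n. U n)"
    proof
      fix x assume "x \<in> X"
      then obtain y where y: "y \<in> C" "x \<in> cball y (5 * r y)" using C(4) by blast
      obtain n where "n \<in> P" "c n = y" using c_surj[OF y(1)] by blast
      then show "x \<in> (\<Union>n. U n)" using y(2) by (auto simp: U_def)
    qed
    moreover have "diameter (U n) \<le> \<delta>" for n
    proof (cases "n \<in> P")
      case True
      have "diameter (U n) \<le> 10 * (K / q)"
        using dU[OF True] rK[of "c n"] c[OF True] C(2) by auto
      then show ?thesis using j by (simp add: q_def)
    next
      case False then show ?thesis using \<delta> by (simp add: U_def)
    qed
    ultimately have "hausdorff_content \<delta> 1 X \<le> (\<Sum>n. diameter_gauge 1 (U n))"
      by (intro hausdorff_content_le_suminf) (auto simp: U_def)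
    also have "\<dots> \<le> (\<Sum>n. ennreal (10 / q) * emeasure M (B n))"
    proof (rule suminf_le)
      fix n show "diameter_gauge 1 (U n) \<le> ennreal (10 / q) * emeasure M (B n)"
      proof (cases "n \<in> P")
        case True
        then have "10 * r (c n) \<le> (10 / q) * measure M (B n)"
          using r(2)[of "c n"] c[OF True] C(2) q by (auto simp: B_def field_simps)
        then have "diameter (U n) \<le> (10 / q) * measure M (B n)" using dU[OF True] by simp
        then have "ennreal (diameter (U n)) \<le> ennreal (10 / q) * emeasure M (B n)"
          using q by (simp add: emeasure_eq_measure ennreal_mult[symmetric] ennreal_leI)
        then show ?thesis using diameter_ge_0[of "U n"]
          by (auto simp: diameter_gauge_def U_def)
      qed (simp add: U_def diameter_gauge_def)
    qed auto
    also have "\<dots> = ennreal (10 / q) * emeasure M (\<Union>n. B n)"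
      using Bs \<open>disjoint_family B\<close> by (simp add: suminf_emeasure)
    also have "\<dots> \<le> ennreal (10 / q) * ennreal K"
      using K by (intro mult_left_mono) (auto simp: emeasure_eq_measure ennreal_leI)
    also have "\<dots> = ennreal (10 * K / q)"
      using q by (subst ennreal_mult[symmetric]) (auto simp: K_def)
    finally show ?thesis by (simp add: q_def)
  qed note bound = this
  have "hausdorff_content \<delta> 1 X \<le> 0" if "0 < \<delta>" for \<delta>
  proof (rule tendsto_lowerbound)
    have lim: "(\<lambda>j. 10 * K / real (Suc j)) \<longlonglongrightarrow> 0"
      by (rule LIMSEQ_Suc[OF lim_const_over_n])
    then show "(\<lambda>j. ennreal (10 * K / real (Suc j))) \<longlonglongrightarrow> 0"
      using tendsto_ennrealI by fastforce
    have "\<forall>\<^sub>F j in sequentially. 10 * K / real (Suc j) < \<delta>"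
      using order_tendstoD(2)[OF lim that] .
    then show "\<forall>\<^sub>F j in sequentially. hausdorff_content \<delta> 1 X \<le> ennreal (10 * K / real (Suc j))"
      by eventually_elim (use bound that in auto)
  qed simp
  then show ?thesis unfolding hausdorff_measure_def by (auto intro!: antisym SUP_least)
qed

lemma hausdorff_measure_mono_exponent:
  assumes "hausdorff_measure 1 X = 0" "1 < u"
  shows "hausdorff_measure u X = 0"
proof -
  have "hausdorff_content \<delta> u X \<le> 0" if "0 < \<delta>" for \<delta>
  proof -
    have le: "hausdorff_content \<delta> u X \<le> hausdorff_content (min \<delta> 1) 1 X"
      unfolding hausdorff_content_def
    proof (rule INF_mono)
      fix U :: "nat \<Rightarrow> 'a set"
      assume U: "U \<in> {U. X \<subseteq> (\<Union>i. U i) \<and> (\<forall>i. bounded (U i) \<and> diameter (U i) \<le> min \<delta> 1)}"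
      have "diameter_gauge u (U i) \<le> diameter_gauge 1 (U i)" for i
      proof -
        have d: "0 \<le> diameter (U i)" "diameter (U i) \<le> 1" using U diameter_ge_0 by auto
        then have "diameter (U i) powr u \<le> diameter (U i) powr 1"
          using assms(2) powr_mono'[of 1 u "diameter (U i)"] by simp
        then show ?thesis using assms(2) by (auto simp: diameter_gauge_def intro!: ennreal_leI)
      qed
      then have "(\<Sum>i. diameter_gauge u (U i)) \<le> (\<Sum>i. diameter_gauge 1 (U i))"
        by (intro suminf_le) auto
      then show "\<exists>V\<in>{U. X \<subseteq> (\<Union>i. U i) \<and> (\<forall>i. bounded (U i) \<and> diameter (U i) \<le> \<delta>)}.
          (\<Sum>i. diameter_gauge u (V i)) \<le> (\<Sum>i. diameter_gauge 1 (U i))"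
        using U by (intro bexI[of _ U]) auto
    qed
    also have "hausdorff_content (min \<delta> 1) 1 X \<le> hausdorff_measure 1 X"
      unfolding hausdorff_measure_def using that by (intro SUP_upper) auto
    finally show ?thesis using assms(1) by simp
  qed
  then show ?thesis unfolding hausdorff_measure_def by (auto intro!: antisym SUP_least)
qed

section \<open>The mass distribution principle\<close>

text \<open>The covering sets need not be measurable, so each is enlarged to a ball about a point of \<open>H\<close>.\<close>

lemma frostman_meets:
  fixes H U :: "'a::metric_space set"
    and M :: "'a measure"
  assumes fin: "finite_measure M" and sets: "sets M = sets borel"
    and H: "\<And>x r. x \<in> H \<Longrightarrow> 0 < r \<Longrightarrow> measure M (cball x r) \<le> j * r powr t"
    and "0 < t" "0 \<le> j" and U: "bounded U"
  obtains V where "V \<in> sets M" "U \<inter> H \<subseteq> V" "measure M V \<le> j * diameter U powr t"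
    "U = {} \<Longrightarrow> V = {}"
proof -
  interpret finite_measure M by (rule fin)
  show ?thesis
  proof (cases "U \<inter> H = {}")
  case True
  then show ?thesis using that[of "{}"] \<open>0 \<le> j\<close> by auto
next
  case False
  then obtain x where x: "x \<in> U" "x \<in> H" by auto
  define d where "d = diameter U"
  have "U \<subseteq> cball x d" using diameter_bounded_bound[OF U x(1)] by (auto simp: d_def)
  moreover have "measure M (cball x d) \<le> j * d powr t"
  \<comment> \<open>The hypothesis concerns positive radii only. For diameter 0 it is applied to
    radii tending to 0, and the limit agrees with the claim because
    \<open>0 powr t = 0\<close>.\<close>
  proof (cases "d = 0")
    case True
    have lim: "(\<lambda>n. j * (1 / real (Suc n)) powr t) \<longlonglongrightarrow> j * 0 powr t"
      using \<open>0 < t\<close> by (intro tendsto_mult tendsto_const tendsto_powr' LIMSEQ_Suc[OF lim_const_over_n]) auto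
    have "measure M (cball x d) \<le> j * (1 / real (Suc n)) powr t" for n
    proof -
      have "measure M (cball x d) \<le> measure M (cball x (1 / real (Suc n)))"
        by (rule finite_measure_mono) (auto simp: True sets)
      also have "\<dots> \<le> j * (1 / real (Suc n)) powr t" using x(2) by (intro H) auto
      finally show ?thesis .
    qed
    then show ?thesis using LIMSEQ_le_const[OF lim] True by auto
  next
    case False
    then show ?thesis using H[OF x(2), of d] diameter_ge_0[OF U] by (simp add: d_def)
  qed
  ultimately show ?thesis using that[of "cball x d"] x by (auto simp: d_def sets)
qed
qed

lemma mass_distribution_hausdorff:
  fixes H F :: "'a::metric_space set"
    and M :: "'a measure"
  assumes fin: "finite_measure M" and sets: "sets M = sets borel"
    and H: "\<And>x r. x \<in> H \<Longrightarrow> 0 < r \<Longrightarrow> measure M (cball x r) \<le> j * r powr t"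
    and "0 < t" "0 < j" "H \<in> sets M" "0 < measure M H" "H \<subseteq> F" "0 \<le> u" "u \<le> t"
  shows "hausdorff_measure u F \<noteq> 0"
proof
  interpret finite_measure M by (rule fin)
  assume "hausdorff_measure u F = 0"
  moreover have "hausdorff_content 1 u F \<le> hausdorff_measure u F"
    unfolding hausdorff_measure_def by (intro SUP_upper) auto
  moreover have "emeasure M H \<le> ennreal j * hausdorff_content 1 u F"
  proof -
    have "emeasure M H / ennreal j \<le> hausdorff_content 1 u F"
      unfolding hausdorff_content_def
    proof (rule INF_greatest)
      fix U :: "nat \<Rightarrow> 'a set"
      assume U: "U \<in> {U. F \<subseteq> (\<Union>i. U i) \<and> (\<forall>i. bounded (U i) \<and> diameter (U i) \<le> 1)}"
      have "\<exists>V. V \<in> sets M \<and> U i \<inter> H \<subseteq> V \<and> measure M V \<le> j * diameter (U i) powr t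
          \<and> (U i = {} \<longrightarrow> V = {})" for i
        using frostman_meets[OF fin sets H \<open>0 < t\<close> less_imp_le[OF \<open>0 < j\<close>], of H "U i"] U
        by (metis (no_types, lifting) mem_Collect_eq)
      then obtain V where V: "\<And>i. V i \<in> sets M" "\<And>i. U i \<inter> H \<subseteq> V i"
        "\<And>i. measure M (V i) \<le> j * diameter (U i) powr t" "\<And>i. U i = {} \<Longrightarrow> V i = {}"
        by metis
      have le: "emeasure M (V i) \<le> ennreal j * diameter_gauge u (U i)" for i
      proof -
        have d: "0 \<le> diameter (U i)" "diameter (U i) \<le> 1" using U diameter_ge_0 by auto
        \<comment> \<open>This bound serves u = 0, where the gauge of a non-empty set is 1; the next
          one serves u > 0.\<close>
        have "diameter (U i) powr t \<le> 1"
          using d \<open>0 < t\<close> by (intro powr_le1) auto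
        moreover have "diameter (U i) powr t \<le> diameter (U i) powr u"
          using d \<open>u \<le> t\<close> by (intro powr_mono') auto
        ultimately have "ennreal (diameter (U i) powr t) \<le> diameter_gauge u (U i)" if "U i \<noteq> {}"
          using that by (auto simp: diameter_gauge_def intro: ennreal_leI)
        moreover have "emeasure M (V i) \<le> ennreal j * ennreal (diameter (U i) powr t)"
          using V(3)[of i] \<open>0 < j\<close> by (simp add: emeasure_eq_measure ennreal_mult[symmetric] ennreal_leI)
        ultimately show ?thesis using V(4)[of i]
          by (cases "U i = {}") (simp, meson order_trans mult_left_mono zero_le)
      qed
      have "H \<subseteq> (\<Union>i. V i)" using V(2) U \<open>H \<subseteq> F\<close> by blast
      then have "emeasure M H \<le> emeasure M (\<Union>i. V i)"
        using V(1) by (intro emeasure_mono) auto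
      also have "\<dots> \<le> (\<Sum>i. emeasure M (V i))"
        using V(1) by (intro emeasure_subadditive_countably) auto
      also have "\<dots> \<le> (\<Sum>i. ennreal j * diameter_gauge u (U i))"
        using le by (intro suminf_le) auto
      also have "\<dots> = ennreal j * (\<Sum>i. diameter_gauge u (U i))" by simp
      finally show "emeasure M H / ennreal j \<le> (\<Sum>i. diameter_gauge u (U i))"
        using \<open>0 < j\<close> by (simp add: divide_le_posI_ennreal)
    qed
    then have "ennreal j * (emeasure M H / ennreal j) \<le> ennreal j * hausdorff_content 1 u F"
      by (intro mult_left_mono) auto
    moreover have "ennreal j * (emeasure M H / ennreal j) = emeasure M H"
      using \<open>0 < j\<close> by (simp add: emeasure_eq_measure divide_ennreal ennreal_mult[symmetric])
    ultimately show ?thesis by simp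
  qed
  ultimately show False using \<open>0 < measure M H\<close> by (simp add: emeasure_eq_measure)
qed

lemma mass_distribution_cover:
  fixes H F :: "'a::metric_space set"
    and M :: "'a measure"
  assumes fin: "finite_measure M" and sets: "sets M = sets borel"
    and H: "\<And>x r. x \<in> H \<Longrightarrow> 0 < r \<Longrightarrow> measure M (cball x r) \<le> j * r powr t"
    and "0 < t" "0 \<le> j" "H \<in> sets M" "H \<subseteq> F"
    and \<U>: "finite \<U>" "F \<subseteq> \<Union>\<U>" "\<And>U. U \<in> \<U> \<Longrightarrow> bounded U \<and> diameter U \<le> \<delta>"
  shows "measure M H \<le> real (card \<U>) * (j * \<delta> powr t)"
proof -
  interpret finite_measure M by (rule fin)
  have "\<forall>U\<in>\<U>. \<exists>V. V \<in> sets M \<and> U \<inter> H \<subseteq> V \<and> measure M V \<le> j * diameter U powr t"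
    using frostman_meets[OF fin sets H \<open>0 < t\<close> \<open>0 \<le> j\<close>, of H] \<U>(3) by metis
  then obtain V where V: "\<And>U. U \<in> \<U> \<Longrightarrow> V U \<in> sets M" "\<And>U. U \<in> \<U> \<Longrightarrow> U \<inter> H \<subseteq> V U"
     "\<And>U. U \<in> \<U> \<Longrightarrow> measure M (V U) \<le> j * diameter U powr t"
    by metis
  have "H \<subseteq> (\<Union>U\<in>\<U>. V U)" using V(2) \<U>(2) \<open>H \<subseteq> F\<close> by blast
  then have "measure M H \<le> measure M (\<Union>U\<in>\<U>. V U)"
    using V(1) \<U>(1) by (intro finite_measure_mono) auto
  also have "\<dots> \<le> (\<Sum>U\<in>\<U>. measure M (V U))"
    using V(1) \<U>(1) by (intro finite_measure_subadditive_finite) auto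
  also have "\<dots> \<le> (\<Sum>U\<in>\<U>. j * \<delta> powr t)"
  proof (rule sum_mono)
    fix U assume "U \<in> \<U>"
    then have "diameter U powr t \<le> \<delta> powr t"
      using \<U>(3) diameter_ge_0 \<open>0 < t\<close> by (intro powr_mono2) auto
    then show "measure M (V U) \<le> j * \<delta> powr t"
      using V(3)[OF \<open>U \<in> \<U>\<close>] \<open>0 \<le> j\<close> by (meson mult_left_mono order_trans)
  qed
  finally show ?thesis by simp
qed

section \<open>Covering numbers and the box dimension\<close>

lemma covering_number_witness:
  assumes "finite \<U>" "F \<subseteq> \<Union>\<U>" "\<And>U. U \<in> \<U> \<Longrightarrow> bounded U \<and> diameter U \<le> \<delta>"
  shows "covering_number \<delta> F \<le> card \<U>"
    and "\<exists>\<V>. finite \<V> \<and> card \<V> = covering_number \<delta> F \<and> F \<subseteq> \<Union>\<V> \<and>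
           (\<forall>U\<in>\<V>. bounded U \<and> diameter U \<le> \<delta>)"
proof -
  define P where "P n \<longleftrightarrow> (\<exists>\<U>. finite \<U> \<and> card \<U> = n \<and> F \<subseteq> \<Union>\<U> \<and>
        (\<forall>U\<in>\<U>. bounded U \<and> diameter U \<le> \<delta>))" for n
  have "P (card \<U>)" unfolding P_def using assms by blast
  moreover have "covering_number \<delta> F = (LEAST n. P n)" by (simp add: covering_number_def P_def)
  ultimately have "covering_number \<delta> F \<le> card \<U>" "P (covering_number \<delta> F)"
    by (auto intro: Least_le LeastI)
  then show "covering_number \<delta> F \<le> card \<U>"
    and "\<exists>\<V>. finite \<V> \<and> card \<V> = covering_number \<delta> F \<and> F \<subseteq> \<Union>\<V> \<and>
           (\<forall>U\<in>\<V>. bounded U \<and> diameter U \<le> \<delta>)"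
    by (auto simp: P_def)
qed

lemma tendsto_div_ln_at_right_0: "((\<lambda>\<delta>::real. a + b / (- ln \<delta>)) \<longlongrightarrow> a) (at_right 0)"
proof -
  have "filterlim (\<lambda>\<delta>::real. - ln \<delta>) at_top (at_right 0)"
    using ln_at_0 by (simp add: filterlim_uminus_at_top)
  then have "((\<lambda>\<delta>::real. b / (- ln \<delta>)) \<longlongrightarrow> 0) (at_right 0)"
    by (intro tendsto_divide_0[OF tendsto_const] filterlim_at_top_imp_at_infinity)
  from tendsto_add[OF tendsto_const this] show ?thesis by simp
qed

lemma has_box_dimI:
  assumes cov: "covered_with_exponent s F"
    and low: "\<And>t. 0 < t \<Longrightarrow> t < s \<Longrightarrow> \<exists>c>0. \<forall>\<delta>. 0 < \<delta> \<longrightarrow> \<delta> \<le> 1 \<longrightarrow> c * \<delta> powr (- t) \<le> real (covering_number \<delta> F)"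
    and "0 < s"
  shows "has_box_dim F s"
  unfolding has_box_dim_def
proof (rule order_tendstoI)
  fix y assume "y < s"
  then obtain t where t: "0 < t" "t < s" "y < t"
    using dense[of "max y 0" s] \<open>0 < s\<close> by auto
  obtain c where c: "0 < c" "\<And>\<delta>. 0 < \<delta> \<Longrightarrow> \<delta> \<le> 1 \<Longrightarrow> c * \<delta> powr (- t) \<le> real (covering_number \<delta> F)"
    using low[OF t(1,2)] by blast
  have "\<forall>\<^sub>F \<delta> in at_right 0. y < t + ln c / (- ln \<delta>)"
    using order_tendstoD(1)[OF tendsto_div_ln_at_right_0 t(3)] .
  moreover have "\<forall>\<^sub>F \<delta>::real in at_right 0. 0 < \<delta> \<and> \<delta> < 1"
    unfolding eventually_at_right_field by (intro exI[of _ 1]) auto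
  ultimately show "\<forall>\<^sub>F \<delta> in at_right 0. y < ln (real (covering_number \<delta> F)) / (- ln \<delta>)"
  proof eventually_elim
    case (elim \<delta>)
    have l: "0 < - ln \<delta>" using elim by simp
    have "ln (c * \<delta> powr (- t)) \<le> ln (real (covering_number \<delta> F))"
      using c(1) c(2)[of \<delta>] elim by (intro ln_mono) auto
    moreover have "ln (c * \<delta> powr (- t)) = ln c + t * (- ln \<delta>)"
      using c(1) elim by (simp add: ln_mult ln_powr)
    ultimately have "(ln c + t * (- ln \<delta>)) / (- ln \<delta>) \<le> ln (real (covering_number \<delta> F)) / (- ln \<delta>)"
      using l by (intro divide_right_mono) auto
    moreover have "(ln c + t * (- ln \<delta>)) / (- ln \<delta>) = t + ln c / (- ln \<delta>)"
      using l by (simp add: field_simps)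
    ultimately show ?case using elim by linarith
  qed
next
  fix y assume "s < y"
  obtain C where C: "\<And>\<delta>. 0 < \<delta> \<Longrightarrow> \<delta> \<le> 1 \<Longrightarrow>
     (\<exists>\<U>. finite \<U> \<and> real (card \<U>) \<le> C * \<delta> powr (- s) \<and> F \<subseteq> \<Union>\<U> \<and>
        (\<forall>U\<in>\<U>. bounded U \<and> diameter U \<le> \<delta>))"
    using cov unfolding covered_with_exponent_def by blast
  define c where "c = max C 1"
  have N: "real (covering_number \<delta> F) \<le> c * \<delta> powr (- s)" if d: "0 < \<delta>" "\<delta> \<le> 1" for \<delta>
  proof -
    obtain \<U> where \<U>: "finite \<U>" "real (card \<U>) \<le> C * \<delta> powr (- s)" "F \<subseteq> \<Union>\<U>"
      "\<And>U. U \<in> \<U> \<Longrightarrow> bounded U \<and> diameter U \<le> \<delta>" using C[OF d] by auto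
    have "real (covering_number \<delta> F) \<le> real (card \<U>)"
      using covering_number_witness(1)[OF \<U>(1,3,4)] by simp
    also have "\<dots> \<le> C * \<delta> powr (- s)" by (rule \<U>(2))
    also have "\<dots> \<le> c * \<delta> powr (- s)" by (intro mult_right_mono) (auto simp: c_def)
    finally show ?thesis .
  qed
  have "\<forall>\<^sub>F \<delta> in at_right 0. s + ln c / (- ln \<delta>) < y"
    using order_tendstoD(2)[OF tendsto_div_ln_at_right_0 \<open>s < y\<close>] .
  moreover have "\<forall>\<^sub>F \<delta>::real in at_right 0. 0 < \<delta> \<and> \<delta> < 1"
    unfolding eventually_at_right_field by (intro exI[of _ 1]) auto
  ultimately show "\<forall>\<^sub>F \<delta> in at_right 0. ln (real (covering_number \<delta> F)) / (- ln \<delta>) < y"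
  proof eventually_elim
    case (elim \<delta>)
    have l: "0 < - ln \<delta>" using elim by simp
    have eq: "ln (c * \<delta> powr (- s)) = ln c + s * (- ln \<delta>)"
      using elim by (simp add: ln_mult ln_powr c_def)
    have "0 \<le> ln (c * \<delta> powr (- s))" unfolding eq using l \<open>0 < s\<close>
      by (intro add_nonneg_nonneg mult_nonneg_nonneg) (auto simp: c_def)
    have "ln (real (covering_number \<delta> F)) \<le> ln (c * \<delta> powr (- s))"
    proof (cases "covering_number \<delta> F = 0")
      case True
      then show ?thesis using \<open>0 \<le> ln (c * \<delta> powr (- s))\<close> by simp
    next
      case False
      then show ?thesis using N[of \<delta>] elim by (intro ln_mono) auto
    qed
    then have "ln (real (covering_number \<delta> F)) / (- ln \<delta>) \<le> (ln c + s * (- ln \<delta>)) / (- ln \<delta>)"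
      unfolding eq using l by (intro divide_right_mono) auto
    also have "\<dots> = s + ln c / (- ln \<delta>)" using l by (simp add: field_simps)
    finally show ?case using elim by linarith
  qed
qed

section \<open>Self-affine sets and their codings\<close>

lemma word_map_simps [simp]:
  "word_map T [] x = x"
  "word_map T (i # w) x = T i (word_map T w x)"
  by (simp_all add: word_map_def)

lemma word_map_append: "word_map T (u @ v) x = word_map T u (word_map T v x)"
  by (induction u) simp_all

lemma map_upt_append:
  "map a [0..<n + k] = map a [0..<n] @ map (\<lambda>j. a (n + j)) [0..<k]"
proof -
  have "map a [n..<n + k] = map (\<lambda>j. a (n + j)) [0..<k]"
    by (rule nth_equalityI) auto
  then show ?thesis using upt_add_eq_append[of 0 n k] by simp
qed

lemma map_upt_take:
  assumes "k \<le> n"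
  shows "\<exists>v. map a [0..<n] = map a [0..<k] @ v"
  using map_upt_append[of a k "n - k"] assms by auto

locale self_affine = positive_matrices A for A :: "'m::finite \<Rightarrow> real^2^2" +
  fixes d :: "'m \<Rightarrow> real^2" and E :: "(real^2) set"
  assumes attractor: "is_attractor (affine_map A d) E"
    and separated: "disjoint_family (\<lambda>i. affine_map A d i ` E)"
begin

abbreviation T :: "'m list \<Rightarrow> real^2 \<Rightarrow> real^2" where
  "T \<equiv> word_map (affine_map A d)"

abbreviation code :: "(nat \<Rightarrow> 'm) \<Rightarrow> real^2" where
  "code \<equiv> coding_map (affine_map A d)"

lemma compact_E: "compact E" and E_nonempty: "E \<noteq> {}"
  and E_eq: "E = (\<Union>i. affine_map A d i ` E)"
  using attractor unfolding is_attractor_def by auto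

lemma T_diff: "T w x - T w y = word_matrix A w *v (x - y)"
proof (induction w)
  case (Cons i w)
  have "T (i # w) x - T (i # w) y = A i *v (T w x - T w y)"
    by (simp add: affine_map_def matrix_vector_mult_diff_distrib)
  then show ?case by (simp add: Cons matrix_vector_mul_assoc)
qed simp

lemma T_eq: "T w x = word_matrix A w *v x + T w 0"
  using T_diff[of w x 0] by (simp add: algebra_simps)

lemma continuous_T: "continuous_on X (T w)"
proof -
  have "continuous_on X (\<lambda>x. word_matrix A w *v x + T w 0)"
    by (intro continuous_intros linear_continuous_on matrix_vector_mul_bounded_linear)
  then show ?thesis by (simp add: T_eq[symmetric])
qed

lemma T_image_subset: "T w ` E \<subseteq> E"
proof (induction w)
  case (Cons i w)
  show ?case
  proof
    fix y assume "y \<in> T (i # w) ` E"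
    then obtain x where "x \<in> E" "y = affine_map A d i (T w x)" by auto
    then have "y \<in> affine_map A d i ` E" using Cons by blast
    then show "y \<in> E" using E_eq by blast
  qed
qed simp

lemma T_split: "T w ` E = (\<Union>i. T (w @ [i]) ` E)"
proof -
  have "T w ` E = T w ` (\<Union>i. affine_map A d i ` E)" using E_eq by metis
  also have "\<dots> = (\<Union>i. T (w @ [i]) ` E)"
    by (auto simp: word_map_append image_UN image_image)
  finally show ?thesis .
qed

lemma E_bound: obtains R where "0 < R" "\<And>x. x \<in> E \<Longrightarrow> norm x \<le> R"
  using compact_imp_bounded[OF compact_E] bounded_pos by blast

text \<open>Compactness of the nested pieces yields a point lying in all of them; the decay of
  \<open>S\<close> then forces every orbit to converge to it, whatever the starting point.\<close>

lemma T_tendsto_E: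
  obtains x where "\<And>n. x \<in> T (map a [0..<n]) ` E" "\<And>y. (\<lambda>n. T (map a [0..<n]) y) \<longlonglongrightarrow> x"
proof -
  obtain R where R: "0 < R" "\<And>x. x \<in> E \<Longrightarrow> norm x \<le> R" by (rule E_bound) blast
  obtain \<theta> where \<theta>: "0 < \<theta>" "\<theta> < 1" "\<And>w. S w \<le> 4 * \<theta> ^ length w" by (rule S_decay) blast
  have "(\<Inter>n. T (map a [0..<n]) ` E) \<noteq> {}"
  proof (rule compact_nest)
    show "compact (T (map a [0..<n]) ` E)" for n
      by (intro compact_continuous_image continuous_T compact_E)
    show "T (map a [0..<n]) ` E \<noteq> {}" for n using E_nonempty by simp
    show "T (map a [0..<n]) ` E \<subseteq> T (map a [0..<m]) ` E" if mn: "m \<le> n" for m n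
    proof -
      obtain v where v: "map a [0..<n] = map a [0..<m] @ v" using map_upt_take[OF mn] by blast
      show ?thesis unfolding v using T_image_subset[of v] by (auto simp: word_map_append)
    qed
  qed
  then obtain x where x: "\<And>n. x \<in> T (map a [0..<n]) ` E" by blast
  moreover have "(\<lambda>n. T (map a [0..<n]) y) \<longlonglongrightarrow> x" for y
  proof (rule metric_LIMSEQ_I)
    fix e :: real assume "0 < e"
    have "(\<lambda>n. 4 * \<theta> ^ n * (norm y + R)) \<longlonglongrightarrow> 4 * 0 * (norm y + R)"
      using \<theta> by (intro tendsto_mult tendsto_const LIMSEQ_power_zero) auto
    then have "\<forall>\<^sub>F n in sequentially. 4 * \<theta> ^ n * (norm y + R) < e"
      using \<open>0 < e\<close> by (intro order_tendstoD) auto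
    then obtain N where N: "\<And>n. n \<ge> N \<Longrightarrow> 4 * \<theta> ^ n * (norm y + R) < e"
      unfolding eventually_sequentially by blast
    have "dist (T (map a [0..<n]) y) x < e" if "n \<ge> N" for n
    proof -
      obtain z where z: "z \<in> E" "x = T (map a [0..<n]) z" using x[of n] by blast
      have "dist (T (map a [0..<n]) y) x = norm (word_matrix A (map a [0..<n]) *v (y - z))"
        by (simp add: z(2) dist_norm T_diff)
      also have "\<dots> \<le> S (map a [0..<n]) * norm (y - z)" by (rule norm_word_le)
      also have "\<dots> \<le> (4 * \<theta> ^ n) * (norm y + R)"
      proof (rule mult_mono)
        show "S (map a [0..<n]) \<le> 4 * \<theta> ^ n" using \<theta>(3)[of "map a [0..<n]"] by simp
        show "norm (y - z) \<le> norm y + R"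
          using norm_triangle_ineq4[of y z] R(2)[OF z(1)] by linarith
      qed (use \<theta>(1) in auto)
      also have "\<dots> < e" using N[OF that] .
      finally show ?thesis .
    qed
    then show "\<exists>N. \<forall>n\<ge>N. dist (T (map a [0..<n]) y) x < e" by blast
  qed
  ultimately show ?thesis using that by blast
qed

lemma code_props:
  "code a \<in> T (map a [0..<n]) ` E" "(\<lambda>n. T (map a [0..<n]) y) \<longlonglongrightarrow> code a"
proof -
  obtain x where x: "\<And>n. x \<in> T (map a [0..<n]) ` E" "\<And>y. (\<lambda>n. T (map a [0..<n]) y) \<longlonglongrightarrow> x"
    by (rule T_tendsto_E) blast
  have "code a = x"
    unfolding coding_map_def using x(2) by (intro the_equality) (auto intro: LIMSEQ_unique)
  then show "code a \<in> T (map a [0..<n]) ` E" "(\<lambda>n. T (map a [0..<n]) y) \<longlonglongrightarrow> code a"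
    using x by auto
qed

lemma code_in_E: "code a \<in> E"
  using code_props(1)[of a 0] by simp

lemma code_unfold: "code a = T (map a [0..<n]) (code (\<lambda>k. a (n + k)))"
proof (rule LIMSEQ_unique)
  show "(\<lambda>k. T (map a [0..<n + k]) 0) \<longlonglongrightarrow> code a"
    using LIMSEQ_ignore_initial_segment[OF code_props(2)[where a = a and y = 0], of n] by (simp add: add.commute)
  have "(\<lambda>k. T (map a [0..<n]) (T (map (\<lambda>j. a (n + j)) [0..<k]) 0)) \<longlonglongrightarrow>
      T (map a [0..<n]) (code (\<lambda>k. a (n + k)))"
    by (rule continuous_on_tendsto_compose[OF continuous_T[of UNIV] code_props(2)]) auto
  then show "(\<lambda>k. T (map a [0..<n + k]) 0) \<longlonglongrightarrow> T (map a [0..<n]) (code (\<lambda>k. a (n + k)))"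
    by (simp only: map_upt_append word_map_append)
qed

lemma pieces_distance:
  obtains \<epsilon> where "0 < \<epsilon>"
    "\<And>i j x y. i \<noteq> j \<Longrightarrow> x \<in> affine_map A d i ` E \<Longrightarrow> y \<in> affine_map A d j ` E \<Longrightarrow> \<epsilon> \<le> dist x y"
proof -
  have cpt: "compact (affine_map A d i ` E)" for i
  proof -
    have "T [i] = affine_map A d i" by (rule ext) simp
    then show ?thesis using compact_continuous_image[OF continuous_T[of E "[i]"] compact_E] by simp
  qed
  have "\<exists>e>0. \<forall>x\<in>affine_map A d i ` E. \<forall>y\<in>affine_map A d j ` E. e \<le> dist x y" if "i \<noteq> j" for i j
  proof -
    have "affine_map A d i ` E \<inter> affine_map A d j ` E = {}"
      using disjoint_family_onD[OF separated, of i j] that by simp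
    then show ?thesis
      using separate_compact_closed[OF cpt compact_imp_closed[OF cpt]] by blast
  qed
  then obtain e where e: "\<And>i j. i \<noteq> j \<Longrightarrow> 0 < e i j"
    "\<And>i j x y. i \<noteq> j \<Longrightarrow> x \<in> affine_map A d i ` E \<Longrightarrow> y \<in> affine_map A d j ` E \<Longrightarrow> e i j \<le> dist x y"
    by metis
  \<comment> \<open>Inserting 1 keeps the set non-empty for an alphabet with one letter.\<close>
  define \<epsilon> where "\<epsilon> = Min (insert 1 ((\<lambda>(i, j). e i j) ` {(i, j). i \<noteq> j}))"
  have "0 < \<epsilon>" unfolding \<epsilon>_def using e(1) by (subst Min_gr_iff) auto
  moreover have "\<epsilon> \<le> e i j" if "i \<noteq> j" for i j
    unfolding \<epsilon>_def using that by (intro Min_le) auto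
  ultimately show ?thesis using that e(2) by (meson order_trans)
qed

text \<open>Strip off the common prefix u of the two sequences. The remaining points lie in
  different pieces of E, at distance at least \<open>\<epsilon>\<close>, and
  \<open>word_matrix A u\<close> shrinks distances at most by \<open>width u\<close>. The width of
  any longer prefix is at most a constant times \<open>width u\<close>.\<close>

lemma code_separated:
  obtains c where "0 < c"
    "\<And>a b n. dist (code a) (code b) \<le> c * width (map a [0..<n]) \<Longrightarrow> map b [0..<n] = map a [0..<n]"
proof -
  obtain \<epsilon> where \<epsilon>: "0 < \<epsilon>"
    "\<And>i j x y. i \<noteq> j \<Longrightarrow> x \<in> affine_map A d i ` E \<Longrightarrow> y \<in> affine_map A d j ` E \<Longrightarrow> \<epsilon> \<le> dist x y"
    by (rule pieces_distance) blast
  \<comment> \<open>The 8 is 4 times 2: the rest of the prefix has width at most 4, and the factor 2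
    makes the final inequality contradictory.\<close>
  define c where "c = \<epsilon> / (8 * (1 + kappa))"
  have c: "0 < c" using \<epsilon>(1) kappa_ge_1 by (simp add: c_def)
  moreover have "map b [0..<n] = map a [0..<n]"
    if le: "dist (code a) (code b) \<le> c * width (map a [0..<n])" for a b n
  proof (rule ccontr)
    assume "map b [0..<n] \<noteq> map a [0..<n]"
    then have ex: "\<exists>k. k < n \<and> a k \<noteq> b k" by auto
    define k where "k = (LEAST k. k < n \<and> a k \<noteq> b k)"
    have k: "k < n" "a k \<noteq> b k" using LeastI_ex[OF ex] by (simp_all add: k_def)
    have k3: "a j = b j" if "j < k" for j
      using not_less_Least[OF that[unfolded k_def]] that k(1) by simp
    define u where "u = map a [0..<k]"
    have u: "map b [0..<k] = u" using k3 by (simp add: u_def)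
    define x y where "x = code (\<lambda>j. a (k + j))" and "y = code (\<lambda>j. b (k + j))"
    have "x \<in> affine_map A d (a k) ` E" "y \<in> affine_map A d (b k) ` E"
      using code_props(1)[of "\<lambda>j. a (k + j)" 1] code_props(1)[of "\<lambda>j. b (k + j)" 1]
      by (auto simp: x_def y_def)
    then have xy: "\<epsilon> \<le> norm (x - y)" using \<epsilon>(2) k(2) by (auto simp: dist_norm)
    have "width u * \<epsilon> \<le> width u * norm (x - y)"
      using xy width_pos[of u] by (intro mult_left_mono) auto
    also have "\<dots> \<le> norm (word_matrix A u *v (x - y))" by (rule norm_word_ge)
    also have "\<dots> = norm (T u x - T u y)" by (simp only: T_diff)
    also have "\<dots> = dist (code a) (code b)"
      using code_unfold[of a k] code_unfold[of b k]
      by (simp add: dist_norm u u_def[symmetric] x_def y_def)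
    also have "\<dots> \<le> c * width (map a [0..<n])" by (rule le)
    also have "\<dots> \<le> c * ((1 + kappa) * width u * 4)"
    proof -
      obtain v where v: "map a [0..<n] = u @ v"
        using map_upt_take[of k n a] k(1) by (auto simp: u_def)
      have "width (u @ v) \<le> (1 + kappa) * width u * width v" by (rule width_append_le)
      also have "\<dots> \<le> (1 + kappa) * width u * 4"
        using width_le_S[of v] S_le_4[of v] width_pos[of u] kappa_ge_1 by (intro mult_left_mono) auto
      finally show ?thesis unfolding v using c by (intro mult_left_mono) auto
    qed
    also have "\<dots> = width u * \<epsilon> / 2" using kappa_ge_1 by (simp add: c_def field_simps)
    finally show False using width_pos[of u] \<epsilon>(1) by simp
  qed
  ultimately show ?thesis using that by blast
qed

subsection \<open>Efficient coverings\<close>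

text \<open>The piece is about \<open>S w\<close> long and at most about \<open>\<delta>\<close>
  thick. Slicing it by the first coordinate at scale \<open>\<delta>\<close> gives about
  \<open>S w / \<delta>\<close> slices, each of diameter of order \<open>\<delta>\<close> by
  \<open>norm_word_first_coord\<close>.\<close>

lemma cover_piece:
  assumes R: "0 < R" "\<And>x. x \<in> E \<Longrightarrow> norm x \<le> R"
    and "0 < \<beta>" "0 < \<delta>" "\<beta> * \<delta> \<le> width w" "width w \<le> \<delta>"
  shows "\<exists>\<U>. finite \<U> \<and> real (card \<U>) \<le> (4 * R + 5 / \<beta>) * S w / \<delta> \<and> T w ` E \<subseteq> \<Union>\<U> \<and>
     (\<forall>U\<in>\<U>. bounded U \<and> diameter U \<le> (1 + kappa) * (1 + 4 * R) * \<delta>)"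
proof -
  obtain x0 where x0: "x0 \<in> E" using E_nonempty by blast
  define k0 where "k0 = \<lfloor>T w x0 $ 1 / \<delta>\<rfloor>"
  define z where "z = 2 * R * S w / \<delta>"
  define N where "N = \<lceil>z\<rceil> + 1"
  have diffE: "norm (x - y) \<le> 2 * R" if "x \<in> E" "y \<in> E" for x y
    using norm_triangle_ineq4[of x y] R(2)[OF that(1)] R(2)[OF that(2)] by simp
  have "0 \<le> z" unfolding z_def using R(1) S_pos[of w] \<open>0 < \<delta>\<close> by simp
  then have N0: "0 \<le> N" unfolding N_def by linarith
  define U where "U k = {y \<in> T w ` E. \<lfloor>y $ 1 / \<delta>\<rfloor> = k}" for k
  define \<U> where "\<U> = U ` {k0 - N..k0 + N}"
  have "real (card \<U>) \<le> real (card {k0 - N..k0 + N})"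
    unfolding \<U>_def by (intro of_nat_mono card_image_le) simp
  also have "\<dots> = real_of_int (2 * N + 1)" using N0 by simp
  also have "\<dots> \<le> 2 * (z + 2) + 1"
    unfolding N_def using ceiling_correct[of z] by simp
  also have "\<dots> = 4 * R * S w / \<delta> + 5" by (simp add: z_def)
  \<comment> \<open>The additive 5 is absorbed by means of
    \<open>\<beta> * \<delta> \<le> width w \<le> S w\<close>.\<close>
  also have "\<dots> \<le> 4 * R * S w / \<delta> + 5 / \<beta> * S w / \<delta>"
  proof -
    have "\<beta> * \<delta> \<le> S w" using width_le_S[of w] assms by linarith
    then show ?thesis using assms by (simp add: field_simps)
  qed
  finally have card: "real (card \<U>) \<le> (4 * R + 5 / \<beta>) * S w / \<delta>"
    by (simp add: add_divide_distrib distrib_right)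
  have cover: "T w ` E \<subseteq> \<Union>\<U>"
  proof
    fix y assume y: "y \<in> T w ` E"
    then obtain x where x: "x \<in> E" "y = T w x" by blast
    have "\<bar>y $ 1 - T w x0 $ 1\<bar> \<le> norm (y - T w x0)"
      using component_le_norm_cart[of "y - T w x0" 1] by simp
    also have "\<dots> \<le> S w * norm (x - x0)" unfolding x(2) T_diff by (rule norm_word_le)
    also have "\<dots> \<le> S w * (2 * R)"
      using diffE[OF x(1) x0] S_pos[of w] by (intro mult_left_mono) auto
    finally have "\<bar>y $ 1 - T w x0 $ 1\<bar> / \<delta> \<le> z"
      unfolding z_def using \<open>0 < \<delta>\<close> by (intro divide_right_mono) (auto simp: mult_ac)
    moreover have "\<bar>y $ 1 - T w x0 $ 1\<bar> / \<delta> = \<bar>y $ 1 / \<delta> - T w x0 $ 1 / \<delta>\<bar>"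
      using \<open>0 < \<delta>\<close> by (simp add: diff_divide_distrib[symmetric])
    moreover have "z \<le> real_of_int (N - 1)" by (simp add: N_def)
    ultimately have "\<bar>y $ 1 / \<delta> - T w x0 $ 1 / \<delta>\<bar> \<le> real_of_int (N - 1)" by linarith
    then have "k0 - N \<le> \<lfloor>y $ 1 / \<delta>\<rfloor>" "\<lfloor>y $ 1 / \<delta>\<rfloor> \<le> k0 + N" unfolding k0_def by linarith+
    then show "y \<in> \<Union>\<U>" using y by (auto simp: \<U>_def U_def)
  qed
  have "bounded V \<and> diameter V \<le> (1 + kappa) * (1 + 4 * R) * \<delta>" if V: "V \<in> \<U>" for V
  proof
    have "V \<subseteq> E" using V T_image_subset by (auto simp: \<U>_def U_def)
    then show "bounded V" using compact_imp_bounded[OF compact_E] bounded_subset by blast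
    show "diameter V \<le> (1 + kappa) * (1 + 4 * R) * \<delta>"
    proof (rule diameter_le)
      show "V \<noteq> {} \<or> 0 \<le> (1 + kappa) * (1 + 4 * R) * \<delta>"
        using kappa_ge_1 R \<open>0 < \<delta>\<close> by simp
      fix y z assume "y \<in> V" "z \<in> V"
      then obtain p q where pq: "p \<in> E" "q \<in> E" "y = T w p" "z = T w q"
        and fl: "\<lfloor>y $ 1 / \<delta>\<rfloor> = \<lfloor>z $ 1 / \<delta>\<rfloor>"
        using V by (auto simp: \<U>_def U_def)
      have "\<bar>y $ 1 / \<delta> - z $ 1 / \<delta>\<bar> \<le> 1" using fl by linarith
      moreover have "\<bar>y $ 1 / \<delta> - z $ 1 / \<delta>\<bar> = \<bar>(y - z) $ 1\<bar> / \<delta>"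
        using \<open>0 < \<delta>\<close> by (simp add: diff_divide_distrib[symmetric])
      ultimately have 1: "\<bar>(y - z) $ 1\<bar> \<le> \<delta>"
        using \<open>0 < \<delta>\<close> by (simp add: divide_le_eq)
      have 2: "2 * width w * norm (p - q) \<le> 2 * \<delta> * (2 * R)"
        using \<open>width w \<le> \<delta>\<close> width_pos[of w] diffE[OF pq(1,2)] \<open>0 < \<delta>\<close> by (intro mult_mono) auto
      have "norm (y - z) \<le> (1 + kappa) * (\<bar>(y - z) $ 1\<bar> + 2 * width w * norm (p - q))"
        unfolding pq(3,4) T_diff by (rule norm_word_first_coord)
      also have "\<dots> \<le> (1 + kappa) * (\<delta> + 2 * \<delta> * (2 * R))"
        using kappa_ge_1 by (intro mult_left_mono add_mono 1 2) auto
      also have "\<dots> = (1 + kappa) * (1 + 4 * R) * \<delta>" by (simp add: algebra_simps)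
      finally show "norm (y - z) \<le> (1 + kappa) * (1 + 4 * R) * \<delta>" .
    qed
  qed
  then show ?thesis using card cover by (intro exI[of _ \<U>]) (simp add: \<U>_def)
qed

text \<open>Follow each branch until the width first drops to \<open>\<delta>\<close> or below; it
  is then still at least \<open>\<beta> * \<delta>\<close>. The \<open>S w / \<delta>\<close> sets
  needed there number at most a constant times \<open>m w * \<delta> powr (- t)\<close>, and
  additivity of m sums these bounds up the tree to \<open>m []\<close>.\<close>

lemma E_covered:
  assumes split: "\<And>w. m w = (\<Sum>i\<in>UNIV. m (w @ [i]))"
    and c: "0 < c" "\<And>w. c * (S w * width w powr (t - 1)) \<le> m w" and t: "1 \<le> t"
  shows "covered_with_exponent t E"
proof -
  obtain R where R: "0 < R" "\<And>x. x \<in> E \<Longrightarrow> norm x \<le> R" by (rule E_bound) blast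
  obtain \<theta> where \<theta>: "0 < \<theta>" "\<theta> < 1" "\<And>w. S w \<le> 4 * \<theta> ^ length w" by (rule S_decay) blast
  obtain \<beta> where \<beta>: "0 < \<beta>" "\<beta> < 1" "\<And>u v. width u * \<beta> ^ length v \<le> width (u @ v)"
    by (rule width_decay_ge) blast
  define L where "L = (1 + kappa) * (1 + 4 * R)"
  define K1 where "K1 = 4 * R + 5 / \<beta>"
  define K where "K = K1 / (c * \<beta> powr (t - 1))"
  have L: "1 \<le> L"
    using mult_mono[of 1 "1 + kappa" 1 "1 + 4 * R"] kappa_ge_1 R(1) by (simp add: L_def)
  have K1: "0 < K1" using R \<beta> by (simp add: K1_def add_pos_pos)
  have K: "0 < K" using K1 c(1) \<beta>(1) by (simp add: K_def)
  have main: "\<exists>\<U>. finite \<U> \<and> real (card \<U>) \<le> K * m w * \<delta> powr (- t) \<and> T w ` E \<subseteq> \<Union>\<U> \<and>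
     (\<forall>U\<in>\<U>. bounded U \<and> diameter U \<le> L * \<delta>)"
    if \<delta>: "0 < \<delta>" and w: "\<beta> * \<delta> \<le> width w" for \<delta> w
  proof -
    \<comment> \<open>N bounds the length of every word with
      \<open>\<beta> * \<delta> \<le> width w\<close>, so N minus the length is a termination
      measure for the splitting.\<close>
    have "(\<lambda>n. 4 * \<theta> ^ n) \<longlonglongrightarrow> 4 * 0"
      using \<theta> by (intro tendsto_mult tendsto_const LIMSEQ_power_zero) auto
    then have "\<forall>\<^sub>F n in sequentially. 4 * \<theta> ^ n < \<beta> * \<delta>"
      using \<beta>(1) \<delta> order_tendstoD(2)[of "\<lambda>n. 4 * \<theta> ^ n" 0 _ "\<beta> * \<delta>"] by simp
    then obtain N where N: "\<And>n. n \<ge> N \<Longrightarrow> 4 * \<theta> ^ n < \<beta> * \<delta>"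
      unfolding eventually_sequentially by blast
    have len: "length w < N" if "\<beta> * \<delta> \<le> width w" for w :: "'m list"
    proof (rule ccontr)
      assume "\<not> length w < N"
      then have "4 * \<theta> ^ length w < \<beta> * \<delta>" using N by simp
      then show False using that width_le_S[of w] \<theta>(3)[of w] by linarith
    qed
    show ?thesis using w
    proof (induction "N - length w" arbitrary: w rule: less_induct)
      case less
      show ?case
      proof (cases "width w \<le> \<delta>")
        case True
        have "c * S w * \<beta> powr (t - 1) * \<delta> powr (t - 1) = c * (S w * (\<beta> * \<delta>) powr (t - 1))"
          using \<beta> \<delta> by (simp add: powr_mult)
        also have "\<dots> \<le> c * (S w * width w powr (t - 1))"
          using c(1) S_pos[of w] less.prems \<beta>(1) \<delta> t
          by (intro mult_left_mono powr_mono2) auto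
        also have "\<dots> \<le> m w" by (rule c(2))
        finally have "c * S w * \<beta> powr (t - 1) * \<delta> powr (t - 1) * \<delta> powr (- t) \<le> m w * \<delta> powr (- t)"
          by (intro mult_right_mono) auto
        moreover have "\<delta> powr (t - 1) * \<delta> powr (- t) = 1 / \<delta>"
        proof -
          have "\<delta> powr (t - 1) * \<delta> powr (- t) = \<delta> powr (t - 1 + - t)" by (rule powr_add[symmetric])
          also have "\<dots> = 1 / \<delta>" using \<delta> by (simp add: powr_minus_divide)
          finally show ?thesis .
        qed
        ultimately have "c * S w * \<beta> powr (t - 1) * (1 / \<delta>) \<le> m w * \<delta> powr (- t)"
          by (simp only: mult.assoc)
        then have "K * (c * S w * \<beta> powr (t - 1) * (1 / \<delta>)) \<le> K * (m w * \<delta> powr (- t))"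
          using K by (intro mult_left_mono) auto
        moreover have "K * (c * S w * \<beta> powr (t - 1) * (1 / \<delta>)) = K1 * S w / \<delta>"
          using c(1) \<beta>(1) by (simp add: K_def)
        ultimately have "K1 * S w / \<delta> \<le> K * m w * \<delta> powr (- t)" by (simp only: mult.assoc)
        then show ?thesis
          using cover_piece[OF R \<beta>(1) \<delta> less.prems True] unfolding L_def K1_def
          by (meson order_trans)
      next
        case False
        have "\<exists>\<U>. finite \<U> \<and> real (card \<U>) \<le> K * m (w @ [i]) * \<delta> powr (- t) \<and>
            T (w @ [i]) ` E \<subseteq> \<Union>\<U> \<and> (\<forall>U\<in>\<U>. bounded U \<and> diameter U \<le> L * \<delta>)" for i
        proof (rule less.hyps)
          show "N - length (w @ [i]) < N - length w" using len[OF less.prems] by simp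
          have "\<delta> * \<beta> \<le> width w * \<beta>" using False \<beta>(1) by (intro mult_right_mono) auto
          then show "\<beta> * \<delta> \<le> width (w @ [i])" using \<beta>(3)[of w "[i]"] by (simp add: mult.commute)
        qed
        then obtain \<U> where \<U>: "\<And>i. finite (\<U> i)" "\<And>i. real (card (\<U> i)) \<le> K * m (w @ [i]) * \<delta> powr (- t)"
          "\<And>i. T (w @ [i]) ` E \<subseteq> \<Union>(\<U> i)" "\<And>i. \<forall>U\<in>\<U> i. bounded U \<and> diameter U \<le> L * \<delta>"
          by metis
        have "real (card (\<Union>i. \<U> i)) \<le> real (\<Sum>i\<in>UNIV. card (\<U> i))"
          by (intro of_nat_mono card_UN_le) simp
        also have "\<dots> = (\<Sum>i\<in>UNIV. real (card (\<U> i)))" by simp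
        also have "\<dots> \<le> (\<Sum>i\<in>UNIV. K * m (w @ [i]) * \<delta> powr (- t))"
          using \<U>(2) by (intro sum_mono) auto
        also have "\<dots> = K * m w * \<delta> powr (- t)"
          by (simp add: split[of w] sum_distrib_left sum_distrib_right)
        finally have card: "real (card (\<Union>i. \<U> i)) \<le> K * m w * \<delta> powr (- t)" .
        have "T w ` E \<subseteq> \<Union>(\<Union>i. \<U> i)" unfolding T_split[of w] using \<U>(3) by blast
        moreover have "finite (\<Union>i. \<U> i)" using \<U>(1) by simp
        moreover have "\<forall>U\<in>(\<Union>i. \<U> i). bounded U \<and> diameter U \<le> L * \<delta>" using \<U>(4) by blast
        ultimately show ?thesis using card by blast
      qed
    qed
  qed
  show ?thesis unfolding covered_with_exponent_def
  proof (intro exI[of _ "K * m [] * (2 * L) powr t"] allI impI)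
    fix \<delta> :: real assume \<delta>: "0 < \<delta>" "\<delta> \<le> 1"
    \<comment> \<open>Dividing by L compensates the diameter bound \<open>L * \<delta>'\<close>; the
      factor 2 brings \<open>\<delta>'\<close> below \<open>width [] = 1 / 2\<close>, where the
      splitting starts.\<close>
    define \<delta>' where "\<delta>' = \<delta> / (2 * L)"
    have d': "0 < \<delta>'" "L * \<delta>' \<le> \<delta>" using \<delta> L by (simp_all add: \<delta>'_def)
    have "\<delta>' \<le> 1 / 2" using \<delta> L by (simp add: \<delta>'_def field_simps)
    moreover have "\<beta> * \<delta>' \<le> 1 * \<delta>'" using \<beta> d' by (intro mult_right_mono) auto
    ultimately have "\<beta> * \<delta>' \<le> width []" by (simp add: width_Nil)
    then obtain \<U> where \<U>: "finite \<U>" "real (card \<U>) \<le> K * m [] * \<delta>' powr (- t)" "E \<subseteq> \<Union>\<U>"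
      "\<And>U. U \<in> \<U> \<Longrightarrow> bounded U \<and> diameter U \<le> L * \<delta>'"
      using main[OF d'(1), of "[]"] by auto
    have "\<delta>' powr (- t) = (2 * L) powr t * \<delta> powr (- t)"
      using \<delta> L by (simp add: \<delta>'_def powr_divide powr_minus field_simps)
    then have "real (card \<U>) \<le> K * m [] * (2 * L) powr t * \<delta> powr (- t)"
      using \<U>(2) by (simp add: mult.assoc)
    moreover have "\<forall>U\<in>\<U>. bounded U \<and> diameter U \<le> \<delta>"
      using \<U>(4) d'(2) by (meson order_trans)
    ultimately show "\<exists>\<U>. finite \<U> \<and> real (card \<U>) \<le> K * m [] * (2 * L) powr t * \<delta> powr (- t) \<and>
        E \<subseteq> \<Union>\<U> \<and> (\<forall>U\<in>\<U>. bounded U \<and> diameter U \<le> \<delta>)"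
      using \<U>(1,3) by blast
  qed
qed

end

section \<open>Measures on sequence spaces\<close>

lemma space_seq_algebra [simp]: "space seq_algebra = UNIV"
  by (simp add: seq_algebra_def space_PiM)

lemma UNIV_in_seq_algebra [simp]: "UNIV \<in> sets seq_algebra"
  using sets.top[of seq_algebra] by simp

lemma measurable_seq_coord: "(\<lambda>a. a k) \<in> seq_algebra \<rightarrow>\<^sub>M count_space UNIV"
  unfolding seq_algebra_def by (rule measurable_component_singleton) simp

lemma measurable_into_seq_algebra:
  assumes "\<And>k. (\<lambda>x. f x k) \<in> M \<rightarrow>\<^sub>M count_space UNIV"
  shows "f \<in> M \<rightarrow>\<^sub>M seq_algebra"
proof -
  have "(\<lambda>x k. f x k) \<in> M \<rightarrow>\<^sub>M PiM UNIV (\<lambda>_. count_space UNIV)"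
    using assms by (intro measurable_PiM_single') auto
  then show ?thesis by (simp add: seq_algebra_def)
qed

lemma measurable_reindex: "(\<lambda>a k. a (f k)) \<in> seq_algebra \<rightarrow>\<^sub>M seq_algebra"
  by (intro measurable_into_seq_algebra measurable_seq_coord)

lemma measurable_prefix:
  "(\<lambda>a. map (\<lambda>k. a (f k)) [0..<n]) \<in> seq_algebra \<rightarrow>\<^sub>M count_space (UNIV :: 'm::finite list set)"
proof (rule measurable_count_space_eq_countable[THEN iffD2])
  show "countable (UNIV :: 'm list set)" by simp
  show "(\<lambda>a. map (\<lambda>k. a (f k)) [0..<n]) \<in> space seq_algebra \<rightarrow> UNIV \<and>
     (\<forall>w\<in>(UNIV :: 'm list set). (\<lambda>a. map (\<lambda>k. a (f k)) [0..<n]) -` {w} \<inter> space seq_algebra \<in> sets seq_algebra)"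
  proof (intro conjI ballI)
    fix w :: "'m list"
    show "(\<lambda>a. map (\<lambda>k. a (f k)) [0..<n]) -` {w} \<inter> space seq_algebra \<in> sets seq_algebra"
    proof (cases "length w = n")
      case True
      have eq: "(\<lambda>a. map (\<lambda>k. a (f k)) [0..<n]) -` {w} \<inter> space seq_algebra
          = space seq_algebra \<inter> (\<Inter>k\<in>{..<n}. (\<lambda>a. a (f k)) -` {w ! k} \<inter> space seq_algebra)"
      proof -
        have "map g [0..<n] = w \<longleftrightarrow> (\<forall>k<n. g k = w ! k)" for g
          using True by (subst list_eq_iff_nth_eq) simp
        then show ?thesis by (auto simp: vimage_def)
      qed
      show ?thesis
      proof (cases "n = 0")
        case True
        then show ?thesis unfolding eq by simp
      next
        case False
        have "(\<Inter>k\<in>{..<n}. (\<lambda>a. a (f k)) -` {w ! k} \<inter> space seq_algebra) \<in> sets seq_algebra"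
          using False by (intro sets.finite_INT measurable_sets[OF measurable_seq_coord]) auto
        then show ?thesis unfolding eq by (intro sets.Int sets.top)
      qed
    next
      case False
      then have eq: "(\<lambda>a. map (\<lambda>k. a (f k)) [0..<n]) -` {w} = {}"
        using length_map length_upt by force
      show ?thesis unfolding eq by simp
    qed
  qed simp
qed

lemma cylinder_eq_prefix: "cylinder w = {a. map a [0..<length w] = w}"
  unfolding cylinder_def by (subst list_eq_iff_nth_eq) simp

lemma prefix_in_sets: "{a. map a [0..<n] \<in> B} \<in> sets (seq_algebra :: (nat \<Rightarrow> 'm::finite) measure)"
  using measurable_sets[OF measurable_prefix[where f = "\<lambda>k. k"], of B n] by (simp add: vimage_def)

lemma cylinder_in_sets: "cylinder w \<in> sets (seq_algebra :: (nat \<Rightarrow> 'm::finite) measure)"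
  unfolding cylinder_eq_prefix using prefix_in_sets[of "length w" "{w}"] by simp

lemma cylinder_split: "cylinder w = (\<Union>i. cylinder (w @ [i]))"
  unfolding cylinder_eq_prefix by (simp add: set_eq_iff)

lemma measure_cylinder_split:
  fixes M :: "(nat \<Rightarrow> 'm::finite) measure"
  assumes "finite_measure M" "sets M = sets seq_algebra"
  shows "measure M (cylinder w) = (\<Sum>i\<in>UNIV. measure M (cylinder (w @ [i])))"
proof -
  interpret finite_measure M by fact
  have "disjoint_family (\<lambda>i. cylinder (w @ [i]))"
    by (auto simp: disjoint_family_on_def cylinder_eq_prefix)
  then have "measure M (\<Union>i. cylinder (w @ [i])) = (\<Sum>i\<in>UNIV. measure M (cylinder (w @ [i])))"
    by (intro finite_measure_finite_Union) (auto simp: assms(2) cylinder_in_sets)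
  then show ?thesis by (simp only: cylinder_split[symmetric])
qed

text \<open>
  Measurable sets are approximated in measure by sets depending on finitely many coordinates,
  so an inequality on cylinders passes to all measurable sets.
\<close>

lemma prefix_approximation:
  fixes M N :: "(nat \<Rightarrow> 'm::finite) measure"
  assumes "finite_measure M" "sets M = sets seq_algebra"
    and "finite_measure N" "sets N = sets seq_algebra"
    and X: "X \<in> sets seq_algebra" and "0 < e"
  shows "\<exists>n B. measure M (sym_diff X {a. map a [0..<n] \<in> B})
           + measure N (sym_diff X {a. map a [0..<n] \<in> B}) < e"
proof -
  interpret M: finite_measure M by fact
  interpret N: finite_measure N by fact
  define cyl :: "(nat \<Rightarrow> 'm) set \<Rightarrow> bool" where "cyl Y \<longleftrightarrow> (\<exists>n B. Y = {a. map a [0..<n] \<in> B})" for Y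
  \<comment> \<open>The sum of both measures, so that one set approximates X for M and N
    simultaneously.\<close>
  define q where "q Z = measure M Z + measure N Z" for Z
  have q_mono: "q Y \<le> q Z" if "Y \<subseteq> Z" "Z \<in> sets seq_algebra" for Y Z
    unfolding q_def using that assms(2,4)
    by (intro add_mono M.finite_measure_mono N.finite_measure_mono) auto
  have q_Un: "q (Y \<union> Z) \<le> q Y + q Z" if "Y \<in> sets seq_algebra" "Z \<in> sets seq_algebra" for Y Z
    unfolding q_def using measure_subadditive[of Y M Z] measure_subadditive[of Y N Z]
      that assms(2,4) by simp
  have q_UN: "q (\<Union>i<k::nat. Y i) \<le> (\<Sum>i<k. q (Y i))" if "\<And>i. Y i \<in> sets seq_algebra" for Y k
  proof (induction k)
    case (Suc k)
    have "q (\<Union>i<Suc k. Y i) \<le> q (\<Union>i<k. Y i) + q (Y k)"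
      using q_Un[of "\<Union>i<k. Y i" "Y k"] that by (simp add: lessThan_Suc Un_commute)
    then show ?case using Suc by simp
  qed (simp add: q_def)
  have cyl_sets: "Y \<in> sets seq_algebra" if "cyl Y" for Y
    using that prefix_in_sets by (auto simp: cyl_def)
  have cyl_Un: "cyl (Y \<union> Z)" if Y: "cyl Y" and Z: "cyl Z" for Y Z
  proof -
    obtain n B k C where eq: "Y = {a. map a [0..<n] \<in> B}" "Z = {a. map a [0..<k] \<in> C}"
      using Y Z by (auto simp: cyl_def)
    have tk: "map a [0..<n] = take n (map a [0..<n + k])" "map a [0..<k] = take k (map a [0..<n + k])"
      for a :: "nat \<Rightarrow> 'm" by (simp_all add: take_map)
    have "Y \<union> Z = {a. map a [0..<n + k] \<in> {w. take n w \<in> B \<or> take k w \<in> C}}"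
      unfolding eq using tk by auto
    then show ?thesis unfolding cyl_def by blast
  qed
  have cyl_UN: "cyl (\<Union>i<k::nat. Y i)" if "\<And>i. cyl (Y i)" for Y k
  proof (induction k)
    case 0
    have "(\<Union>i<0. Y i) = {a. map a [0..<0] \<in> {}}" by simp
    then show ?case unfolding cyl_def by blast
  next
    case (Suc k) then show ?case using cyl_Un[OF that[of k]] by (simp add: lessThan_Suc)
  qed
  have gen: "sets (seq_algebra :: (nat \<Rightarrow> 'm) measure)
      = sigma_sets UNIV {{f. f i \<in> A} |i A. True}"
    unfolding seq_algebra_def sets_PiM_single by simp
  have "\<forall>e>0. \<exists>Y. cyl Y \<and> q (sym_diff X Y) < e"
    using X unfolding gen
  proof (induction rule: sigma_sets.induct)
    case (Basic X)
    then obtain i A where "X = {f. f i \<in> A}" by blast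
    then have "X = {a. map a [0..<Suc i] \<in> {w. w ! i \<in> A}}" by (auto simp: nth_append)
    then have "cyl X" unfolding cyl_def by blast
    then show ?case by (intro allI impI exI[of _ X]) (simp add: q_def)
  next
    case Empty
    have "{} = {a. map a [0..<0] \<in> {}}" by simp
    then have "cyl {}" unfolding cyl_def by blast
    then show ?case by (intro allI impI exI[of _ "{}"]) (simp add: q_def)
  next
    case (Compl X)
    show ?case
    proof (intro allI impI)
      fix e :: real assume "0 < e"
      then obtain Y where Y: "cyl Y" "q (sym_diff X Y) < e" using Compl by blast
      obtain n B where "Y = {a. map a [0..<n] \<in> B}" using Y(1) by (auto simp: cyl_def)
      then have "- Y = {a. map a [0..<n] \<in> - B}" by auto
      then have "cyl (- Y)" unfolding cyl_def by blast
      moreover have "sym_diff (UNIV - X) (- Y) = sym_diff X Y" by blast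
      ultimately show "\<exists>Y. cyl Y \<and> q (sym_diff (UNIV - X) Y) < e" using Y(2) by metis
    qed
  next
    case (Union X)
    have Xs: "X i \<in> sets seq_algebra" for i using Union(1) gen by blast
    show ?case
    proof (intro allI impI)
      fix e :: real assume e: "0 < e"
      \<comment> \<open>The part of the union missed by the first k sets. Its measure tends to 0, so
        only finitely many approximations have to be combined.\<close>
      define Z where "Z k = (\<Union>i. X i) - (\<Union>i<k. X i)" for k
      have Zs: "Z k \<in> sets seq_algebra" for k using Xs by (auto simp: Z_def)
      have "decseq Z" by (fastforce simp: decseq_def Z_def)
      moreover have "(\<Inter>k. Z k) = {}" by (fastforce simp: Z_def)
      ultimately have "(\<lambda>k. q (Z k)) \<longlonglongrightarrow> 0 + 0"
        unfolding q_def using M.finite_Lim_measure_decseq[of Z] N.finite_Lim_measure_decseq[of Z] Zs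
        by (intro tendsto_add) (auto simp: assms(2,4))
      then have "\<forall>\<^sub>F k in sequentially. q (Z k) < e / 2"
        using e by (intro order_tendstoD(2)[of _ "0 + 0"]) auto
      then obtain k where k: "q (Z k) < e / 2" by (auto simp: eventually_sequentially)
      have "\<forall>i. \<exists>Y. cyl Y \<and> q (sym_diff (X i) Y) < e / (2 * (real k + 1))"
        using Union(2) e by simp
      then obtain Y where Y: "\<And>i. cyl (Y i)" "\<And>i. q (sym_diff (X i) (Y i)) < e / (2 * (real k + 1))"
        by metis
      have Ds: "sym_diff (X i) (Y i) \<in> sets seq_algebra" for i using Xs cyl_sets[OF Y(1)] by blast
      have "sym_diff (\<Union>i. X i) (\<Union>i<k. Y i) \<subseteq> Z k \<union> (\<Union>i<k. sym_diff (X i) (Y i))"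
        by (auto simp: Z_def)
      then have "q (sym_diff (\<Union>i. X i) (\<Union>i<k. Y i)) \<le> q (Z k \<union> (\<Union>i<k. sym_diff (X i) (Y i)))"
        using Zs Ds by (intro q_mono) auto
      also have "\<dots> \<le> q (Z k) + q (\<Union>i<k. sym_diff (X i) (Y i))"
        using Zs Ds by (intro q_Un) auto
      also have "\<dots> \<le> q (Z k) + (\<Sum>i<k. q (sym_diff (X i) (Y i)))"
        using q_UN[OF Ds] by simp
      also have "\<dots> \<le> q (Z k) + (\<Sum>i<k. e / (2 * (real k + 1)))"
        using Y(2) by (intro add_left_mono sum_mono less_imp_le)
      also have "\<dots> < e / 2 + e / 2"
      proof (rule add_less_le_mono[OF k])
        show "(\<Sum>i<k. e / (2 * (real k + 1))) \<le> e / 2"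
          using e by (simp add: field_simps)
      qed
      finally have "q (sym_diff (\<Union>i. X i) (\<Union>i<k. Y i)) < e" by simp
      then show "\<exists>Y. cyl Y \<and> q (sym_diff (\<Union>i. X i) Y) < e"
        using cyl_UN[of Y k, OF Y(1)] by (intro exI conjI)
    qed
  qed
  then obtain Y where "cyl Y" "q (sym_diff X Y) < e" using \<open>0 < e\<close> by blast
  then show ?thesis unfolding cyl_def q_def by blast
qed

lemma cylinder_domination:
  fixes M N :: "(nat \<Rightarrow> 'm::finite) measure"
  assumes M: "finite_measure M" "sets M = sets seq_algebra"
    and N: "finite_measure N" "sets N = sets seq_algebra"
    and le: "\<And>w. measure N (cylinder w) \<le> K * measure M (cylinder w)" and "0 \<le> K"
    and X: "X \<in> sets seq_algebra"
  shows "measure N X \<le> K * measure M X"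
proof (rule field_le_epsilon)
  interpret M: finite_measure M by fact
  interpret N: finite_measure N by fact
  fix e :: real assume "0 < e"
  define e' where "e' = e / (K + 1)"
  have "0 < e'" using \<open>0 < e\<close> \<open>0 \<le> K\<close> by (simp add: e'_def)
  obtain n B where nB: "measure M (sym_diff X {a. map a [0..<n] \<in> B})
      + measure N (sym_diff X {a. map a [0..<n] \<in> B}) < e'"
    using prefix_approximation[OF M N X \<open>0 < e'\<close>] by blast
  define Y where "Y = {a::nat \<Rightarrow> 'm. map a [0..<n] \<in> B}"
  define W where "W = B \<inter> {w. length w = n}"
  have Ys: "Y \<in> sets seq_algebra" unfolding Y_def by (rule prefix_in_sets)
  have fin: "finite W"
    using finite_lists_length_eq[of "UNIV :: 'm set" n] by (simp add: W_def)
  have Y: "Y = (\<Union>w\<in>W. cylinder w)"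
    by (auto simp: Y_def W_def cylinder_eq_prefix)
  have disj: "disjoint_family_on cylinder W"
    by (auto simp: disjoint_family_on_def W_def cylinder_eq_prefix)
  have "measure N Y = (\<Sum>w\<in>W. measure N (cylinder w))"
    unfolding Y using fin disj
    by (intro N.finite_measure_finite_Union) (auto simp: N(2) cylinder_in_sets)
  also have "\<dots> \<le> (\<Sum>w\<in>W. K * measure M (cylinder w))" using le by (rule sum_mono)
  also have "\<dots> = K * measure M Y"
    unfolding Y using fin disj
    by (subst M.finite_measure_finite_Union) (auto simp: M(2) cylinder_in_sets sum_distrib_left)
  finally have NY: "measure N Y \<le> K * measure M Y" .
  define D where "D = sym_diff X Y"
  have Ds: "D \<in> sets seq_algebra" using X Ys by (simp add: D_def)
  have small: "measure M D + measure N D < e'" using nB by (simp add: D_def Y_def)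
  have "measure N X \<le> measure N (Y \<union> D)"
    using Ys Ds by (intro N.finite_measure_mono) (auto simp: D_def N(2))
  also have "\<dots> \<le> measure N Y + measure N D"
    using Ys Ds by (intro measure_subadditive) (auto simp: N(2))
  finally have 1: "measure N X \<le> measure N Y + measure N D" .
  have "measure M Y \<le> measure M (X \<union> D)"
    using X Ds by (intro M.finite_measure_mono) (auto simp: D_def M(2))
  also have "\<dots> \<le> measure M X + measure M D"
    using X Ds by (intro measure_subadditive) (auto simp: M(2))
  finally have "K * measure M Y \<le> K * (measure M X + measure M D)"
    using \<open>0 \<le> K\<close> by (intro mult_left_mono)
  then have "measure N X \<le> K * measure M X + (K * measure M D + measure N D)"
    using 1 NY by (simp add: distrib_left)
  also have "K * measure M D + measure N D \<le> K * e' + e'"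
  proof (rule add_mono)
    have "measure M D \<le> e'" using small measure_nonneg[of N D] by linarith
    then show "K * measure M D \<le> K * e'" using \<open>0 \<le> K\<close> by (rule mult_left_mono)
    show "measure N D \<le> e'" using small measure_nonneg[of M D] by linarith
  qed
  also have "K * e' + e' = (K + 1) * e'" by (simp add: distrib_right)
  also have "\<dots> = e" using \<open>0 \<le> K\<close> by (simp add: e'_def)
  finally show "measure N X \<le> K * measure M X + e" by simp
qed

lemma shift_invariant_probD:
  assumes "shift_invariant_prob M"
  shows "prob_space M" "sets M = sets seq_algebra" "space M = UNIV"
  using assms sets_eq_imp_space_eq[of M seq_algebra] by (simp_all add: shift_invariant_prob_def)

lemma shift_invariant_iterate:
  fixes M :: "('n::comm_semiring_1 \<Rightarrow> 'm) measure"
  assumes M: "shift_invariant_prob M" and X: "X \<in> sets seq_algebra"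
  shows "measure M {a. (\<lambda>k. a (k + of_nat n)) \<in> X} = measure M X"
  using X
proof (induction n arbitrary: X)
  case (Suc n)
  have inv: "distr M M shift = M" and s: "sets M = sets seq_algebra" and sp: "space M = UNIV"
    using M shift_invariant_probD(2,3)[OF M] by (simp_all add: shift_invariant_prob_def)
  have sm: "shift \<in> M \<rightarrow>\<^sub>M M"
    unfolding shift_def measurable_cong_sets[OF s s] by (rule measurable_reindex)
  define Y where "Y = {a. (\<lambda>k. a (k + of_nat n)) \<in> X}"
  have Y: "Y \<in> sets seq_algebra"
    using measurable_sets[OF measurable_reindex Suc.prems, of "\<lambda>k. k + of_nat n"]
    by (simp add: Y_def vimage_def)
  have "measure M X = measure M Y" unfolding Y_def by (rule Suc.IH[OF Suc.prems, symmetric])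
  also have "\<dots> = measure (distr M M shift) Y" by (simp only: inv)
  also have "\<dots> = measure M (shift -` Y \<inter> space M)"
    using sm Y s by (intro measure_distr) auto
  also have "shift -` Y \<inter> space M = {a. (\<lambda>k. a (k + of_nat (Suc n))) \<in> X}"
    by (auto simp: Y_def shift_def sp add_ac)
  finally show ?case by simp
qed simp

section \<open>The Kaenmaki measure\<close>

locale kaenmaki = self_affine A d E for A :: "'m::finite \<Rightarrow> real^2^2" and d E +
  fixes \<mu> :: "(nat \<Rightarrow> 'm) measure"
  assumes kaenmaki: "is_kaenmaki_measure A \<mu>"
begin

abbreviation s :: real where "s \<equiv> affinity_dim A"

abbreviation M :: "(real^2) measure" where "M \<equiv> distr \<mu> borel code"

lemma mu_shift_invariant: "shift_invariant_prob \<mu>"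
  using kaenmaki by (simp add: is_kaenmaki_measure_def)

lemmas sets_mu = shift_invariant_probD(2)[OF mu_shift_invariant]
lemmas space_mu = shift_invariant_probD(3)[OF mu_shift_invariant]

sublocale mu: prob_space \<mu>
  by (rule shift_invariant_probD(1)[OF mu_shift_invariant])

section \<open>Gibbs bounds in terms of \<open>S\<close> and \<open>width\<close>\<close>

lemma singular_values_width:
  assumes B_def: "B = word_matrix A w"
  shows "S w / 3 \<le> sing1 B" "sing1 B \<le> S w" "width w \<le> sing2 B" "sing2 B \<le> 3 * width w"
proof -
  have n: "0 \<le> B $ i $ j" for i j unfolding B_def by (rule nonneg)
  note sv = singular_values_entry_sum[of B, OF n]
  have S: "entry_sum B = S w" by (simp add: S_def B_def)
  show 1: "S w / 3 \<le> sing1 B" and 2: "sing1 B \<le> S w" using sv S by simp_all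
  have D: "sing1 B * sing2 B = S w * width w" using sv(3) D_eq[of w] by (simp add: D_def B_def)
  have "S w * width w \<le> S w * sing2 B" using D mult_right_mono[OF 2 sv(4)] by simp
  then show "width w \<le> sing2 B" using S_pos[of w] by simp
  have "S w / 3 * sing2 B \<le> S w * width w" using D mult_right_mono[OF 1 sv(4)] by simp
  then show "sing2 B \<le> 3 * width w" using S_pos[of w] by (simp add: field_simps)
qed

text \<open>The exponent \<open>max 1 s\<close> treats both branches of \<open>sv_function\<close>
  together, because this bound is used in the very proof that s > 1.\<close>

lemma measure_cylinder_ge:
  obtains c where "0 < c" "\<And>w. c * (S w * width w powr (max 1 s - 1)) \<le> measure \<mu> (cylinder w)"
proof -
  obtain C where C: "0 < C" "\<And>w. sv_function s (word_matrix A w) / C \<le> measure \<mu> (cylinder w)"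
    using kaenmaki unfolding is_kaenmaki_measure_def by blast
  \<comment> \<open>The 3 comes from \<open>S w / 3 \<le> sing1 B\<close>. The power of 4 serves s
    <= 1, where \<open>sing1 B \<le> 4\<close> bounds \<open>sing1 B powr (s - 1)\<close> from
    below.\<close>
  define c where "c = min 1 (4 powr (s - 1)) / (3 * C)"
  have "0 < c" using C(1) by (simp add: c_def)
  moreover have "c * (S w * width w powr (max 1 s - 1)) \<le> measure \<mu> (cylinder w)" for w
  proof -
    define B where "B = word_matrix A w"
    note b = singular_values_width[OF B_def]
    have s1: "0 < sing1 B" using b(1) S_pos[of w] by linarith
    have "min 1 (4 powr (s - 1)) * (S w / 3 * width w powr (max 1 s - 1)) \<le> sv_function s B"
    proof (cases "s \<le> 1")
      case True
      have "4 powr (s - 1) \<le> sing1 B powr (s - 1)"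
        using True s1 b(2) S_le_4[of w] by (intro powr_mono2') auto
      then have "S w / 3 * 4 powr (s - 1) \<le> sing1 B * sing1 B powr (s - 1)"
        using b(1) s1 S_pos[of w] by (intro mult_mono) auto
      also have "sing1 B * sing1 B powr (s - 1) = sing1 B powr s"
        using s1 powr_add[of "sing1 B" 1 "s - 1"] by simp
      finally have "4 powr (s - 1) * (S w / 3) \<le> sv_function s B"
        using True by (simp add: sv_function_def mult.commute)
      moreover have "min 1 (4 powr (s - 1)) * (S w / 3) \<le> 4 powr (s - 1) * (S w / 3)"
        using S_pos[of w] by (intro mult_right_mono) auto
      moreover have "width w powr (max 1 s - 1) = 1" using True width_pos[of w] by simp
      ultimately show ?thesis by simp
    next
      case False
      have "S w / 3 * width w powr (s - 1) \<le> sing1 B * sing2 B powr (s - 1)"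
        using b width_pos[of w] s1 False by (intro mult_mono powr_mono2) auto
      then have "S w / 3 * width w powr (s - 1) \<le> sv_function s B"
        using False by (simp add: sv_function_def)
      moreover have "min 1 (4 powr (s - 1)) * (S w / 3 * width w powr (s - 1)) \<le> 1 * (S w / 3 * width w powr (s - 1))"
        using S_pos[of w] by (intro mult_right_mono) auto
      ultimately show ?thesis using False by (simp add: max_def)
    qed
    then have "min 1 (4 powr (s - 1)) * (S w / 3 * width w powr (max 1 s - 1)) / C \<le> sv_function s B / C"
      using C(1) by (intro divide_right_mono) auto
    also have "\<dots> \<le> measure \<mu> (cylinder w)" unfolding B_def by (rule C(2))
    finally show ?thesis by (simp add: c_def)
  qed
  ultimately show ?thesis using that by blast
qed

lemma measure_cylinder_le:
  assumes "1 < s"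
  obtains C where "0 < C" "\<And>w. measure \<mu> (cylinder w) \<le> C * (S w * width w powr (s - 1))"
proof -
  obtain C where C: "0 < C" "\<And>w. measure \<mu> (cylinder w) \<le> C * sv_function s (word_matrix A w)"
    using kaenmaki unfolding is_kaenmaki_measure_def by blast
  have "measure \<mu> (cylinder w) \<le> (C * 3 powr (s - 1)) * (S w * width w powr (s - 1))" for w
  proof -
    define B where "B = word_matrix A w"
    note b = singular_values_width[OF B_def]
    have "sing1 B * sing2 B powr (s - 1) \<le> S w * (3 * width w) powr (s - 1)"
      using b width_pos[of w] S_pos[of w] assms by (intro mult_mono powr_mono2) auto
    also have "\<dots> = 3 powr (s - 1) * (S w * width w powr (s - 1))"
      using width_pos[of w] by (simp add: powr_mult)
    finally have "sv_function s B \<le> 3 powr (s - 1) * (S w * width w powr (s - 1))"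
      using assms by (simp add: sv_function_def)
    then have "C * sv_function s B \<le> C * (3 powr (s - 1) * (S w * width w powr (s - 1)))"
      using C(1) by (intro mult_left_mono) auto
    then show ?thesis using C(2)[of w] by (simp add: B_def mult.assoc)
  qed
  moreover have "0 < C * 3 powr (s - 1)" using C(1) by simp
  ultimately show ?thesis using that by blast
qed

text \<open>The upper half of the quasi-Bernoulli property. Both the quasi-independence of past and
  future and the comparison of a restricted shifted measure with \<open>\<mu>\<close> rest on
  it.\<close>

lemma measure_cylinder_append_le:
  assumes "1 < s"
  obtains C where "0 < C"
    "\<And>u v. measure \<mu> (cylinder (u @ v)) \<le> C * measure \<mu> (cylinder u) * measure \<mu> (cylinder v)"
proof -
  obtain c where c: "0 < c" "\<And>w. c * (S w * width w powr (max 1 s - 1)) \<le> measure \<mu> (cylinder w)"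
    by (rule measure_cylinder_ge) blast
  have c2: "c * (S w * width w powr (s - 1)) \<le> measure \<mu> (cylinder w)" for w
    using c(2)[of w] assms by simp
  obtain C where C: "0 < C" "\<And>w. measure \<mu> (cylinder w) \<le> C * (S w * width w powr (s - 1))"
    by (rule measure_cylinder_le[OF assms]) blast
  define K where "K = C * (1 + kappa) powr (s - 1) / (c * c)"
  have "measure \<mu> (cylinder (u @ v)) \<le> K * measure \<mu> (cylinder u) * measure \<mu> (cylinder v)" for u v
  proof -
    have "width (u @ v) powr (s - 1) \<le> ((1 + kappa) * width u * width v) powr (s - 1)"
      using width_append_le[of u v] width_pos[of "u @ v"] assms by (intro powr_mono2) auto
    also have "\<dots> = (1 + kappa) powr (s - 1) * width u powr (s - 1) * width v powr (s - 1)"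
      using width_pos[of u] width_pos[of v] kappa_ge_1 by (simp add: powr_mult)
    finally have "S (u @ v) * width (u @ v) powr (s - 1)
        \<le> (S u * S v) * ((1 + kappa) powr (s - 1) * width u powr (s - 1) * width v powr (s - 1))"
      using S_append_le[of u v] S_pos[of "u @ v"] by (intro mult_mono) auto
    then have "measure \<mu> (cylinder (u @ v))
        \<le> C * ((S u * S v) * ((1 + kappa) powr (s - 1) * width u powr (s - 1) * width v powr (s - 1)))"
      using C(1) order_trans[OF C(2) mult_left_mono] by simp
    also have "\<dots> = K * ((c * (S u * width u powr (s - 1))) * (c * (S v * width v powr (s - 1))))"
      using c(1) by (simp add: K_def)
    also have "\<dots> \<le> K * (measure \<mu> (cylinder u) * measure \<mu> (cylinder v))"
      using c(1) C(1) S_pos[of u] S_pos[of v] c2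
      by (intro mult_left_mono mult_mono) (auto simp: K_def less_imp_le)
    finally show ?thesis by (simp add: mult.assoc)
  qed
  moreover have "0 < K" using c(1) C(1) kappa_ge_1 by (simp add: K_def)
  ultimately show ?thesis using that by blast
qed

lemma E_covered_max: "covered_with_exponent (max 1 s) E"
proof -
  obtain c where c: "0 < c" "\<And>w. c * (S w * width w powr (max 1 s - 1)) \<le> measure \<mu> (cylinder w)"
    by (rule measure_cylinder_ge) blast
  show ?thesis
    by (rule E_covered[OF measure_cylinder_split[OF mu.finite_measure_axioms sets_mu] c]) simp
qed

section \<open>The projected measure and its Frostman sets\<close>

lemma measurable_code: "code \<in> \<mu> \<rightarrow>\<^sub>M borel"
proof (rule borel_measurable_LIMSEQ_metric)
  fix n
  have "(\<lambda>w. T w 0) \<circ> (\<lambda>a. map a [0..<n]) \<in> seq_algebra \<rightarrow>\<^sub>M borel"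
    using measurable_prefix[where f = "\<lambda>k. k"] by (rule measurable_comp) simp
  then show "(\<lambda>a. T (map a [0..<n]) 0) \<in> borel_measurable \<mu>"
    using measurable_cong_sets[OF sets_mu refl] by (auto simp: comp_def)
qed (rule code_props(2))

lemma borel_E: "E \<in> sets borel"
  using compact_imp_closed[OF compact_E] by simp

sublocale M: prob_space M
  by (rule mu.prob_space_distr[OF measurable_code])

lemma measure_M: "X \<in> sets borel \<Longrightarrow> measure M X = measure \<mu> {a. code a \<in> X}"
  using measure_distr[OF measurable_code, of X] by (simp add: space_mu vimage_def)

lemma measure_M_E: "measure M E = 1"
  using mu.prob_space by (simp add: measure_M[OF borel_E] code_in_E space_mu)

lemma hausdorff_dim_measure_M_le:
  assumes "hausdorff_measure 1 X = 0" "X \<in> sets borel" "measure M X = 1"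
  shows "hausdorff_dim_measure M \<le> 1"
proof -
  have "hausdorff_dim X \<le> ereal 1"
    using hausdorff_measure_mono_exponent[OF assms(1)] by (intro hausdorff_dim_le) auto
  moreover have "hausdorff_dim_measure M \<le> hausdorff_dim X"
    unfolding hausdorff_dim_measure_def using assms
    by (intro INF_lower) (simp add: M.emeasure_eq_measure)
  ultimately show ?thesis by (simp add: one_ereal_def)
qed

lemma affinity_dim_gt_1:
  assumes "1 < hausdorff_dim_measure M"
  shows "1 < s"
proof (rule ccontr)
  assume "\<not> 1 < s"
  then have "max 1 s = 1" by simp
  then have cov: "covered_with_exponent 1 E" using E_covered_max by metis
  have "hausdorff_dim E \<le> ereal 1"
    using covered_hausdorff_measure_zero[OF cov] by (intro hausdorff_dim_le) auto
  moreover have "hausdorff_dim_measure M \<le> hausdorff_dim E"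
    unfolding hausdorff_dim_measure_def using borel_E measure_M_E
    by (intro INF_lower) (simp add: M.emeasure_eq_measure)
  ultimately show False using assms by (simp add: one_ereal_def)
qed

definition frostman_set :: "real \<Rightarrow> nat \<Rightarrow> (real^2) set" where
  "frostman_set t j = {x. \<forall>r>0. measure M (cball x r) \<le> real j * r powr t}"

text \<open>A violation at x persists nearby: a slight increase of the radius absorbs a move of the
  centre, and the bound is continuous in the radius. Closedness supplies measurability.\<close>

lemma closed_frostman_set: "closed (frostman_set t j)"
proof -
  have "open (- frostman_set t j)"
  proof (rule openI)
    fix x assume "x \<in> - frostman_set t j"
    then obtain r where r: "0 < r" "real j * r powr t < measure M (cball x r)"
      by (auto simp: frostman_set_def not_le)
    have "((\<lambda>h. real j * (r + h) powr t) \<longlongrightarrow> real j * (r + 0) powr t) (at_right 0)"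
      using r(1) by (intro tendsto_intros) auto
    then have "\<forall>\<^sub>F h in at_right 0. real j * (r + h) powr t < measure M (cball x r)"
      using r(2) by (intro order_tendstoD(2)) auto
    then obtain b where b: "0 < b" "\<And>h. 0 < h \<Longrightarrow> h < b \<Longrightarrow> real j * (r + h) powr t < measure M (cball x r)"
      unfolding eventually_at_right_field by blast
    define h where "h = b / 2"
    have h: "0 < h" "real j * (r + h) powr t < measure M (cball x r)" using b by (simp_all add: h_def)
    have "ball x h \<subseteq> - frostman_set t j"
    proof
      fix y assume "y \<in> ball x h"
      then have "cball x r \<subseteq> cball y (r + h)"
        by (auto simp: mem_ball) (smt (verit) dist_commute dist_triangle)
      then have "measure M (cball x r) \<le> measure M (cball y (r + h))"
        by (intro M.finite_measure_mono) auto
      then have "real j * (r + h) powr t < measure M (cball y (r + h))" using h(2) by linarith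
      then show "y \<in> - frostman_set t j"
        using r(1) h(1) by (auto simp: frostman_set_def not_le intro!: exI[of _ "r + h"])
    qed
    then show "\<exists>e>0. ball x e \<subseteq> - frostman_set t j" using h(1) by blast
  qed
  then show ?thesis by (simp add: closed_def)
qed

lemma borel_frostman_set: "frostman_set t j \<in> sets borel"
  using closed_frostman_set by simp

text \<open>If all these sets were null, the complement of their union would have full measure,
  while by the Vitali argument its one-dimensional Hausdorff measure vanishes, against the dimension
  assumption.\<close>

lemma frostman_set_1_positive:
  assumes "1 < hausdorff_dim_measure M"
  obtains j where "0 < measure M (frostman_set 1 j)"
proof (rule ccontr)
  assume n: "\<not> thesis"
  have zero: "measure M (frostman_set 1 j) = 0" for j
    using n that[of j] measure_nonneg[of M "frostman_set 1 j"] by linarith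
  define X where "X = - (\<Union>j. frostman_set 1 j)"
  have Xb: "X \<in> sets borel" unfolding X_def using borel_frostman_set by (intro borel_comp) auto
  have "emeasure M (\<Union>j. frostman_set 1 j) = 0"
    using zero borel_frostman_set by (intro emeasure_UN_eq_0) (auto simp: M.emeasure_eq_measure)
  then have "measure M (\<Union>j. frostman_set 1 j) = 0" by (simp add: measure_def)
  moreover have "measure M X = 1 - measure M (\<Union>j. frostman_set 1 j)"
    using M.prob_compl[of "\<Union>j. frostman_set 1 j"] borel_frostman_set
    by (auto simp: X_def Compl_eq_Diff_UNIV)
  ultimately have X1: "measure M X = 1" by simp
  have "hausdorff_measure 1 X = 0"
  proof (rule vitali_hausdorff_measure_1)
    show "finite_measure M" by (rule M.finite_measure_axioms)
    show "sets M = sets borel" by simp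
    fix x j assume "x \<in> X"
    then have "x \<notin> frostman_set 1 j" by (auto simp: X_def)
    then obtain r where "0 < r" "real j * r powr 1 < measure M (cball x r)"
      by (auto simp: frostman_set_def not_le)
    then show "\<exists>r>0. real j * r < measure M (cball x r)" by auto
  qed
  then show False using hausdorff_dim_measure_M_le[OF _ Xb X1] assms by simp
qed

lemma dimensions_of_E:
  assumes "1 < s"
    and pos: "\<And>t. 0 < t \<Longrightarrow> t < s \<Longrightarrow> \<exists>j. 0 < measure M (frostman_set t j)"
  shows "hausdorff_dim E = ereal s \<and> has_box_dim E s"
proof -
  have cov: "covered_with_exponent s E" using E_covered_max assms(1) by simp
  have H: "\<exists>j H. 0 < j \<and> H \<in> sets M \<and> 0 < measure M H \<and> H \<subseteq> E \<and>
      (\<forall>x r. x \<in> H \<longrightarrow> 0 < r \<longrightarrow> measure M (cball x r) \<le> j * r powr t)" if t: "0 < t" "t < s" for t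
  proof -
    obtain j where j: "0 < measure M (frostman_set t j)" using pos[OF t] by blast
    define H where "H = frostman_set t j \<inter> E"
    have "measure M H = measure M (frostman_set t j)"
      unfolding H_def measure_M[OF borel_frostman_set]
      using measure_M[of "frostman_set t j \<inter> E"] borel_frostman_set borel_E
      by (simp add: code_in_E)
    \<comment> \<open>\<open>Suc j\<close> in place of j makes the constant positive, as the
      Hausdorff estimate and the division below require.\<close>
    moreover have "measure M (cball x r) \<le> real (Suc j) * r powr t" if "x \<in> H" "0 < r" for x r
    proof -
      have "measure M (cball x r) \<le> real j * r powr t"
        using that by (auto simp: H_def frostman_set_def)
      also have "\<dots> \<le> real (Suc j) * r powr t" by (intro mult_right_mono) auto
      finally show ?thesis .
    qed
    ultimately show ?thesis using j borel_frostman_set borel_E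
      by (intro exI[of _ "real (Suc j)"] exI[of _ H]) (auto simp: H_def)
  qed
  have "hausdorff_dim E \<le> ereal s"
    using covered_hausdorff_measure_zero[OF cov] assms(1) by (intro hausdorff_dim_le) auto
  moreover have "ereal s \<le> hausdorff_dim E"
  proof (rule hausdorff_dim_ge)
    fix u assume u: "0 \<le> u" "u < s"
    define t where "t = (u + s) / 2"
    have t: "0 < t" "t < s" "u \<le> t" using u assms(1) by (simp_all add: t_def)
    obtain j H where "0 < j" "H \<in> sets M" "0 < measure M H" "H \<subseteq> E"
      "\<And>x r. x \<in> H \<Longrightarrow> 0 < r \<Longrightarrow> measure M (cball x r) \<le> j * r powr t"
      using H[OF t(1,2)] by blast
    then show "hausdorff_measure u E \<noteq> 0"
      using mass_distribution_hausdorff[OF M.finite_measure_axioms, of H j t E u] t u by auto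
  qed
  moreover have "has_box_dim E s"
  proof (rule has_box_dimI[OF cov])
    fix t assume t: "0 < t" "t < s"
    obtain j H where H: "0 < j" "H \<in> sets M" "0 < measure M H" "H \<subseteq> E"
      "\<And>x r. x \<in> H \<Longrightarrow> 0 < r \<Longrightarrow> measure M (cball x r) \<le> j * r powr t"
      using H[OF t] by blast
    define c where "c = measure M H / j"
    have "c * \<delta> powr (- t) \<le> real (covering_number \<delta> E)" if \<delta>: "0 < \<delta>" "\<delta> \<le> 1" for \<delta>
    proof -
      obtain \<U> where \<U>: "finite \<U>" "E \<subseteq> \<Union>\<U>" "\<And>U. U \<in> \<U> \<Longrightarrow> bounded U \<and> diameter U \<le> \<delta>"
        using cov \<delta> unfolding covered_with_exponent_def by metis
      obtain \<V> where \<V>: "finite \<V>" "card \<V> = covering_number \<delta> E" "E \<subseteq> \<Union>\<V>"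
        "\<And>U. U \<in> \<V> \<Longrightarrow> bounded U \<and> diameter U \<le> \<delta>"
        using covering_number_witness(2)[OF \<U>] by blast
      have "measure M H \<le> real (card \<V>) * (j * \<delta> powr t)"
        using H \<V> t by (intro mass_distribution_cover[OF M.finite_measure_axioms]) auto
      then show ?thesis using H(1) \<delta> \<V>(2) by (simp add: c_def powr_minus field_simps)
    qed
    moreover have "0 < c" using H by (simp add: c_def)
    ultimately show "\<exists>c>0. \<forall>\<delta>. 0 < \<delta> \<longrightarrow> \<delta> \<le> 1 \<longrightarrow> c * \<delta> powr (- t) \<le> real (covering_number \<delta> E)"
      by blast
  qed (use assms(1) in simp)
  ultimately show ?thesis by (simp add: antisym)
qed

end

section \<open>The projective line\<close>

lemma abs_rp1_eqI:
  "abs_rp1 u = abs_rp1 v" if "norm u = 1" "u = v \<or> u = - v"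
  using Quotient3_rel[OF Quotient3_rp1, of u v] that by auto

lemma norm_rep_rp1 [simp]: "norm (rep_rp1 p) = 1"
  using Quotient3_rep_reflp[OF Quotient3_rp1, of p] by auto

lemma rep_direction:
  assumes "norm v = 1"
  shows "rep_rp1 (direction v) = v \<or> rep_rp1 (direction v) = - v"
proof -
  have "sgn v = v" using assms by (simp add: sgn_div_norm)
  then show ?thesis
    using Quotient3_rep_abs[OF Quotient3_rp1, of v] assms by (auto simp: direction_def)
qed

lemma direction_scaleR:
  assumes "c \<noteq> 0"
  shows "direction (c *\<^sub>R v) = direction v"
proof (cases "v = 0")
  case False
  have "sgn (c *\<^sub>R v) = sgn v \<or> sgn (c *\<^sub>R v) = - sgn v"
    using assms by (cases "c > 0") (auto simp: sgn_scaleR)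
  then show ?thesis unfolding direction_def
    using False assms by (intro abs_rp1_eqI) (auto simp: norm_sgn)
qed simp

lemma direction_minus: "direction (- v) = direction v"
  using direction_scaleR[of "-1" v] by simp

lemma direction_sgn: "direction (sgn v) = direction v"
  by (cases "v = 0") (simp_all add: direction_def sgn_div_norm)

lemma dist_direction_le:
  assumes "norm u = 1" "norm v = 1"
  shows "dist (direction u) (direction v) \<le> norm (u - v)"
proof -
  have "dist (direction u) (direction v)
      = min (norm (rep_rp1 (direction u) - rep_rp1 (direction v)))
            (norm (rep_rp1 (direction u) + rep_rp1 (direction v)))"
    by (simp add: dist_rp1_def)
  also have "\<dots> \<le> norm (u - v)"
    using rep_direction[OF assms(1)] rep_direction[OF assms(2)]
    by (auto simp: norm_minus_commute add.commute min_le_iff_disj)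
  finally show ?thesis .
qed

lemma tendsto_direction:
  assumes "u \<longlonglongrightarrow> v" "\<And>n. norm (u n) = 1" "norm v = 1"
  shows "(\<lambda>n. direction (u n)) \<longlonglongrightarrow> direction v"
proof (rule metric_LIMSEQ_I)
  fix e :: real assume "0 < e"
  then obtain N where N: "\<And>n. n \<ge> N \<Longrightarrow> norm (u n - v) < e"
    using assms(1) by (auto simp: LIMSEQ_iff)
  then show "\<exists>N. \<forall>n\<ge>N. dist (direction (u n)) (direction v) < e"
    using dist_direction_le[OF assms(2,3)] by (meson le_less_trans)
qed

text \<open>Unit vectors in one quadrant have an inner product t between 0 and 1. Then the squared
  distance is 2 - 2t, the squared \<open>cross2\<close> is 1 - t^2, and the latter is at least 1 -
  t.\<close>

lemma norm_diff_le_cross2: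
  assumes "norm u = 1" "norm v = 1" "0 \<le> u $ 1" "u $ 2 \<le> 0" "0 \<le> v $ 1" "v $ 2 \<le> 0"
  shows "norm (u - v) \<le> 2 * \<bar>cross2 u v\<bar>"
proof -
  define t where "t = u $ 1 * v $ 1 + u $ 2 * v $ 2"
  have "0 \<le> t" using assms by (simp add: t_def mult_nonpos_nonpos)
  have uu: "(u $ 1)\<^sup>2 + (u $ 2)\<^sup>2 = 1" "(v $ 1)\<^sup>2 + (v $ 2)\<^sup>2 = 1"
    using assms(1,2) by (simp_all add: norm_vec2)
  have n: "(norm (u - v))\<^sup>2 = 2 - 2 * t"
  proof -
    have "(norm (u - v))\<^sup>2 = (u $ 1 - v $ 1)\<^sup>2 + (u $ 2 - v $ 2)\<^sup>2"
      by (simp add: norm_vec2)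
    also have "\<dots> = ((u $ 1)\<^sup>2 + (u $ 2)\<^sup>2) + ((v $ 1)\<^sup>2 + (v $ 2)\<^sup>2) - 2 * t"
      by (simp add: t_def power2_eq_square algebra_simps)
    finally show ?thesis by (simp add: uu)
  qed
  have c: "(cross2 u v)\<^sup>2 = 1 - t\<^sup>2"
  proof -
    have "(cross2 u v)\<^sup>2 + t\<^sup>2 = ((u $ 1)\<^sup>2 + (u $ 2)\<^sup>2) * ((v $ 1)\<^sup>2 + (v $ 2)\<^sup>2)"
      by (simp add: cross2_def t_def power2_eq_square algebra_simps)
    then show ?thesis by (simp add: uu)
  qed
  have "t\<^sup>2 \<le> 1" using c zero_le_power2[of "cross2 u v"] by linarith
  then have "t \<le> 1" using power2_le_imp_le[of t 1] by simp
  then have "t\<^sup>2 \<le> t" using \<open>0 \<le> t\<close> by (simp add: power2_eq_square mult_left_le_one_le)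
  then have "(norm (u - v))\<^sup>2 \<le> (2 * \<bar>cross2 u v\<bar>)\<^sup>2"
    using n c \<open>t \<le> 1\<close> by (simp add: power_mult_distrib)
  then show ?thesis by (rule power2_le_imp_le) simp
qed

subsection \<open>The Furstenberg map\<close>

lemma sgn_matrix_sgn: "sgn (B *v sgn x) = sgn (B *v (x::real^2))"
proof (cases "x = 0")
  case False
  have "B *v sgn x = (1 / norm x) *\<^sub>R (B *v x)"
    by (simp add: sgn_div_norm matrix_vector_mult_scaleR divide_inverse_commute)
  then show ?thesis using False by (simp add: sgn_scaleR)
qed simp

text \<open>Every direction in \<open>Q2\<close> has a representative here. Working in the cone
  removes the sign ambiguity and replaces limits in \<open>rp1\<close> by limits of vectors.\<close>

definition cone :: "(real^2) set" where
  "cone = {q. 0 \<le> q $ 1 \<and> q $ 2 \<le> 0 \<and> q \<noteq> 0}"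

lemma sgn_cone: "q \<in> cone \<Longrightarrow> sgn q \<in> cone"
  by (auto simp: cone_def sgn_div_norm sgn_zero_iff mult_nonneg_nonpos)

context positive_matrices
begin

text \<open>A vector representing the composed inverse action in which c 0 acts last. The adjugate
  reverses products, hence \<open>rev\<close>.\<close>

definition past_dir :: "nat \<Rightarrow> (nat \<Rightarrow> 'm) \<Rightarrow> real^2 \<Rightarrow> real^2" where
  "past_dir n c q = sgn (adjugate2 (word_matrix A (rev (map c [0..<n]))) *v q)"

definition rho :: "(nat \<Rightarrow> 'm) \<Rightarrow> real^2" where
  "rho c = lim (\<lambda>n. past_dir n c (vector [1, -1]))"

lemma adjugate2_in_cone: "q \<in> cone \<Longrightarrow> adjugate2 (word_matrix A w) *v q \<in> cone"
proof -
  assume q: "q \<in> cone"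
  define p where "p = adjugate2 (word_matrix A w) *v q"
  have c: "0 \<le> q $ 1" "q $ 2 \<le> 0" "q \<noteq> 0" using q by (auto simp: cone_def)
  note a = adjugate2_cone[OF c(1,2) p_def]
  have "0 < S w * norm q" using S_pos c by simp
  then have "p \<noteq> 0" using a(3) by auto
  then show ?thesis using a(1,2) by (simp add: cone_def p_def)
qed

lemma past_dir_cone: "q \<in> cone \<Longrightarrow> past_dir n c q \<in> cone"
  unfolding past_dir_def by (intro sgn_cone adjugate2_in_cone)

lemma norm_past_dir: "q \<in> cone \<Longrightarrow> norm (past_dir n c q) = 1"
  unfolding past_dir_def using adjugate2_in_cone[of q] by (auto simp: norm_sgn cone_def)

lemma past_dir_append:
  "past_dir (n + k) c q
     = past_dir n c (adjugate2 (word_matrix A (rev (map (\<lambda>j. c (n + j)) [0..<k]))) *v q)"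
  unfolding past_dir_def map_upt_append rev_append word_matrix_append adjugate2_mult
  by (simp add: matrix_vector_mul_assoc)

text \<open>The adjugate multiplies \<open>cross2\<close> by the determinant while it stretches both
  vectors by about \<open>S w\<close>. The sine of the angle between them thus shrinks at the rate
  \<open>D w / (S w)^2\<close> of \<open>D_decay\<close>.\<close>

lemma past_dir_contract:
  obtains \<gamma> K where "0 < \<gamma>" "\<gamma> < 1"
    "\<And>n c p q. p \<in> cone \<Longrightarrow> q \<in> cone \<Longrightarrow> norm (past_dir n c p - past_dir n c q) \<le> K * \<gamma> ^ n"
proof -
  obtain \<gamma> where \<gamma>: "0 < \<gamma>" "\<gamma> < 1" "\<And>w. D w \<le> \<gamma> ^ length w * (S w)\<^sup>2"
    by (rule D_decay) blast
  define L where "L = 2 * (1 + kappa)"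
  have L: "0 < L" using kappa_ge_1 by (simp add: L_def)
  have "norm (past_dir n c p - past_dir n c q) \<le> (2 * L\<^sup>2) * \<gamma> ^ n"
    if p: "p \<in> cone" and q: "q \<in> cone" for n c p q
  proof -
    define w where "w = rev (map c [0..<n])"
    define p' q' where "p' = adjugate2 (word_matrix A w) *v p" and "q' = adjugate2 (word_matrix A w) *v q"
    have cp: "0 \<le> p $ 1" "p $ 2 \<le> 0" "p \<noteq> 0" and cq: "0 \<le> q $ 1" "q $ 2 \<le> 0" "q \<noteq> 0"
      using p q by (auto simp: cone_def)
    have np: "S w * norm p \<le> L * norm p'" "S w * norm q \<le> L * norm q'"
      using adjugate2_cone(3)[OF cp(1,2) p'_def] adjugate2_cone(3)[OF cq(1,2) q'_def]
      by (simp_all add: L_def)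
    have p0: "0 < norm p'" "0 < norm q'"
      using adjugate2_in_cone[OF p, of w] adjugate2_in_cone[OF q, of w]
      by (auto simp: p'_def q'_def cone_def)
    have pq: "0 < norm p" "0 < norm q" using cp cq by auto
    have d: "past_dir n c p = sgn p'" "past_dir n c q = sgn q'"
      by (simp_all add: past_dir_def p'_def q'_def w_def)
    have "\<bar>cross2 p' q'\<bar> * (S w * norm p) * (S w * norm q)
        \<le> D w * (norm p * norm q) * (L * norm p') * (L * norm q')"
    proof (intro mult_mono[OF mult_mono[OF _ np(1)] np(2)])
      have "\<bar>cross2 p' q'\<bar> = D w * \<bar>cross2 p q\<bar>"
        by (simp add: p'_def q'_def cross2_adjugate2 abs_mult D_def)
      also have "\<dots> \<le> D w * (norm p * norm q)"
        using abs_cross2_le D_pos[of w] by (intro mult_left_mono) auto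
      finally show "\<bar>cross2 p' q'\<bar> \<le> D w * (norm p * norm q)" .
    qed (use S_pos[of w] D_pos[of w] L in \<open>auto intro!: mult_nonneg_nonneg less_imp_le\<close>)
    also have "D w * (norm p * norm q) * (L * norm p') * (L * norm q')
        \<le> (\<gamma> ^ n * (S w)\<^sup>2) * (norm p * norm q) * (L * norm p') * (L * norm q')"
      using \<gamma>(3)[of w] L by (intro mult_right_mono) (auto simp: w_def)
    finally have "(\<bar>cross2 p' q'\<bar>) * ((S w)\<^sup>2 * (norm p * norm q))
        \<le> (L\<^sup>2 * \<gamma> ^ n * (norm p' * norm q')) * ((S w)\<^sup>2 * (norm p * norm q))"
      by (simp add: power2_eq_square mult_ac)
    moreover have "0 < (S w)\<^sup>2 * (norm p * norm q)" using S_pos[of w] pq by simp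
    ultimately have c1: "\<bar>cross2 p' q'\<bar> \<le> L\<^sup>2 * \<gamma> ^ n * (norm p' * norm q')"
      by (simp only: mult_le_cancel_right_pos)
    have "cross2 (sgn p') (sgn q') = cross2 p' q' / (norm p' * norm q')"
      by (simp add: sgn_div_norm cross2_scaleR_left cross2_scaleR_right field_simps)
    then have "\<bar>cross2 (sgn p') (sgn q')\<bar> \<le> L\<^sup>2 * \<gamma> ^ n"
      using c1 p0 by (simp add: abs_mult divide_le_eq)
    moreover have "norm (sgn p' - sgn q') \<le> 2 * \<bar>cross2 (sgn p') (sgn q')\<bar>"
      using past_dir_cone[OF p, of n c] past_dir_cone[OF q, of n c] norm_past_dir[OF p, of n c]
        norm_past_dir[OF q, of n c]
      unfolding d by (intro norm_diff_le_cross2) (auto simp: cone_def)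
    ultimately show ?thesis unfolding d by simp
  qed
  then show ?thesis using that \<gamma>(1,2) by blast
qed

lemma vec_1_minus_1_cone: "vector [1, -1] \<in> cone"
  by (simp add: cone_def vec2_eq_iff)

lemma past_dir_tendsto:
  assumes q: "q \<in> cone"
  shows "(\<lambda>n. past_dir n c q) \<longlonglongrightarrow> rho c"
proof -
  let ?q = "vector [1, -1] :: real^2"
  obtain \<gamma> K where K: "0 < \<gamma>" "\<gamma> < 1"
    "\<And>n c p q. p \<in> cone \<Longrightarrow> q \<in> cone \<Longrightarrow> norm (past_dir n c p - past_dir n c q) \<le> K * \<gamma> ^ n"
    by (rule past_dir_contract) blast
  have lim: "(\<lambda>n. K * \<gamma> ^ n) \<longlonglongrightarrow> 0"
    using tendsto_mult_right_zero[OF LIMSEQ_power_zero[of \<gamma>], of K] K(1,2) by simp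
  have "Cauchy (\<lambda>n. past_dir n c ?q)"
  proof (rule CauchyI')
    fix e :: real assume "0 < e"
    then obtain N where N: "\<And>n. n \<ge> N \<Longrightarrow> K * \<gamma> ^ n < e"
      using order_tendstoD(2)[OF lim] by (auto simp: eventually_sequentially)
    have "dist (past_dir m c ?q) (past_dir n c ?q) < e" if "N \<le> m" "m < n" for m n
    proof -
      obtain k where k: "n = m + k" using \<open>m < n\<close> less_imp_add_positive by blast
      \<comment> \<open>\<open>past_dir (m + k)\<close> is \<open>past_dir m\<close> applied to
        another vector of the cone, so the contraction estimate gives the Cauchy property.\<close>
      show ?thesis unfolding k past_dir_append dist_norm
        using K(3)[OF vec_1_minus_1_cone adjugate2_in_cone[OF vec_1_minus_1_cone]] N[OF \<open>N \<le> m\<close>]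
        by (meson le_less_trans)
    qed
    then show "\<exists>M. \<forall>m\<ge>M. \<forall>n>m. dist (past_dir m c ?q) (past_dir n c ?q) < e" by blast
  qed
  then have 1: "(\<lambda>n. past_dir n c ?q) \<longlonglongrightarrow> rho c"
    unfolding rho_def by (simp add: Cauchy_convergent_iff convergent_LIMSEQ_iff)
  have "(\<lambda>n. past_dir n c q - past_dir n c ?q) \<longlonglongrightarrow> 0"
    by (rule Lim_null_comparison[OF _ lim]) (use K(3)[OF q vec_1_minus_1_cone] in auto)
  from tendsto_add[OF this 1] show ?thesis by simp
qed

lemma norm_rho: "norm (rho c) = 1"
proof -
  have "(\<lambda>n. norm (past_dir n c (vector [1, -1]))) \<longlonglongrightarrow> norm (rho c)"
    by (intro tendsto_norm past_dir_tendsto vec_1_minus_1_cone)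
  then show ?thesis using norm_past_dir[OF vec_1_minus_1_cone] by (simp add: LIMSEQ_const_iff)
qed

lemma rho_cone: "rho c \<in> cone"
proof -
  let ?q = "vector [1, -1] :: real^2"
  have t: "(\<lambda>n. past_dir n c ?q $ i) \<longlonglongrightarrow> rho c $ i" for i
    by (intro tendsto_vec_nth past_dir_tendsto vec_1_minus_1_cone)
  have m: "past_dir n c ?q \<in> cone" for n by (rule past_dir_cone[OF vec_1_minus_1_cone])
  have "0 \<le> rho c $ 1" using m by (intro LIMSEQ_le_const[OF t]) (auto simp: cone_def)
  moreover have "rho c $ 2 \<le> 0" using m by (intro LIMSEQ_le_const2[OF t]) (auto simp: cone_def)
  moreover have "rho c \<noteq> 0" using norm_rho[of c] by auto
  ultimately show ?thesis by (simp add: cone_def)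
qed

lemma measurable_rho: "rho \<in> seq_algebra \<rightarrow>\<^sub>M borel"
proof (rule borel_measurable_LIMSEQ_metric)
  fix n
  have "(\<lambda>w. sgn (adjugate2 (word_matrix A (rev w)) *v vector [1, -1])) \<circ> (\<lambda>c. map c [0..<n])
      \<in> seq_algebra \<rightarrow>\<^sub>M borel"
    using measurable_prefix[where f = "\<lambda>k. k"] by (rule measurable_comp) simp
  then show "(\<lambda>c. past_dir n c (vector [1, -1])) \<in> borel_measurable seq_algebra"
    by (simp add: comp_def past_dir_def)
qed (rule past_dir_tendsto[OF vec_1_minus_1_cone])

lemma inverse_action_word:
  assumes "q \<noteq> 0"
  shows "word_map (inverse_action A) w (direction q) = direction (adjugate2 (word_matrix A (rev w)) *v q)"
    and "adjugate2 (word_matrix A (rev w)) *v q \<noteq> 0"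
proof (induction w)
  case Nil
  { case 1 show ?case by (simp add: adjugate2_mat1) }
  { case 2 show ?case using assms by (simp add: adjugate2_mat1) }
next
  case (Cons i w)
  define p where "p = adjugate2 (word_matrix A (rev w)) *v q"
  have eq: "adjugate2 (word_matrix A (rev (i # w))) *v q = adjugate2 (A i) *v p"
    by (simp add: word_matrix_append adjugate2_mult p_def matrix_vector_mul_assoc)
  have di: "det (A i) \<noteq> 0" using invertible invertible_det_nz by blast
  have inj: "adjugate2 (A i) *v p \<noteq> 0"
  proof
    assume "adjugate2 (A i) *v p = 0"
    then have "matrix_inv (A i) *v p = 0" by (simp add: matrix_inv_adjugate2[OF invertible])
    then have "A i *v (matrix_inv (A i) *v p) = 0" by simp
    then have "p = 0"
      using someI_ex[of "\<lambda>C. A i ** C = mat 1 \<and> C ** A i = mat 1"] invertible[of i]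
      by (simp add: matrix_vector_mul_assoc matrix_inv_def invertible_def)
    then show False using Cons(2) by (simp add: p_def)
  qed
  { case 1
    have "rep_rp1 (direction p) = sgn p \<or> rep_rp1 (direction p) = - sgn p"
      using rep_direction[of "sgn p"] Cons(2) by (simp add: norm_sgn p_def direction_sgn)
    then obtain c where c: "c \<noteq> 0" "rep_rp1 (direction p) = c *\<^sub>R p"
    proof
      assume "rep_rp1 (direction p) = sgn p"
      then show ?thesis using that[of "1 / norm p"] Cons(2) by (simp add: sgn_div_norm p_def divide_inverse)
    next
      assume "rep_rp1 (direction p) = - sgn p"
      then show ?thesis using that[of "- (1 / norm p)"] Cons(2) by (simp add: sgn_div_norm p_def divide_inverse)
    qed
    have "word_map (inverse_action A) (i # w) (direction q) = inverse_action A i (direction p)"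
      using Cons(1) by (simp add: p_def)
    also have "\<dots> = direction ((c / det (A i)) *\<^sub>R (adjugate2 (A i) *v p))"
      by (simp add: inverse_action_def c(2) matrix_inv_adjugate2[OF invertible] matrix_vector_mult_scaleR)
    also have "\<dots> = direction (adjugate2 (A i) *v p)" using c(1) di by (intro direction_scaleR) simp
    finally show ?case unfolding eq . }
  { case 2 show ?case unfolding eq by (rule inj) }
qed

lemma furstenberg_map_eq: "furstenberg_map A a = direction (rho (\<lambda>k. a (- int k)))"
proof -
  define c where "c k = a (- int k)" for k
  have lim: "(\<lambda>n. word_map (inverse_action A) (map c [0..<Suc n]) \<theta>) \<longlonglongrightarrow> direction (rho c)"
    if \<theta>: "\<theta> \<in> Q2" for \<theta>
  proof -
    obtain v where v: "v \<noteq> 0" "v $ 1 * v $ 2 \<le> 0" "\<theta> = direction v" using \<theta> by (auto simp: Q2_def)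
    obtain q where q: "q \<in> cone" "\<theta> = direction q"
    proof (cases "0 \<le> v $ 1 \<and> v $ 2 \<le> 0")
      case True then show ?thesis using that[of v] v by (simp add: cone_def)
    next
      case False
      then have "0 \<le> (- v) $ 1 \<and> (- v) $ 2 \<le> 0"
        using v(2) by (auto simp: mult_le_0_iff)
      then show ?thesis using that[of "- v"] v by (simp add: cone_def direction_minus)
    qed
    have "word_map (inverse_action A) (map c [0..<n]) \<theta> = direction (past_dir n c q)" for n
      using inverse_action_word(1)[of q "map c [0..<n]"] q
      by (simp add: past_dir_def direction_sgn cone_def)
    moreover have "(\<lambda>n. direction (past_dir (Suc n) c q)) \<longlonglongrightarrow> direction (rho c)"
      by (intro tendsto_direction LIMSEQ_Suc past_dir_tendsto norm_past_dir norm_rho q)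
    ultimately show ?thesis by (simp only:)
  qed
  have ex: "direction (vector [1, -1]) \<in> Q2"
    unfolding Q2_def by (intro imageI) (simp add: vec2_eq_iff)
  have "(THE p. \<forall>\<theta>\<in>Q2. (\<lambda>n. word_map (inverse_action A) (map c [0..<Suc n]) \<theta>) \<longlonglongrightarrow> p) = direction (rho c)"
  proof (rule the_equality)
    fix p assume "\<forall>\<theta>\<in>Q2. (\<lambda>n. word_map (inverse_action A) (map c [0..<Suc n]) \<theta>) \<longlonglongrightarrow> p"
    then show "p = direction (rho c)" using LIMSEQ_unique[OF _ lim[OF ex]] ex by blast
  qed (use lim in blast)
  moreover have "c = (\<lambda>k. a (- int k))" by (rule ext) (simp add: c_def)
  ultimately show ?thesis by (simp only: furstenberg_map_def)
qed

text \<open>Equivariance of \<open>rho\<close>. The shift moves n symbols of the future into the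
  past, where they are read backwards; the \<open>rev\<close> in \<open>past_dir\<close> restores
  their order and produces the word of the future.\<close>

lemma rho_shift:
  fixes a :: "int \<Rightarrow> 'm"
  defines "past b \<equiv> \<lambda>k. b (- int k)"
  shows "rho (past (\<lambda>k. a (k + int n)))
    = sgn (adjugate2 (word_matrix A (map (\<lambda>k. a (int k + 1)) [0..<n])) *v rho (past a))"
proof (rule LIMSEQ_unique)
  let ?q = "vector [1, -1] :: real^2"
  define c' where "c' = past (\<lambda>k. a (k + int n))"
  define w where "w = map (\<lambda>k. a (int k + 1)) [0..<n]"
  have w: "rev (map c' [0..<n]) = w"
    by (rule nth_equalityI) (auto simp: w_def c'_def past_def rev_nth of_nat_diff intro!: arg_cong[of _ _ a])
  have p: "(\<lambda>j. c' (n + j)) = past a" by (auto simp: c'_def past_def)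
  have eq: "past_dir (n + k) c' ?q = sgn (adjugate2 (word_matrix A w) *v past_dir k (past a) ?q)" for k
    unfolding past_dir_append[of n k] p unfolding past_dir_def w
    by (simp add: sgn_matrix_sgn)
  show "(\<lambda>k. past_dir (n + k) c' ?q) \<longlonglongrightarrow> rho (past (\<lambda>k. a (k + int n)))"
    using LIMSEQ_ignore_initial_segment[OF past_dir_tendsto[OF vec_1_minus_1_cone, of c'], of n]
    by (simp add: add.commute c'_def)
  have "adjugate2 (word_matrix A w) *v rho (past a) \<noteq> 0"
    using adjugate2_in_cone[OF rho_cone] by (simp add: cone_def)
  then have "(\<lambda>k. sgn (adjugate2 (word_matrix A w) *v past_dir k (past a) ?q))
      \<longlonglongrightarrow> sgn (adjugate2 (word_matrix A w) *v rho (past a))"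
    by (intro tendsto_sgn bounded_linear.tendsto[OF matrix_vector_mul_bounded_linear]
        past_dir_tendsto vec_1_minus_1_cone)
  then show "(\<lambda>k. past_dir (n + k) c' ?q)
      \<longlonglongrightarrow> sgn (adjugate2 (word_matrix A (map (\<lambda>k. a (int k + 1)) [0..<n])) *v rho (past a))"
    unfolding eq w_def .
qed

text \<open>
  The preimage under \<^term>\<open>word_matrix A w\<close> of a disc of radius \<open>r\<close> lies in a strip of width
  about \<open>r / S w\<close> whose direction is exactly the Furstenberg direction at time \<open>n\<close>.
\<close>

lemma cross2_rho_shift_le:
  fixes a :: "int \<Rightarrow> 'm"
  defines "past b \<equiv> \<lambda>k. b (- int k)"
  assumes w: "w = map (\<lambda>k. a (int k + 1)) [0..<n]"
  shows "\<bar>cross2 (rho (past (\<lambda>k. a (k + int n)))) v\<bar> \<le> 2 * (1 + kappa) * norm (word_matrix A w *v v) / S w"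
proof -
  define q where "q = rho (past a)"
  define p where "p = adjugate2 (word_matrix A w) *v q"
  have q: "0 \<le> q $ 1" "q $ 2 \<le> 0" "norm q = 1"
    using rho_cone norm_rho by (auto simp: q_def cone_def)
  have np: "S w \<le> 2 * (1 + kappa) * norm p" using adjugate2_cone(3)[OF q(1,2) p_def] q(3) by simp
  have p0: "0 < norm p" using adjugate2_in_cone[OF rho_cone] by (auto simp: p_def q_def cone_def)
  have "rho (past (\<lambda>k. a (k + int n))) = sgn p"
    using rho_shift[of a n] by (simp add: past_def p_def q_def w)
  then have "\<bar>cross2 (rho (past (\<lambda>k. a (k + int n)))) v\<bar> = \<bar>cross2 p v\<bar> / norm p"
    by (simp add: sgn_div_norm cross2_scaleR_left abs_mult divide_inverse_commute)
  also have "\<dots> \<le> norm (word_matrix A w *v v) / norm p"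
    using abs_cross2_le[of q "word_matrix A w *v v"] q(3) p0
    by (intro divide_right_mono) (auto simp: p_def cross2_adjugate2_left)
  also have "\<dots> \<le> 2 * (1 + kappa) * norm (word_matrix A w *v v) / S w"
  proof -
    have "norm (word_matrix A w *v v) * S w \<le> norm (word_matrix A w *v v) * (2 * (1 + kappa) * norm p)"
      using np by (intro mult_left_mono) auto
    then show ?thesis using p0 S_pos[of w] by (simp add: field_simps)
  qed
  finally show ?thesis .
qed

end

section \<open>Transversality\<close>

definition unit_vec :: "real \<Rightarrow> real^2" where
  "unit_vec t = vector [cos t, sin t]"

text \<open>A dyadic energy. If it is at most L for \<open>\<rho> = 2 powr (1 - \<epsilon>)\<close>,
  then strips through x in direction e of half-width \<open>\<delta>\<close> have measure at most a
  multiple, depending on L alone, of \<open>\<delta> powr (1 - \<epsilon>)\<close>.\<close>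

definition strip_sum :: "(real^2) measure \<Rightarrow> real \<Rightarrow> real^2 \<Rightarrow> real^2 \<Rightarrow> ennreal" where
  "strip_sum M \<rho> x e = (\<Sum>k. ennreal (\<rho> ^ k) * emeasure M {y. \<bar>cross2 e (x - y)\<bar> \<le> (1/2) ^ k})"

lemma strip_sum_minus: "strip_sum M \<rho> x (- e) = strip_sum M \<rho> x e"
proof -
  have "\<bar>cross2 (- e) v\<bar> = \<bar>cross2 e v\<bar>" for v
    using cross2_scaleR_left[of "-1" e v] by simp
  then show ?thesis by (simp add: strip_sum_def)
qed

lemma norm_unit_vec [simp]: "norm (unit_vec t) = 1"
  by (simp add: unit_vec_def norm_vec2)

lemma measurable_cart_nth [measurable]: "(\<lambda>x::real^2. x $ i) \<in> borel_measurable borel"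
  by (intro borel_measurable_continuous_onI continuous_intros)

lemma measurable_strip_sum:
  assumes "sigma_finite_measure M" and [measurable_cong]: "sets M = sets borel"
  shows "(\<lambda>(x, e). strip_sum M \<rho> x e) \<in> borel_measurable (borel \<Otimes>\<^sub>M borel)"
proof -
  interpret sigma_finite_measure M by fact
  \<comment> \<open>Written as an integral with parameters, the strip measure is seen to be jointly
    measurable in x and e.\<close>
  have eq: "emeasure M {y. \<bar>cross2 e (x - y)\<bar> \<le> c} = (\<integral>\<^sup>+y. indicator {z. \<bar>cross2 e z\<bar> \<le> c} (x - y) \<partial>M)"
    for x e c
  proof -
    have [measurable]: "{y. \<bar>cross2 e (x - y)\<bar> \<le> c} \<in> sets borel"
      unfolding cross2_def by measurable
    have "(\<integral>\<^sup>+y. indicator {z. \<bar>cross2 e z\<bar> \<le> c} (x - y) \<partial>M)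
        = (\<integral>\<^sup>+y. indicator {y. \<bar>cross2 e (x - y)\<bar> \<le> c} y \<partial>M)"
      by (intro nn_integral_cong) (auto simp: indicator_def)
    then show ?thesis by (simp add: assms(2))
  qed
  have [measurable]: "(\<lambda>p. \<integral>\<^sup>+y. indicator {z. \<bar>cross2 (snd p) z\<bar> \<le> c} (fst p - y) \<partial>M)
      \<in> borel_measurable (borel \<Otimes>\<^sub>M borel)" for c
  proof (rule borel_measurable_nn_integral)
    have "(\<lambda>(p :: (real^2) \<times> (real^2), y). indicator {z. \<bar>cross2 (snd p) z\<bar> \<le> c} (fst p - y) :: ennreal)
       = indicator {q :: ((real^2) \<times> (real^2)) \<times> (real^2).
           \<bar>cross2 (snd (fst q)) (fst (fst q) - snd q)\<bar> \<le> c}"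
      by (auto simp: indicator_def fun_eq_iff)
    moreover have "{q \<in> space ((borel \<Otimes>\<^sub>M borel) \<Otimes>\<^sub>M M).
           \<bar>cross2 (snd (fst q)) (fst (fst q) - snd q)\<bar> \<le> c} \<in> sets ((borel \<Otimes>\<^sub>M borel) \<Otimes>\<^sub>M M)"
      unfolding cross2_def vector_minus_component by measurable
    ultimately show "(\<lambda>(p :: (real^2) \<times> (real^2), y). indicator {z. \<bar>cross2 (snd p) z\<bar> \<le> c} (fst p - y) :: ennreal)
       \<in> borel_measurable ((borel \<Otimes>\<^sub>M borel) \<Otimes>\<^sub>M M)"
      by (simp add: space_pair_measure sets_eq_imp_space_eq[OF assms(2)])
  qed
  show ?thesis unfolding strip_sum_def eq split_beta' by measurable
qed

section \<open>Angles whose strip contains a given point\<close>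

lemma abs_le_2_abs_sin:
  assumes "\<bar>u\<bar> \<le> pi / 2"
  shows "\<bar>u\<bar> \<le> 2 * \<bar>sin u\<bar>"
proof -
  \<comment> \<open>Up to pi/3 the function 2 sin y - y increases; beyond that, 2 sin x is at least
    the square root of 3, which exceeds 1.7 and hence pi/2.\<close>
  have pos: "x \<le> 2 * sin x" if x: "0 \<le> x" "x \<le> pi / 2" for x :: real
  proof (cases "x \<le> pi / 3")
    case True
    define f where "f y = 2 * sin y - y" for y :: real
    have "f 0 \<le> f x"
    proof (rule DERIV_nonneg_imp_nondecreasing[OF x(1)])
      fix y assume y: "0 \<le> y" "y \<le> x"
      have "cos (pi / 3) \<le> cos y" using y True by (intro cos_monotone_0_pi_le) auto
      then have "0 \<le> 2 * cos y - 1" by (simp add: cos_60)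
      moreover have "DERIV f y :> 2 * cos y - 1"
        unfolding f_def by (auto intro!: derivative_eq_intros)
      ultimately show "\<exists>z. DERIV f y :> z \<and> 0 \<le> z" by blast
    qed
    then show ?thesis by (simp add: f_def)
  next
    case False
    have "sin (pi / 3) \<le> sin x" using False x by (intro sin_monotone_2pi_le) auto
    moreover have "(1.7::real) \<le> sqrt 3" by (rule real_le_rsqrt) (simp add: power2_eq_square)
    moreover have "pi < 3.3" using pi_approx by simp
    ultimately show ?thesis using x by (simp add: sin_60)
  qed
  show ?thesis
  proof (cases "0 \<le> u")
    case True then show ?thesis using pos[of u] assms by simp
  next
    case False then show ?thesis using pos[of "- u"] assms by simp
  qed
qed

text \<open>If t and t0 both belong to the set, eliminating v shows that sin (t - t0) is at most
  \<open>2 * \<delta> / norm v\<close> in absolute value, so t is close to t0 or to t0 plus or minus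
  pi.\<close>

lemma emeasure_angles_le:
  assumes "v \<noteq> 0" "0 \<le> \<delta>"
  shows "emeasure lborel {t \<in> {0..<pi}. \<bar>cross2 (unit_vec t) v\<bar> \<le> \<delta>} \<le> ennreal (24 * (\<delta> / norm v))"
proof (cases "{t \<in> {0..<pi}. \<bar>cross2 (unit_vec t) v\<bar> \<le> \<delta>} = {}")
  case True
  then show ?thesis by (simp only: emeasure_empty) simp
next
  case False
  then obtain t0 where t0: "0 \<le> t0" "t0 < pi" "\<bar>cross2 (unit_vec t0) v\<bar> \<le> \<delta>" by auto
  define \<eta> where "\<eta> = 4 * (\<delta> / norm v)"
  have \<eta>: "0 \<le> \<eta>" using assms by (simp add: \<eta>_def)
  \<comment> \<open>Three intervals of length \<open>2 * \<eta>\<close> each, whence the constant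
    24.\<close>
  have sub: "{t \<in> {0..<pi}. \<bar>cross2 (unit_vec t) v\<bar> \<le> \<delta>}
      \<subseteq> {t0 - \<eta>..t0 + \<eta>} \<union> {t0 + pi - \<eta>..t0 + pi + \<eta>} \<union> {t0 - pi - \<eta>..t0 - pi + \<eta>}"
  proof
    fix t assume "t \<in> {t \<in> {0..<pi}. \<bar>cross2 (unit_vec t) v\<bar> \<le> \<delta>}"
    then have t: "0 \<le> t" "t < pi" "\<bar>cross2 (unit_vec t) v\<bar> \<le> \<delta>" by auto
    define u where "u = t - t0"
    have "sin u *\<^sub>R v = cross2 (unit_vec t0) v *\<^sub>R unit_vec t - cross2 (unit_vec t) v *\<^sub>R unit_vec t0"
      by (simp add: vec2_eq_iff cross2_def unit_vec_def u_def sin_diff algebra_simps)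
    then have "\<bar>sin u\<bar> * norm v = norm (cross2 (unit_vec t0) v *\<^sub>R unit_vec t - cross2 (unit_vec t) v *\<^sub>R unit_vec t0)"
      by (metis norm_scaleR real_norm_def)
    also have "\<dots> \<le> \<bar>cross2 (unit_vec t0) v\<bar> + \<bar>cross2 (unit_vec t) v\<bar>"
      by (rule order_trans[OF norm_triangle_ineq4]) simp
    also have "\<dots> \<le> 2 * \<delta>" using t t0 by simp
    finally have "\<bar>sin u\<bar> * norm v \<le> 2 * \<delta>" .
    then have "\<bar>sin u\<bar> \<le> 2 * \<delta> / norm v" using assms(1) by (subst pos_le_divide_eq) auto
    then have s: "2 * \<bar>sin u\<bar> \<le> \<eta>" by (simp add: \<eta>_def)
    consider "\<bar>u\<bar> \<le> pi / 2" | "pi / 2 < u" | "u < - (pi / 2)" by linarith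
    then show "t \<in> {t0 - \<eta>..t0 + \<eta>} \<union> {t0 + pi - \<eta>..t0 + pi + \<eta>} \<union> {t0 - pi - \<eta>..t0 - pi + \<eta>}"
    proof cases
      case 1
      then have "\<bar>u\<bar> \<le> \<eta>" using abs_le_2_abs_sin[OF 1] s by simp
      then show ?thesis by (simp add: u_def abs_le_iff)
    next
      case 2
      have "\<bar>u - pi\<bar> \<le> 2 * \<bar>sin (u - pi)\<bar>"
        using 2 t t0 by (intro abs_le_2_abs_sin) (simp add: u_def)
      then have "\<bar>u - pi\<bar> \<le> \<eta>" using s by simp
      then show ?thesis by (simp add: u_def abs_le_iff)
    next
      case 3
      have "\<bar>u + pi\<bar> \<le> 2 * \<bar>sin (u + pi)\<bar>"
        using 3 t t0 by (intro abs_le_2_abs_sin) (simp add: u_def)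
      then have "\<bar>u + pi\<bar> \<le> \<eta>" using s by simp
      then show ?thesis by (simp add: u_def abs_le_iff)
    qed
  qed
  have "emeasure lborel {t \<in> {0..<pi}. \<bar>cross2 (unit_vec t) v\<bar> \<le> \<delta>}
      \<le> emeasure lborel ({t0 - \<eta>..t0 + \<eta>} \<union> {t0 + pi - \<eta>..t0 + pi + \<eta>} \<union> {t0 - pi - \<eta>..t0 - pi + \<eta>})"
    by (rule emeasure_mono[OF sub]) simp
  also have "\<dots> \<le> emeasure lborel {t0 - \<eta>..t0 + \<eta>} + emeasure lborel {t0 + pi - \<eta>..t0 + pi + \<eta>}
      + emeasure lborel {t0 - pi - \<eta>..t0 - pi + \<eta>}"
    by (rule order_trans[OF emeasure_subadditive add_right_mono[OF emeasure_subadditive]]) auto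
  also have "\<dots> = ennreal (24 * (\<delta> / norm v))"
    using \<eta> by (simp add: ennreal_plus[symmetric] \<eta>_def del: ennreal_plus)
  finally show ?thesis .
qed

lemma emeasure_angles_le_4:
  "emeasure lborel {t \<in> {0..<pi}. P t} \<le> 4"
proof -
  have "emeasure lborel {t \<in> {0..<pi}. P t} \<le> emeasure lborel {0..<pi}"
    by (rule emeasure_mono) auto
  also have "\<dots> = ennreal pi" by simp
  also have "\<dots> \<le> ennreal 4" using pi_less_4 by (intro ennreal_leI) simp
  finally show ?thesis by simp
qed

text \<open>Selects the dyadic annulus containing a point at distance D. The innermost one, l = 0,
  is a full disc without a lower bound on D.\<close>

lemma dyadic_bound:
  fixes D :: real
  assumes "0 \<le> D"
  shows "\<exists>l. l \<le> k \<and> (D \<le> 1 \<longrightarrow> D \<le> 2 ^ l / 2 ^ k \<and> (0 < l \<longrightarrow> 2 ^ l / 2 ^ k < 2 * D))"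
proof (cases "D \<le> 1")
  case True
  define l where "l = (LEAST l. D \<le> 2 ^ l / 2 ^ k)"
  have ex: "D \<le> 2 ^ k / 2 ^ k" using True by simp
  have le: "D \<le> 2 ^ l / 2 ^ k" unfolding l_def by (rule LeastI[where P = "\<lambda>l. D \<le> 2 ^ l / 2 ^ k", OF ex])
  have lk: "l \<le> k" unfolding l_def by (rule Least_le[where P = "\<lambda>l. D \<le> 2 ^ l / 2 ^ k", OF ex])
  have "2 ^ l / 2 ^ k < 2 * D" if l: "0 < l"
  proof -
    obtain m where m: "l = Suc m" using l gr0_implies_Suc by blast
    have "\<not> D \<le> 2 ^ m / 2 ^ k"
      by (rule not_less_Least[where P = "\<lambda>l. D \<le> 2 ^ l / 2 ^ k"]) (simp add: l_def[symmetric] m)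
    then show ?thesis by (simp add: m)
  qed
  then show ?thesis using le lk by blast
qed auto

text \<open>On the annulus of outer radius 2^(l-k) the angle bound is at most 48 / 2^l; for l = 0
  the total length of the angle interval suffices. Replacing annuli by balls allows integration
  against a measure with known ball masses. The first summand handles points at distance more than
  1.\<close>

lemma angle_integral_le:
  fixes x y :: "real^2"
  shows "emeasure lborel {t \<in> {0..<pi}. \<bar>cross2 (unit_vec t) (x - y)\<bar> \<le> (1/2) ^ k}
    \<le> ennreal (24 * (1/2) ^ k) + (\<Sum>l\<le>k. ennreal (48 / 2 ^ l) * indicator (cball x (2 ^ l / 2 ^ k)) y)"
    (is "?m \<le> _ + ?s")
proof -
  obtain l where l: "l \<le> k" "dist x y \<le> 1 \<Longrightarrow> dist x y \<le> 2 ^ l / 2 ^ k"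
    "dist x y \<le> 1 \<Longrightarrow> 0 < l \<Longrightarrow> 2 ^ l / 2 ^ k < 2 * dist x y"
    using dyadic_bound[of "dist x y" k] by auto
  show ?thesis
  proof (cases "dist x y \<le> 1")
    case False
    then have "x - y \<noteq> 0" and n: "1 \<le> norm (x - y)" by (auto simp: dist_norm)
    then have "?m \<le> ennreal (24 * ((1/2) ^ k / norm (x - y)))" by (intro emeasure_angles_le) auto
    also have "\<dots> \<le> ennreal (24 * (1/2) ^ k)"
      using n by (intro ennreal_leI mult_left_mono) (auto simp: divide_le_eq)
    finally show ?thesis by (rule add_increasing2[rotated]) simp
  next
    case True
    have "?m \<le> ennreal (48 / 2 ^ l)"
    proof (cases "l = 0")
      case True
      have "?m \<le> 4" by (rule emeasure_angles_le_4)
      also have "\<dots> \<le> ennreal (48 / 2 ^ l)" using True ennreal_leI[of 4 48] by simp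
      finally show ?thesis .
    next
      case False
      then have d: "2 ^ l / 2 ^ k < 2 * norm (x - y)" using l(3) True by (simp add: dist_norm)
      have "0 < 2 * norm (x - y)" by (rule le_less_trans[OF _ d]) simp
      then have n0: "0 < norm (x - y)" by simp
      then have "?m \<le> ennreal (24 * ((1/2) ^ k / norm (x - y)))" by (intro emeasure_angles_le) auto
      also have "\<dots> \<le> ennreal (48 / 2 ^ l)"
        using d n0 by (intro ennreal_leI) (simp add: field_simps power_divide)
      finally show ?thesis .
    qed
    also have "\<dots> = ennreal (48 / 2 ^ l) * indicator (cball x (2 ^ l / 2 ^ k)) y"
      using l(2) True by simp
    also have "\<dots> \<le> ?s" using l(1) by (intro member_le_sum) auto
    finally show ?thesis by (rule add_increasing[rotated]) simp
  qed
qed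

text \<open>Fubini reduces the claim to the mean over all angles. Each of the k + 1 balls
  contributes mass at most j 2^(l-k) times 48 / 2^l, that is 48 j 2^(-k). The resulting factor k + 1
  is a logarithmic loss, and the series converges for every \<open>\<rho> < 2\<close>.\<close>

lemma strip_sum_finite_AE:
  assumes M: "prob_space M" and [measurable_cong]: "sets M = sets borel"
    and x: "\<And>r. 0 < r \<Longrightarrow> measure M (cball x r) \<le> j * r" and "0 \<le> \<rho>" "\<rho> < 2"
  shows "AE t in restrict_space lborel {0..<pi}. strip_sum M \<rho> x (unit_vec t) < \<infinity>"
proof -
  interpret M: prob_space M by fact
  define R where "R = restrict_space lborel {0..<pi}"
  have spM: "space M = UNIV" using sets_eq_imp_space_eq[OF assms(2)] by simp
  interpret R: finite_measure R
    by (rule finite_measureI) (simp add: R_def emeasure_restrict_space space_restrict_space)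
  interpret pair_sigma_finite R M ..
  define f where "f c t y = (indicator {z. \<bar>cross2 (unit_vec t) z\<bar> \<le> c} (x - y) :: ennreal)" for c t y
  have mR: "(\<lambda>t. t) \<in> R \<rightarrow>\<^sub>M borel"
    unfolding R_def by (rule measurable_restrict_space1) simp
  have fm: "(\<lambda>(t, y). f c t y) \<in> borel_measurable (R \<Otimes>\<^sub>M M)" for c
  proof -
    have [measurable]: "(\<lambda>p. fst p) \<in> R \<Otimes>\<^sub>M M \<rightarrow>\<^sub>M borel"
      using measurable_compose[OF measurable_fst mR] .
    have "{p \<in> space (R \<Otimes>\<^sub>M M). \<bar>cos (fst p) * (x $ 2 - snd p $ 2) - sin (fst p) * (x $ 1 - snd p $ 1)\<bar> \<le> c}
        \<in> sets (R \<Otimes>\<^sub>M M)" by measurable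
    then have "indicator {p \<in> space (R \<Otimes>\<^sub>M M). \<bar>cos (fst p) * (x $ 2 - snd p $ 2) - sin (fst p) * (x $ 1 - snd p $ 1)\<bar> \<le> c}
        \<in> borel_measurable (R \<Otimes>\<^sub>M M)" by (rule borel_measurable_indicator)
    then show ?thesis
      by (rule measurable_cong[THEN iffD1, rotated])
        (auto simp: f_def indicator_def cross2_def unit_vec_def)
  qed
  have fM: "(\<integral>\<^sup>+y. f c t y \<partial>M) = emeasure M {y. \<bar>cross2 (unit_vec t) (x - y)\<bar> \<le> c}" for c t
  proof -
    have [measurable]: "{y. \<bar>cross2 (unit_vec t) (x - y)\<bar> \<le> c} \<in> sets borel"
      unfolding cross2_def by measurable
    have "(\<integral>\<^sup>+y. f c t y \<partial>M) = (\<integral>\<^sup>+y. indicator {y. \<bar>cross2 (unit_vec t) (x - y)\<bar> \<le> c} y \<partial>M)"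
      by (intro nn_integral_cong) (auto simp: f_def indicator_def)
    then show ?thesis by (simp add: assms(2))
  qed
  have fR: "(\<integral>\<^sup>+t. f ((1/2) ^ k) t y \<partial>R)
      \<le> ennreal (24 * (1/2) ^ k) + (\<Sum>l\<le>k. ennreal (48 / 2 ^ l) * indicator (cball x (2 ^ l / 2 ^ k)) y)" for k y
  proof -
    have ms: "{t \<in> {0..<pi}. \<bar>cross2 (unit_vec t) (x - y)\<bar> \<le> (1/2) ^ k} \<in> sets borel"
      unfolding cross2_def unit_vec_def by (simp, measurable)
    have "(\<integral>\<^sup>+t. f ((1/2) ^ k) t y \<partial>R)
        = (\<integral>\<^sup>+t. f ((1/2) ^ k) t y * indicator {0..<pi} t \<partial>lborel)"
      unfolding R_def by (subst nn_integral_restrict_space) auto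
    also have "\<dots> = (\<integral>\<^sup>+t. indicator {t \<in> {0..<pi}. \<bar>cross2 (unit_vec t) (x - y)\<bar> \<le> (1/2) ^ k} t \<partial>lborel)"
      by (intro nn_integral_cong) (auto simp: f_def indicator_def)
    also have "\<dots> = emeasure lborel {t \<in> {0..<pi}. \<bar>cross2 (unit_vec t) (x - y)\<bar> \<le> (1/2) ^ k}"
      using ms by simp
    finally show ?thesis using angle_integral_le[of x y k] by simp
  qed
  have j0: "0 \<le> j" using order_trans[OF measure_nonneg x[of 1]] by simp
  have cb: "emeasure M (cball x r) \<le> ennreal (j * r)" if "0 < r" for r
    using x[OF that] by (simp add: M.emeasure_eq_measure ennreal_leI)
  define z where "z k = 24 * (1/2) ^ k + real (Suc k) * (48 * j * (1/2) ^ k)" for k :: nat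
  have z0: "0 \<le> z k" for k using j0 by (simp add: z_def)
  have est: "(\<integral>\<^sup>+t. emeasure M {y. \<bar>cross2 (unit_vec t) (x - y)\<bar> \<le> (1/2) ^ k} \<partial>R) \<le> ennreal (z k)" for k
  proof -
    have "(\<integral>\<^sup>+t. emeasure M {y. \<bar>cross2 (unit_vec t) (x - y)\<bar> \<le> (1/2) ^ k} \<partial>R)
        = (\<integral>\<^sup>+y. (\<integral>\<^sup>+t. f ((1/2) ^ k) t y \<partial>R) \<partial>M)"
      unfolding fM[symmetric] by (rule Fubini'[OF fm, symmetric])
    also have "\<dots> \<le> (\<integral>\<^sup>+y. (ennreal (24 * (1/2) ^ k)
        + (\<Sum>l\<le>k. ennreal (48 / 2 ^ l) * indicator (cball x (2 ^ l / 2 ^ k)) y)) \<partial>M)"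
      by (intro nn_integral_mono fR)
    also have "\<dots> = ennreal (24 * (1/2) ^ k) + (\<Sum>l\<le>k. ennreal (48 / 2 ^ l) * emeasure M (cball x (2 ^ l / 2 ^ k)))"
    proof -
      have cm: "cball x r \<in> sets M" for r by (simp add: assms(2))
      have g: "(\<lambda>y. ennreal (48 / 2 ^ l) * indicator (cball x r) y) \<in> borel_measurable M" for l r
        using cm by (intro borel_measurable_times_ennreal borel_measurable_indicator) auto
      have "(\<integral>\<^sup>+y. (ennreal (24 * (1/2) ^ k)
          + (\<Sum>l\<le>k. ennreal (48 / 2 ^ l) * indicator (cball x (2 ^ l / 2 ^ k)) y)) \<partial>M)
        = (\<integral>\<^sup>+y. ennreal (24 * (1/2) ^ k) \<partial>M)
          + (\<integral>\<^sup>+y. (\<Sum>l\<le>k. ennreal (48 / 2 ^ l) * indicator (cball x (2 ^ l / 2 ^ k)) y) \<partial>M)"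
        by (rule nn_integral_add) (simp, intro borel_measurable_sum g)
      also have "(\<integral>\<^sup>+y. (\<Sum>l\<le>k. ennreal (48 / 2 ^ l) * indicator (cball x (2 ^ l / 2 ^ k)) y) \<partial>M)
          = (\<Sum>l\<le>k. \<integral>\<^sup>+y. ennreal (48 / 2 ^ l) * indicator (cball x (2 ^ l / 2 ^ k)) y \<partial>M)"
        by (rule nn_integral_sum) (rule g)
      finally show ?thesis
        by (simp only: nn_integral_cmult_indicator[OF cm] nn_integral_const M.emeasure_space_1 mult_1_right)
    qed
    also have "\<dots> \<le> ennreal (24 * (1/2) ^ k) + (\<Sum>l\<le>k. ennreal (48 / 2 ^ l) * ennreal (j * (2 ^ l / 2 ^ k)))"
      by (intro add_left_mono sum_mono mult_left_mono cb) auto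
    also have "\<dots> = ennreal (24 * (1/2) ^ k) + (\<Sum>l\<le>k. ennreal (48 * j * (1/2) ^ k))"
      using j0 by (simp add: ennreal_mult[symmetric] power_divide)
    also have "\<dots> = ennreal (24 * (1/2) ^ k) + ennreal (real (Suc k) * (48 * j * (1/2) ^ k))"
      using j0 by (subst sum_ennreal) auto
    also have "\<dots> = ennreal (z k)" using j0 by (simp add: z_def)
    finally show ?thesis .
  qed
  have em: "(\<lambda>t. emeasure M {y. \<bar>cross2 (unit_vec t) (x - y)\<bar> \<le> c}) \<in> borel_measurable R" for c
    unfolding fM[symmetric] using M.borel_measurable_nn_integral[OF fm[of c]] by simp
  have "(\<integral>\<^sup>+t. strip_sum M \<rho> x (unit_vec t) \<partial>R)
      = (\<Sum>k. \<integral>\<^sup>+t. ennreal (\<rho> ^ k) * emeasure M {y. \<bar>cross2 (unit_vec t) (x - y)\<bar> \<le> (1/2) ^ k} \<partial>R)"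
    unfolding strip_sum_def using em by (intro nn_integral_suminf) auto
  also have "\<dots> = (\<Sum>k. ennreal (\<rho> ^ k) * (\<integral>\<^sup>+t. emeasure M {y. \<bar>cross2 (unit_vec t) (x - y)\<bar> \<le> (1/2) ^ k} \<partial>R))"
    using em by (simp add: nn_integral_cmult)
  also have "\<dots> \<le> (\<Sum>k. ennreal (\<rho> ^ k) * ennreal (z k))"
    by (intro suminf_le mult_left_mono est) auto
  also have "\<dots> = (\<Sum>k. ennreal (\<rho> ^ k * z k))"
    using \<open>0 \<le> \<rho>\<close> z0 by (simp add: ennreal_mult)
  also have "\<dots> < \<infinity>"
  proof -
    have n: "norm (\<rho> / 2) < 1" using \<open>0 \<le> \<rho>\<close> \<open>\<rho> < 2\<close> by simp
    have "summable (\<lambda>k. 24 * (\<rho> / 2) ^ k + 48 * j * (of_nat (Suc k) * (\<rho> / 2) ^ k))"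
      by (intro summable_add summable_mult summable_geometric[OF n] sums_summable[OF geometric_deriv_sums[OF n]])
    moreover have "\<rho> ^ k * z k = 24 * (\<rho> / 2) ^ k + 48 * j * (of_nat (Suc k) * (\<rho> / 2) ^ k)" for k
      by (simp add: z_def power_divide algebra_simps)
    ultimately have "summable (\<lambda>k. \<rho> ^ k * z k)" by simp
    then have "(\<Sum>k. ennreal (\<rho> ^ k * z k)) = ennreal (\<Sum>k. \<rho> ^ k * z k)"
      using \<open>0 \<le> \<rho>\<close> z0 by (intro suminf_ennreal2) auto
    then show ?thesis by simp
  qed
  finally have "(\<integral>\<^sup>+t. strip_sum M \<rho> x (unit_vec t) \<partial>R) \<noteq> \<infinity>" by auto
  moreover have "(\<lambda>t. strip_sum M \<rho> x (unit_vec t)) \<in> borel_measurable R"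
  proof -
    note em[measurable]
    show ?thesis unfolding strip_sum_def by measurable
  qed
  ultimately have "AE t in R. strip_sum M \<rho> x (unit_vec t) \<noteq> \<infinity>"
    by (intro nn_integral_noteq_infinite)
  then show ?thesis unfolding R_def by eventually_elim (simp add: less_top)
qed

text \<open>Both expressions are even in the vector, so the arbitrary choice of representative does
  not matter; as the metric measures the distance to the nearer representative, they are
  Lipschitz.\<close>

lemma continuous_rep_rp1:
  "continuous_on UNIV (\<lambda>p. \<bar>rep_rp1 p $ i\<bar>)" "continuous_on UNIV (\<lambda>p. rep_rp1 p $ 1 * rep_rp1 p $ 2)"
proof -
  have c: "\<bar>rep_rp1 p $ i\<bar> \<le> 1" for p i using component_le_norm_cart[of "rep_rp1 p" i] by simp
  have sgn: "\<exists>c::real. \<bar>c\<bar> = 1 \<and> dist p q = norm (rep_rp1 p - c *\<^sub>R rep_rp1 q)" for p q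
  proof (cases "norm (rep_rp1 p - rep_rp1 q) \<le> norm (rep_rp1 p + rep_rp1 q)")
    case True then show ?thesis by (intro exI[of _ 1]) (simp add: dist_rp1_def)
  next
    case False then show ?thesis by (intro exI[of _ "-1"]) (simp add: dist_rp1_def)
  qed
  have l1: "\<bar>\<bar>rep_rp1 p $ i\<bar> - \<bar>rep_rp1 q $ i\<bar>\<bar> \<le> dist p q" for p q i
  proof -
    obtain c :: real where k: "\<bar>c\<bar> = 1" "dist p q = norm (rep_rp1 p - c *\<^sub>R rep_rp1 q)" using sgn by blast
    have "\<bar>\<bar>rep_rp1 p $ i\<bar> - \<bar>c * rep_rp1 q $ i\<bar>\<bar> \<le> \<bar>rep_rp1 p $ i - c * rep_rp1 q $ i\<bar>" by simp
    also have "\<dots> \<le> dist p q"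
      using component_le_norm_cart[of "rep_rp1 p - c *\<^sub>R rep_rp1 q" i] k(2) by simp
    finally show ?thesis using k(1) by (simp add: abs_mult)
  qed
  have l2: "\<bar>rep_rp1 p $ 1 * rep_rp1 p $ 2 - rep_rp1 q $ 1 * rep_rp1 q $ 2\<bar> \<le> 2 * dist p q" for p q
  proof -
    obtain c :: real where k: "\<bar>c\<bar> = 1" "dist p q = norm (rep_rp1 p - c *\<^sub>R rep_rp1 q)" using sgn by blast
    define u v where "u = rep_rp1 p" and "v = c *\<^sub>R rep_rp1 q"
    have cc: "c * c = 1" using k(1) by (metis abs_mult_self_eq mult_1)
    have uv: "\<bar>u $ i - v $ i\<bar> \<le> dist p q" for i
      using component_le_norm_cart[of "u - v" i] k(2) by (simp add: u_def v_def)
    have b: "\<bar>u $ i\<bar> \<le> 1" "\<bar>v $ i\<bar> \<le> 1" for i using c k(1) by (simp_all add: u_def v_def abs_mult)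
    have "rep_rp1 q $ 1 * rep_rp1 q $ 2 = v $ 1 * v $ 2"
      using cc by (simp add: v_def)
    then have "rep_rp1 p $ 1 * rep_rp1 p $ 2 - rep_rp1 q $ 1 * rep_rp1 q $ 2
        = u $ 1 * (u $ 2 - v $ 2) + (u $ 1 - v $ 1) * v $ 2"
      by (simp add: u_def algebra_simps)
    also have "\<bar>\<dots>\<bar> \<le> \<bar>u $ 1\<bar> * \<bar>u $ 2 - v $ 2\<bar> + \<bar>u $ 1 - v $ 1\<bar> * \<bar>v $ 2\<bar>"
      by (metis abs_mult abs_triangle_ineq)
    also have "\<dots> \<le> 1 * dist p q + dist p q * 1"
      using uv b by (intro add_mono mult_mono) auto
    finally show ?thesis by simp
  qed
  show "continuous_on UNIV (\<lambda>p. \<bar>rep_rp1 p $ i\<bar>)"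
    unfolding continuous_on_iff
  proof (intro ballI allI impI)
    fix p :: rp1 and e :: real assume "0 < e"
    then show "\<exists>d>0. \<forall>q\<in>UNIV. dist q p < d \<longrightarrow> dist \<bar>rep_rp1 q $ i\<bar> \<bar>rep_rp1 p $ i\<bar> < e"
      using l1 by (intro exI[of _ e]) (auto simp: dist_real_def intro: le_less_trans)
  qed
  show "continuous_on UNIV (\<lambda>p. rep_rp1 p $ 1 * rep_rp1 p $ 2)"
    unfolding continuous_on_iff
  proof (intro ballI allI impI)
    fix p :: rp1 and e :: real assume e: "0 < e"
    have "dist (rep_rp1 q $ 1 * rep_rp1 q $ 2) (rep_rp1 p $ 1 * rep_rp1 p $ 2) < e" if "dist q p < e / 2" for q
      using l2[of q p] that by (simp add: dist_real_def)
    then show "\<exists>d>0. \<forall>q\<in>UNIV. dist q p < d \<longrightarrow>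
        dist (rep_rp1 q $ 1 * rep_rp1 q $ 2) (rep_rp1 p $ 1 * rep_rp1 p $ 2) < e"
      using e by (intro exI[of _ "e / 2"]) auto
  qed
qed

text \<open>The representative \<^const>\<open>rep_rp1\<close> is arbitrary; this choice of sign is Borel.\<close>

definition section_rp1 :: "rp1 \<Rightarrow> real^2" where
  "section_rp1 p = vector [\<bar>rep_rp1 p $ 1\<bar>,
     (if 0 \<le> rep_rp1 p $ 1 * rep_rp1 p $ 2 then 1 else -1) * \<bar>rep_rp1 p $ 2\<bar>]"

lemma section_rp1_cases: "section_rp1 p = rep_rp1 p \<or> section_rp1 p = - rep_rp1 p"
  unfolding section_rp1_def by (auto simp: vec2_eq_iff abs_if zero_le_mult_iff)

lemma section_direction:
  assumes "norm v = 1"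
  shows "section_rp1 (direction v) = v \<or> section_rp1 (direction v) = - v"
  using section_rp1_cases[of "direction v"] rep_direction[OF assms] by auto

lemma measurable_section_rp1: "section_rp1 \<in> borel \<rightarrow>\<^sub>M borel"
proof -
  have [measurable]: "(\<lambda>p. \<bar>rep_rp1 p $ i\<bar>) \<in> borel_measurable borel"
    "(\<lambda>p. rep_rp1 p $ 1 * rep_rp1 p $ 2) \<in> borel_measurable borel" for i
    by (intro borel_measurable_continuous_onI continuous_rep_rp1)+
  have "section_rp1 = (\<lambda>p. \<bar>rep_rp1 p $ 1\<bar> *\<^sub>R axis 1 1
     + ((if 0 \<le> rep_rp1 p $ 1 * rep_rp1 p $ 2 then 1 else -1) * \<bar>rep_rp1 p $ 2\<bar>) *\<^sub>R axis 2 1)"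
    by (rule ext) (simp add: section_rp1_def vec2_eq_iff axis_def)
  also have "\<dots> \<in> borel \<rightarrow>\<^sub>M borel" by measurable
  finally show ?thesis .
qed

lemma measurable_direction_unit_vec: "(\<lambda>t. direction (unit_vec t)) \<in> borel \<rightarrow>\<^sub>M borel"
proof (intro borel_measurable_continuous_onI)
  have "((\<lambda>t. direction (unit_vec t)) \<longlongrightarrow> direction (unit_vec t0)) (at t0)" for t0
  proof (rule tendstoI)
    fix e :: real assume "0 < e"
    have "((\<lambda>t. norm (unit_vec t - unit_vec t0)) \<longlongrightarrow> norm (unit_vec t0 - unit_vec t0)) (at t0)"
    proof (intro tendsto_norm tendsto_diff tendsto_const)
      have u: "unit_vec = (\<lambda>t. cos t *\<^sub>R axis 1 1 + sin t *\<^sub>R axis 2 1)"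
        by (rule ext) (simp add: unit_vec_def vec2_eq_iff axis_def)
      show "(unit_vec \<longlongrightarrow> unit_vec t0) (at t0)"
        unfolding u by (intro tendsto_intros)
    qed
    then have "\<forall>\<^sub>F t in at t0. norm (unit_vec t - unit_vec t0) < e"
      using \<open>0 < e\<close> by (intro order_tendstoD) auto
    then show "\<forall>\<^sub>F t in at t0. dist (direction (unit_vec t)) (direction (unit_vec t0)) < e"
      by eventually_elim (meson dist_direction_le le_less_trans norm_unit_vec)
  qed
  then show "continuous_on UNIV (\<lambda>t. direction (unit_vec t))"
    by (simp add: continuous_on_def)
qed

lemma rp1_lebesgue_null_strip_sum:
  assumes M: "prob_space M" and sM: "sets M = sets borel"
    and x: "\<And>r. 0 < r \<Longrightarrow> measure M (cball x r) \<le> j * r" and \<rho>: "0 \<le> \<rho>" "\<rho> < 2"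
  shows "{p. strip_sum M \<rho> x (section_rp1 p) = \<infinity>} \<in> null_sets rp1_lebesgue"
proof -
  interpret M: prob_space M by fact
  have "(\<lambda>e. strip_sum M \<rho> x e) \<in> borel_measurable borel"
    using measurable_compose[OF measurable_Pair1'[of x borel borel] measurable_strip_sum[OF M.sigma_finite_measure_axioms sM, of \<rho>]]
    by simp
  then have "(\<lambda>p. strip_sum M \<rho> x (section_rp1 p)) \<in> borel_measurable borel"
    by (rule measurable_compose[OF measurable_section_rp1])
  from measurable_sets[OF this, of "{\<infinity>}"]
  have ms: "{p. strip_sum M \<rho> x (section_rp1 p) = \<infinity>} \<in> sets borel" by (simp add: vimage_def)
  have ms': "{p. strip_sum M \<rho> x (section_rp1 p) \<noteq> \<infinity>} \<in> sets borel"
    using borel_comp[OF ms] by (simp add: Collect_neg_eq)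
  have md: "(\<lambda>t. direction (vector [cos t, sin t])) \<in> restrict_space lborel {0..<pi} \<rightarrow>\<^sub>M borel"
    using measurable_direction_unit_vec unfolding unit_vec_def
    by (intro measurable_restrict_space1) simp
  have eq: "strip_sum M \<rho> x (section_rp1 (direction (unit_vec t))) = strip_sum M \<rho> x (unit_vec t)" for t
    using section_direction[OF norm_unit_vec, of t] by (auto simp: strip_sum_minus)
  have "AE t in restrict_space lborel {0..<pi}. strip_sum M \<rho> x (unit_vec t) < \<infinity>"
    by (rule strip_sum_finite_AE[OF M sM x \<rho>])
  then have "AE t in restrict_space lborel {0..<pi}.
      direction (vector [cos t, sin t]) \<notin> {p. strip_sum M \<rho> x (section_rp1 p) = \<infinity>}"
    by eventually_elim (auto simp: eq[unfolded unit_vec_def] unit_vec_def less_top[symmetric])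
  then have "AE p in rp1_lebesgue. p \<notin> {p. strip_sum M \<rho> x (section_rp1 p) = \<infinity>}"
    unfolding rp1_lebesgue_def using ms' by (subst AE_distr_iff[OF md]) auto
  then show ?thesis using ms
    by (subst AE_iff_null_sets) (simp_all add: rp1_lebesgue_def)
qed

section \<open>From good times to all radii\<close>

text \<open>Given r, take the last good time n with \<open>r \<le> c * b n\<close>. The next good
  time n + k satisfies \<open>c * b (n + k) < r\<close> and k <= n div q. By the choice of q,
  \<open>\<beta> ^ k\<close> is at least \<open>(b n / 4) powr \<eta>\<close>, hence
  \<open>b n powr (1 + \<eta>) \<le> K * r\<close>, and the estimate at radius
  \<open>c * b n\<close> is also good enough at r.\<close>

lemma radial_bound:
  fixes b :: "nat \<Rightarrow> real" and m :: "real \<Rightarrow> real"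
  assumes b: "\<And>n. 0 < b n" "\<And>n k. b n * \<beta> ^ k \<le> b (n + k)" "\<And>n. b n \<le> 4 * \<theta> ^ n"
    and \<beta>: "0 < \<beta>" "\<beta> < 1" and \<theta>: "0 < \<theta>" "\<theta> < 1"
    and q: "0 < q" "(\<theta> powr \<eta>) ^ q \<le> \<beta>" and \<eta>: "0 < \<eta>"
    and m: "\<And>r r'. r \<le> r' \<Longrightarrow> m r \<le> m r'" "\<And>r. m r \<le> 1"
    and inf: "\<And>N. \<exists>n\<ge>N. n \<in> I"
    and gap: "\<And>n. n0 \<le> n \<Longrightarrow> n \<in> I \<Longrightarrow> \<exists>k\<in>{1..n div q}. n + k \<in> I"
    and good: "\<And>n. n \<in> I \<Longrightarrow> m (c * b n) \<le> C * b n powr u"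
    and c: "0 < c" and C: "0 < C" and t: "0 < t" "t * (1 + \<eta>) \<le> u"
  shows "\<exists>j::nat. \<forall>r>0. m r \<le> real j * r powr t"
proof -
  obtain n1 where n1: "n0 \<le> n1" "n1 \<in> I" using inf by blast
  define r0 where "r0 = c * b n1"
  define K where "K = 4 powr \<eta> / c"
  define u' where "u' = u / (1 + \<eta>)"
  have r0: "0 < r0" using c b(1) by (simp add: r0_def)
  have K: "0 < K" using c by (simp add: K_def)
  have u': "t \<le> u'" using t \<eta> by (simp add: u'_def field_simps)
  have lim: "(\<lambda>n. c * (4 * \<theta> ^ n)) \<longlonglongrightarrow> 0"
    using LIMSEQ_power_zero[of \<theta>] \<theta> by (intro tendsto_mult_right_zero) auto
  have small: "m r \<le> (C * K powr u') * r powr t" if r: "0 < r" "r < r0" "r \<le> 1" for r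
  proof -
    define F where "F = {n \<in> I. n1 \<le> n \<and> r \<le> c * b n}"
    obtain N where N: "\<And>n. n \<ge> N \<Longrightarrow> c * (4 * \<theta> ^ n) < r"
      using order_tendstoD(2)[OF lim r(1)] by (auto simp: eventually_sequentially)
    have "F \<subseteq> {..<N}"
    proof
      fix n assume "n \<in> F"
      then have "r \<le> c * b n" by (simp add: F_def)
      also have "\<dots> \<le> c * (4 * \<theta> ^ n)" using b(3) c by (intro mult_left_mono) auto
      finally show "n \<in> {..<N}" using N[of n] by (meson lessThan_iff not_less)
    qed
    then have fin: "finite F" using finite_subset by blast
    have ne: "n1 \<in> F" using n1 r by (simp add: F_def r0_def)
    define n where "n = Max F"
    have nF: "n \<in> F" unfolding n_def using fin ne by (intro Max_in) auto
    then have n: "n \<in> I" "n1 \<le> n" "r \<le> c * b n" by (auto simp: F_def)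
    obtain k where k: "1 \<le> k" "k \<le> n div q" "n + k \<in> I"
      using gap[of n] n n1 by auto
    have "n + k \<notin> F" using Max_ge[OF fin, of "n + k"] k(1) by (auto simp: n_def[symmetric])
    then have "c * b (n + k) < r" using k n by (simp add: F_def)
    have "(b n / 4) powr \<eta> \<le> (\<theta> ^ n) powr \<eta>"
      using b(1)[of n] b(3)[of n] \<eta> by (intro powr_mono2) auto
    also have "\<dots> = (\<theta> powr \<eta>) ^ n" using \<theta> by (simp add: powr_power powr_realpow[symmetric] powr_powr mult.commute)
    also have "\<dots> \<le> (\<theta> powr \<eta>) ^ (q * (n div q))"
      using \<theta> \<eta> by (intro power_decreasing) (auto simp: powr_le1)
    also have "\<dots> = ((\<theta> powr \<eta>) ^ q) ^ (n div q)" by (rule power_mult)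
    also have "\<dots> \<le> \<beta> ^ (n div q)" using q(2) by (intro power_mono) auto
    also have "\<dots> \<le> \<beta> ^ k" using k(2) \<beta> by (intro power_decreasing) auto
    finally have "b n * (b n / 4) powr \<eta> \<le> b n * \<beta> ^ k" using b(1)[of n] by (intro mult_left_mono) auto
    also have "\<dots> \<le> b (n + k)" by (rule b(2))
    also have "\<dots> \<le> r / c" using \<open>c * b (n + k) < r\<close> c by (simp add: field_simps)
    finally have "b n * (b n / 4) powr \<eta> \<le> r / c" .
    then have "b n * b n powr \<eta> \<le> K * r"
      using b(1)[of n] c by (simp add: powr_divide K_def field_simps)
    moreover have "b n * b n powr \<eta> = b n powr (1 + \<eta>)" using b(1)[of n] by (simp add: powr_add)
    ultimately have bK: "b n powr (1 + \<eta>) \<le> K * r" by simp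
    have "0 \<le> u'" using u' t by simp
    have "b n powr u = (b n powr (1 + \<eta>)) powr u'" using \<eta> by (simp add: powr_powr u'_def)
    also have "\<dots> \<le> (K * r) powr u'" using bK \<open>0 \<le> u'\<close> by (intro powr_mono2) auto
    also have "\<dots> = K powr u' * r powr u'" using K r by (simp add: powr_mult)
    also have "\<dots> \<le> K powr u' * r powr t" using r u' by (intro mult_left_mono powr_mono') auto
    finally have "C * b n powr u \<le> C * (K powr u' * r powr t)" using C by (intro mult_left_mono) auto
    moreover have "m r \<le> C * b n powr u" using m(1)[OF n(3)] good[OF n(1)] by linarith
    ultimately show ?thesis by (simp add: mult.assoc)
  qed
  \<comment> \<open>Radii above 1 or at least \<open>r0\<close> are covered by
    \<open>m r \<le> 1\<close> alone.\<close>
  define J where "J = max (C * K powr u') (max 1 (r0 powr (- t)))"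
  have "m r \<le> J * r powr t" if r: "0 < r" for r
  proof -
    consider "r < r0" "r \<le> 1" | "r0 \<le> r" | "1 < r" by linarith
    then show ?thesis
    proof cases
      case 1
      have "m r \<le> (C * K powr u') * r powr t" using small r 1 by simp
      also have "\<dots> \<le> J * r powr t" by (intro mult_right_mono) (auto simp: J_def)
      finally show ?thesis .
    next
      case 2
      have "r0 powr t \<le> r powr t" using 2 r0 t by (intro powr_mono2) auto
      then have "1 \<le> r0 powr (- t) * r powr t" using r0 by (simp add: powr_minus field_simps)
      also have "\<dots> \<le> J * r powr t" by (intro mult_right_mono) (auto simp: J_def)
      finally show ?thesis using m(2)[of r] by linarith
    next
      case 3
      have "1 \<le> r powr t" using 3 t by (simp add: ge_one_powr_ge_zero)
      then have "1 \<le> 1 * r powr t" by simp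
      also have "\<dots> \<le> J * r powr t" by (intro mult_right_mono) (auto simp: J_def)
      finally show ?thesis using m(2)[of r] by linarith
    qed
  qed
  moreover have "J * r powr t \<le> real (nat \<lceil>J\<rceil>) * r powr t" for r
    by (intro mult_right_mono real_nat_ceiling_ge) auto
  ultimately show ?thesis by (meson order_trans)
qed

section \<open>Return times\<close>

definition shift_by :: "nat \<Rightarrow> (int \<Rightarrow> 'm) \<Rightarrow> int \<Rightarrow> 'm" where
  "shift_by n a = (\<lambda>k. a (k + int n))"

lemma shift_by_add: "shift_by n (shift_by k a) = shift_by (n + k) a"
  by (simp add: shift_by_def fun_eq_iff add_ac)

lemma shift_by_in_sets:
  "X \<in> sets seq_algebra \<Longrightarrow> {a. shift_by n a \<in> X} \<in> sets seq_algebra"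
  using measurable_sets[OF measurable_reindex, of X "\<lambda>k. k + int n"]
  by (simp add: vimage_def shift_by_def)

lemma measure_shift_by:
  assumes "shift_invariant_prob N" "X \<in> sets seq_algebra"
  shows "measure N {a. shift_by n a \<in> X} = measure N X"
  using shift_invariant_iterate[OF assms, of n] by (simp add: shift_by_def)

text \<open>
  Splitting according to the last visit to \<open>G\<close> before time \<open>k\<close> shows that the probabilities of
  not returning within \<open>i\<close> steps have bounded sum.
\<close>

lemma no_return_sum_le:
  fixes N :: "(int \<Rightarrow> 'm) measure"
  assumes N: "shift_invariant_prob N" and G: "G \<in> sets seq_algebra"
  defines "R \<equiv> \<lambda>k. {a \<in> G. \<forall>i\<in>{1..k}. shift_by i a \<notin> G}"
  shows "R k \<in> sets seq_algebra" "(\<Sum>i<k. measure N (R i)) \<le> 1"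
proof -
  interpret prob_space N by (rule shift_invariant_probD(1)[OF N])
  have sN: "sets N = sets seq_algebra" by (rule shift_invariant_probD(2)[OF N])
  have Rs: "R k \<in> sets seq_algebra" for k
  proof -
    have "R k = G - (\<Union>i\<in>{1..k}. {a. shift_by i a \<in> G})" by (auto simp: R_def)
    then show ?thesis using G shift_by_in_sets[OF G] by auto
  qed
  then show "R k \<in> sets seq_algebra" .
  \<comment> \<open>The event that the last visit before time k happens at time j.\<close>
  define V where "V j = {a. shift_by j a \<in> R (k - 1 - j)}" for j
  have Vs: "V j \<in> sets seq_algebra" for j unfolding V_def by (rule shift_by_in_sets[OF Rs])
  have disj: "disjoint_family_on V {..<k}"
    unfolding disjoint_family_on_def
  proof (intro ballI impI)
    have *: "V i \<inter> V j = {}" if ij: "i < j" "j < k" for i j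
    proof -
      have "a \<notin> V j" if "a \<in> V i" for a
      proof
        assume "a \<in> V j"
        then have "shift_by (j - i) (shift_by i a) \<in> G"
          using ij by (simp add: V_def R_def shift_by_add)
        moreover have "j - i \<in> {1..k - 1 - i}" using ij by auto
        ultimately show False using that by (auto simp: V_def R_def)
      qed
      then show ?thesis by blast
    qed
    fix i j assume "i \<in> {..<k}" "j \<in> {..<k}" "i \<noteq> j"
    then show "V i \<inter> V j = {}" using *[of i j] *[of j i] by (cases "i < j") auto
  qed
  have "(\<Sum>i<k. measure N (R i)) = (\<Sum>j<k. measure N (R (k - 1 - j)))"
    using sum.nat_diff_reindex[of "\<lambda>i. measure N (R i)" k] by simp
  also have "\<dots> = (\<Sum>j<k. measure N (V j))"
    unfolding V_def by (simp only: measure_shift_by[OF N Rs])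
  also have "\<dots> = measure N (\<Union>j\<in>{..<k}. V j)"
    using Vs disj by (intro finite_measure_finite_Union[symmetric]) (auto simp: sN)
  also have "\<dots> \<le> 1" by (rule prob_le_1)
  finally show "(\<Sum>i<k. measure N (R i)) \<le> 1" .
qed

text \<open>The event that a visit at time n is followed by too long a gap is a shift of
  \<open>R (n div q)\<close>. Each value of n div q is taken q times, so these probabilities sum to
  at most q, and Borel-Cantelli applies.\<close>

lemma AE_return_gap:
  fixes N :: "(int \<Rightarrow> 'm) measure"
  assumes N: "shift_invariant_prob N" and G: "G \<in> sets seq_algebra" and q: "0 < q"
  shows "AE a in N. \<exists>n0. \<forall>n\<ge>n0. shift_by n a \<in> G \<longrightarrow> (\<exists>k\<in>{1..n div q}. shift_by (n + k) a \<in> G)"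
proof -
  interpret prob_space N by (rule shift_invariant_probD(1)[OF N])
  have sN: "sets N = sets seq_algebra" by (rule shift_invariant_probD(2)[OF N])
  define R where "R k = {a \<in> G. \<forall>i\<in>{1..k}. shift_by i a \<notin> G}" for k
  have Rs: "R k \<in> sets seq_algebra" and sum1: "(\<Sum>i<k. measure N (R i)) \<le> 1" for k
    using no_return_sum_le[OF N G, of k] by (simp_all add: R_def)
  define V where "V n = {a. shift_by n a \<in> R (n div q)}" for n
  have Vs: "V n \<in> sets N" for n unfolding V_def sN by (rule shift_by_in_sets[OF Rs])
  have Vm: "measure N (V n) = measure N (R (n div q))" for n
    unfolding V_def by (rule measure_shift_by[OF N Rs])
  have "summable (\<lambda>n. measure N (V n))"
  proof (rule summableI_nonneg_bounded)
    fix n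
    have "(\<Sum>i<n. measure N (V i)) \<le> (\<Sum>i<n * q. measure N (V i))"
      using q by (intro sum_mono2) auto
    also have "\<dots> = (\<Sum>m<n. \<Sum>i\<in>{m * q..<m * q + q}. measure N (R (i div q)))"
      unfolding Vm by (rule sum.nat_group[symmetric])
    also have "\<dots> = (\<Sum>m<n. \<Sum>i\<in>{m * q..<m * q + q}. measure N (R m))"
    proof (intro sum.cong refl)
      fix m i assume "i \<in> {m * q..<m * q + q}"
      then have "i div q = m" by (intro div_nat_eqI) (auto simp: mult.commute)
      then show "measure N (R (i div q)) = measure N (R m)" by simp
    qed
    also have "\<dots> = q * (\<Sum>m<n. measure N (R m))" by (simp add: sum_distrib_left)
    also have "\<dots> \<le> real q * 1" using sum1 by (intro mult_left_mono) auto
    finally show "(\<Sum>i<n. measure N (V i)) \<le> real q" by simp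
  qed simp
  then have "AE a in N. eventually (\<lambda>n. a \<in> space N - V n) sequentially"
    using Vs by (intro borel_cantelli_AE1) (auto simp: emeasure_eq_measure)
  then show ?thesis
  proof eventually_elim
    case (elim a)
    then obtain n0 where n0: "\<And>n. n \<ge> n0 \<Longrightarrow> a \<notin> V n" by (auto simp: eventually_sequentially)
    have "\<exists>k\<in>{1..n div q}. shift_by (n + k) a \<in> G" if "n \<ge> n0" "shift_by n a \<in> G" for n
      using n0[OF that(1)] that(2) by (auto simp: V_def R_def shift_by_add add.commute)
    then show ?case by blast
  qed
qed

text \<open>The limit superior of events of equal measure has at least that measure. The negated
  form is what contradicts an almost sure absence of infinitely many returns.\<close>

lemma infinitely_often_positive:
  fixes N :: "(int \<Rightarrow> 'm) measure"
  assumes N: "shift_invariant_prob N" and G: "G \<in> sets seq_algebra" and pos: "0 < measure N G"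
  shows "\<not> (AE a in N. \<not> (\<forall>n0. \<exists>n\<ge>n0. shift_by n a \<in> G))"
proof
  assume ae: "AE a in N. \<not> (\<forall>n0. \<exists>n\<ge>n0. shift_by n a \<in> G)"
  interpret prob_space N by (rule shift_invariant_probD(1)[OF N])
  have sN: "sets N = sets seq_algebra" by (rule shift_invariant_probD(2)[OF N])
  have spN: "space N = UNIV" by (rule shift_invariant_probD(3)[OF N])
  define U where "U n0 = (\<Union>n\<in>{n0..}. {a. shift_by n a \<in> G})" for n0
  have Us: "U n \<in> sets N" for n unfolding U_def sN using shift_by_in_sets[OF G] by auto
  have "decseq U" unfolding decseq_def U_def by (intro allI impI UN_mono) auto
  then have lim: "(\<lambda>n. measure N (U n)) \<longlonglongrightarrow> measure N (\<Inter>n. U n)"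
    using Us by (intro finite_Lim_measure_decseq) auto
  have "measure N G \<le> measure N (U n)" for n
  proof -
    have "measure N G = measure N {a. shift_by n a \<in> G}" by (rule measure_shift_by[OF N G, symmetric])
    also have "\<dots> \<le> measure N (U n)" using Us by (intro finite_measure_mono) (auto simp: U_def)
    finally show ?thesis .
  qed
  then have "measure N G \<le> measure N (\<Inter>n. U n)" by (intro LIMSEQ_le_const[OF lim]) auto
  moreover have "measure N (\<Inter>n. U n) = 0"
  proof -
    have Is: "(\<Inter>n. U n) \<in> sets N" using Us by auto
    have "AE a in N. a \<notin> (\<Inter>n. U n)" using ae by eventually_elim (auto simp: U_def)
    then have "(\<Inter>n. U n) \<in> null_sets N" using Is by (simp add: AE_iff_null_sets)
    then show ?thesis by (simp add: measure_def null_setsD1)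
  qed
  ultimately show False using pos by simp
qed

section \<open>The two-sided extension\<close>

definition future :: "(int \<Rightarrow> 'm) \<Rightarrow> nat \<Rightarrow> 'm" where
  "future a = (\<lambda>k. a (int k + 1))"

text \<open>Read backwards from coordinate 0, in the order in which \<open>furstenberg_map\<close>
  composes the maps.\<close>

definition past :: "(int \<Rightarrow> 'm) \<Rightarrow> nat \<Rightarrow> 'm" where
  "past a = (\<lambda>k. a (- int k))"

lemma measurable_future: "future \<in> seq_algebra \<rightarrow>\<^sub>M seq_algebra"
  unfolding future_def by (rule measurable_reindex)

lemma measurable_past: "past \<in> seq_algebra \<rightarrow>\<^sub>M seq_algebra"
  unfolding past_def by (rule measurable_reindex)

lemma future_shift_by: "future (shift_by n a) = (\<lambda>k. future a (n + k))"
  by (simp add: future_def shift_by_def fun_eq_iff add_ac)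

locale two_sided = kaenmaki A d E \<mu> for A :: "'m::finite \<Rightarrow> real^2^2" and d E \<mu> +
  fixes \<nu> :: "(int \<Rightarrow> 'm) measure"
  assumes extension: "is_two_sided_extension \<mu> \<nu>"
begin

lemma nu_shift_invariant: "shift_invariant_prob \<nu>"
  using extension by (simp add: is_two_sided_extension_def)

lemmas sets_nu = shift_invariant_probD(2)[OF nu_shift_invariant]
lemmas space_nu = shift_invariant_probD(3)[OF nu_shift_invariant]

sublocale nu: prob_space \<nu>
  by (rule shift_invariant_probD(1)[OF nu_shift_invariant])

lemma future_in_sets: "X \<in> sets seq_algebra \<Longrightarrow> {a. future a \<in> X} \<in> sets seq_algebra"
  using measurable_sets[OF measurable_future] by (simp add: vimage_def)

text \<open>Shifting by the length of v moves both conditions onto the coordinates 1, 2, ..., where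
  the backward word v appears reversed and in front of u.\<close>

lemma measure_nu_cylinders:
  "measure \<nu> {a. future a \<in> cylinder u \<and> past a \<in> cylinder v} = measure \<mu> (cylinder (rev v @ u))"
proof -
  define p where "p = length v"
  define Y where "Y = {a :: int \<Rightarrow> 'm. future a \<in> cylinder u \<and> past a \<in> cylinder v}"
  have "Y = {a. future a \<in> cylinder u} \<inter> {a. past a \<in> cylinder v}" by (auto simp: Y_def)
  moreover have "{a :: int \<Rightarrow> 'm. past a \<in> cylinder v} \<in> sets seq_algebra"
    using measurable_sets[OF measurable_past cylinder_in_sets[of v]] by (simp add: vimage_def)
  ultimately have Y: "Y \<in> sets seq_algebra"
    using future_in_sets[OF cylinder_in_sets[of u]] by (metis sets.Int)
  have eq: "{a. shift_by p a \<in> Y} = {a. future a \<in> cylinder (rev v @ u)}"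
  proof (intro set_eqI)
    fix a :: "int \<Rightarrow> 'm"
    have "shift_by p a \<in> Y \<longleftrightarrow> (\<forall>k<length u. a (int k + 1 + int p) = u ! k) \<and> (\<forall>k<p. a (int p - int k) = v ! k)"
      by (simp add: Y_def cylinder_def shift_by_def future_def past_def p_def add_ac)
    also have "(\<forall>k<p. a (int p - int k) = v ! k) \<longleftrightarrow> (\<forall>k<p. a (int k + 1) = rev v ! k)"
    proof (intro iffI allI impI)
      fix k assume h: "\<forall>k<p. a (int p - int k) = v ! k" and k: "k < p"
      have "a (int p - int (p - 1 - k)) = v ! (p - 1 - k)"
        by (rule h[rule_format]) (use k in simp)
      moreover have "int p - int (p - 1 - k) = int k + 1" using k by simp
      ultimately have "a (int k + 1) = v ! (p - 1 - k)" by (simp only:)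
      then show "a (int k + 1) = rev v ! k" using k by (simp add: rev_nth p_def)
    next
      fix k assume h: "\<forall>k<p. a (int k + 1) = rev v ! k" and k: "k < p"
      have "a (int (p - 1 - k) + 1) = rev v ! (p - 1 - k)"
        by (rule h[rule_format]) (use k in simp)
      moreover have "int (p - 1 - k) + 1 = int p - int k" using k by simp
      ultimately have "a (int p - int k) = rev v ! (p - 1 - k)" by (simp only:)
      then show "a (int p - int k) = v ! k" using k by (simp add: rev_nth p_def)
    qed
    also have "(\<forall>k<length u. a (int k + 1 + int p) = u ! k) \<and> (\<forall>k<p. a (int k + 1) = rev v ! k)
        \<longleftrightarrow> (\<forall>k<p + length u. a (int k + 1) = (rev v @ u) ! k)"
    proof (intro iffI conjI allI impI)
      fix k assume h: "(\<forall>k<length u. a (int k + 1 + int p) = u ! k) \<and> (\<forall>k<p. a (int k + 1) = rev v ! k)"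
        and k: "k < p + length u"
      show "a (int k + 1) = (rev v @ u) ! k"
      proof (cases "k < p")
        case True then show ?thesis using h by (simp add: nth_append p_def)
      next
        case False
        then have "k - p < length u" using k by simp
        then have "a (int (k - p) + 1 + int p) = u ! (k - p)" using h by blast
        moreover have "int (k - p) + 1 + int p = int k + 1" using False by simp
        ultimately have "a (int k + 1) = u ! (k - p)" by (simp only:)
        then show ?thesis using False by (simp add: nth_append p_def)
      qed
    next
      fix k assume h: "\<forall>k<p + length u. a (int k + 1) = (rev v @ u) ! k" and k: "k < length u"
      have "a (int (p + k) + 1) = (rev v @ u) ! (p + k)"
        by (rule h[rule_format]) (use k in simp)
      then show "a (int k + 1 + int p) = u ! k" by (simp add: nth_append p_def add_ac)
    next
      fix k assume h: "\<forall>k<p + length u. a (int k + 1) = (rev v @ u) ! k" and k: "k < p"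
      then show "a (int k + 1) = rev v ! k" using h[rule_format, of k] by (simp add: nth_append p_def)
    qed
    finally show "a \<in> {a. shift_by p a \<in> Y} \<longleftrightarrow> a \<in> {a. future a \<in> cylinder (rev v @ u)}"
      by (simp add: cylinder_def future_def p_def)
  qed
  have "measure \<nu> Y = measure \<nu> {a. shift_by p a \<in> Y}"
    by (rule measure_shift_by[OF nu_shift_invariant Y, symmetric])
  also have "\<dots> = measure \<nu> {a. future a \<in> cylinder (rev v @ u)}" by (simp only: eq)
  also have "\<dots> = measure \<mu> (cylinder (rev v @ u))"
    using extension by (simp add: is_two_sided_extension_def future_def)
  finally show ?thesis by (simp add: Y_def)
qed

lemma measure_future:
  assumes X: "X \<in> sets seq_algebra"
  shows "measure \<nu> {a. future a \<in> X} = measure \<mu> X"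
proof -
  define N where "N = distr \<nu> seq_algebra future"
  have mf: "future \<in> \<nu> \<rightarrow>\<^sub>M seq_algebra"
    using measurable_future measurable_cong_sets[OF sets_nu refl] by blast
  have N: "measure N X = measure \<nu> {a. future a \<in> X}" if "X \<in> sets seq_algebra" for X
    using measure_distr[OF mf that] by (simp add: N_def space_nu vimage_def)
  interpret N: prob_space N unfolding N_def by (rule nu.prob_space_distr[OF mf])
  have sN: "sets N = sets seq_algebra" by (simp add: N_def)
  have c: "measure N (cylinder w) = measure \<mu> (cylinder w)" for w
    using extension by (simp add: N[OF cylinder_in_sets] is_two_sided_extension_def future_def)
  have "measure N X \<le> 1 * measure \<mu> X"
    by (rule cylinder_domination[OF mu.finite_measure_axioms sets_mu N.finite_measure_axioms sN _ _ X])
      (simp_all add: c)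
  moreover have "measure \<mu> X \<le> 1 * measure N X"
    by (rule cylinder_domination[OF N.finite_measure_axioms sN mu.finite_measure_axioms sets_mu _ _ X])
      (simp_all add: c)
  ultimately show ?thesis using N[OF X] by simp
qed

text \<open>Zipping past and future into one sequence of pairs reduces the domination of their joint law
  by the product law to cylinders.\<close>

lemma future_past_null:
  assumes s: "1 < s" and X: "X \<in> sets (seq_algebra \<Otimes>\<^sub>M seq_algebra)"
    and null: "emeasure (\<mu> \<Otimes>\<^sub>M distr \<nu> seq_algebra past) X = 0"
  shows "measure \<nu> {a. (future a, past a) \<in> X} = 0"
proof -
  obtain C where C: "0 < C"
    "\<And>u v. measure \<mu> (cylinder (u @ v)) \<le> C * measure \<mu> (cylinder u) * measure \<mu> (cylinder v)"
    by (rule measure_cylinder_append_le[OF s]) blast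
  define P where "P = distr \<nu> seq_algebra past"
  have mp: "past \<in> \<nu> \<rightarrow>\<^sub>M seq_algebra"
    using measurable_past measurable_cong_sets[OF sets_nu refl] by blast
  have mf: "future \<in> \<nu> \<rightarrow>\<^sub>M seq_algebra"
    using measurable_future measurable_cong_sets[OF sets_nu refl] by blast
  interpret P: prob_space P unfolding P_def by (rule nu.prob_space_distr[OF mp])
  interpret muP: pair_prob_space \<mu> P ..
  have sP: "sets P = sets seq_algebra" by (simp add: P_def)
  have smuP: "sets (\<mu> \<Otimes>\<^sub>M P) = sets (seq_algebra \<Otimes>\<^sub>M seq_algebra)"
    by (intro sets_pair_measure_cong sets_mu sP)
  have cyl_P: "measure P (cylinder v) = measure \<mu> (cylinder (rev v))" for v
  proof -
    have "measure P (cylinder v) = measure \<nu> {a. past a \<in> cylinder v}"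
      unfolding P_def using measure_distr[OF mp cylinder_in_sets[of v]] by (simp add: space_nu vimage_def)
    also have "\<dots> = measure \<mu> (cylinder (rev v))"
      using measure_nu_cylinders[of "[]" v] by (simp add: cylinder_def)
    finally show ?thesis .
  qed
  define z :: "(nat \<Rightarrow> 'm) \<times> (nat \<Rightarrow> 'm) \<Rightarrow> nat \<Rightarrow> 'm \<times> 'm" where "z p k = (fst p k, snd p k)" for p k
  have coord: "(\<lambda>p. (fst p k, snd p k)) \<in> seq_algebra \<Otimes>\<^sub>M seq_algebra \<rightarrow>\<^sub>M count_space (UNIV :: ('m \<times> 'm) set)" for k
  proof -
    have "(\<lambda>p. (fst p k, snd p k)) \<in> seq_algebra \<Otimes>\<^sub>M seq_algebra \<rightarrow>\<^sub>M
        count_space (UNIV :: 'm set) \<Otimes>\<^sub>M count_space (UNIV :: 'm set)"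
      by (intro measurable_Pair measurable_compose[OF measurable_fst measurable_seq_coord]
          measurable_compose[OF measurable_snd measurable_seq_coord])
    then show ?thesis by (simp add: pair_measure_countable)
  qed
  have mz: "z \<in> seq_algebra \<Otimes>\<^sub>M seq_algebra \<rightarrow>\<^sub>M seq_algebra"
    by (rule measurable_into_seq_algebra) (simp add: z_def coord)
  have mz': "z \<in> \<mu> \<Otimes>\<^sub>M P \<rightarrow>\<^sub>M seq_algebra"
    using mz measurable_cong_sets[OF smuP refl] by blast
  have mfp: "(\<lambda>a. z (future a, past a)) \<in> \<nu> \<rightarrow>\<^sub>M seq_algebra"
    by (rule measurable_compose[OF measurable_Pair[OF mf mp] mz])
  define N where "N = distr \<nu> seq_algebra (\<lambda>a. z (future a, past a))"
  define Q where "Q = distr (\<mu> \<Otimes>\<^sub>M P) seq_algebra z"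
  interpret N: prob_space N unfolding N_def by (rule nu.prob_space_distr[OF mfp])
  interpret Q: prob_space Q unfolding Q_def by (rule muP.prob_space_distr[OF mz'])
  have zc: "z p \<in> cylinder w \<longleftrightarrow> fst p \<in> cylinder (map fst w) \<and> snd p \<in> cylinder (map snd w)" for p w
    by (auto simp: cylinder_def z_def prod_eq_iff)
  have Nc: "measure N (cylinder w) = measure \<mu> (cylinder (rev (map snd w) @ map fst w))" for w
    unfolding N_def using measure_distr[OF mfp cylinder_in_sets[of w]]
      measure_nu_cylinders[of "map fst w" "map snd w"]
    by (simp add: space_nu vimage_def zc)
  have Qc: "measure Q (cylinder w) = measure \<mu> (cylinder (map fst w)) * measure P (cylinder (map snd w))" for w
  proof -
    have "measure Q (cylinder w) = measure (\<mu> \<Otimes>\<^sub>M P) (z -` cylinder w \<inter> space (\<mu> \<Otimes>\<^sub>M P))"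
      unfolding Q_def by (rule measure_distr[OF mz' cylinder_in_sets])
    also have "z -` cylinder w \<inter> space (\<mu> \<Otimes>\<^sub>M P) = cylinder (map fst w) \<times> cylinder (map snd w)"
      by (auto simp: space_pair_measure space_mu zc sets_eq_imp_space_eq[OF sP])
    also have "measure (\<mu> \<Otimes>\<^sub>M P) \<dots> = measure \<mu> (cylinder (map fst w)) * measure P (cylinder (map snd w))"
      using P.emeasure_pair_measure_Times[of "cylinder (map fst w)" \<mu> "cylinder (map snd w)"]
      by (simp add: sets_mu sP cylinder_in_sets measure_def enn2real_mult)
    finally show ?thesis .
  qed
  \<comment> \<open>With u and v the first and second components of w, the joint law sees the word
    \<open>rev v @ u\<close>; splitting this word costs the factor C.\<close>
  have dom: "measure N (cylinder w) \<le> C * measure Q (cylinder w)" for w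
    unfolding Nc Qc cyl_P using C(2)[of "rev (map snd w)" "map fst w"] by (simp add: mult_ac)
  define X' where "X' = {c :: nat \<Rightarrow> 'm \<times> 'm. ((\<lambda>k. fst (c k)), (\<lambda>k. snd (c k))) \<in> X}"
  have "(\<lambda>c :: nat \<Rightarrow> 'm \<times> 'm. ((\<lambda>k. fst (c k)), (\<lambda>k. snd (c k)))) \<in> seq_algebra \<rightarrow>\<^sub>M seq_algebra \<Otimes>\<^sub>M seq_algebra"
    by (intro measurable_Pair measurable_into_seq_algebra measurable_compose[OF measurable_seq_coord]) simp_all
  from measurable_sets[OF this X] have X': "X' \<in> sets seq_algebra" by (simp add: X'_def vimage_def)
  have zX: "z p \<in> X' \<longleftrightarrow> p \<in> X" for p by (simp add: X'_def z_def)
  have "measure N X' \<le> C * measure Q X'"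
    using C(1) by (intro cylinder_domination[OF Q.finite_measure_axioms _ N.finite_measure_axioms _ dom _ X'])
      (auto simp: Q_def N_def)
  also have "measure Q X' = measure (\<mu> \<Otimes>\<^sub>M P) X"
  proof -
    have "z -` X' \<inter> space (\<mu> \<Otimes>\<^sub>M P) = X"
      using sets.sets_into_space[OF X] by (auto simp: zX space_pair_measure space_mu sets_eq_imp_space_eq[OF sP])
    then show ?thesis unfolding Q_def using measure_distr[OF mz' X'] by simp
  qed
  also have "measure (\<mu> \<Otimes>\<^sub>M P) X = 0" using null by (simp add: P_def measure_def)
  finally have "measure N X' \<le> 0" by simp
  moreover have "measure N X' = measure \<nu> {a. (future a, past a) \<in> X}"
    unfolding N_def using measure_distr[OF mfp X'] by (simp add: space_nu vimage_def zX)
  ultimately show ?thesis using measure_nonneg[of \<nu> "{a. (future a, past a) \<in> X}"] by linarith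
qed

lemma measurable_furstenberg_map: "furstenberg_map A \<in> \<nu> \<rightarrow>\<^sub>M borel"
proof (rule borel_measurable_LIMSEQ_metric)
  fix n
  have "(\<lambda>w. direction (sgn (adjugate2 (word_matrix A (rev w)) *v vector [1, -1])))
      \<circ> (\<lambda>a. map (\<lambda>k. a (- int k)) [0..<n]) \<in> seq_algebra \<rightarrow>\<^sub>M borel"
    using measurable_prefix[where f = "\<lambda>k. - int k"] by (rule measurable_comp) simp
  then show "(\<lambda>a. direction (past_dir n (\<lambda>k. a (- int k)) (vector [1, -1]))) \<in> borel_measurable \<nu>"
    using measurable_cong_sets[OF sets_nu refl] by (auto simp: comp_def past_dir_def)
next
  fix a
  show "(\<lambda>n. direction (past_dir n (\<lambda>k. a (- int k)) (vector [1, -1]))) \<longlonglongrightarrow> furstenberg_map A a"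
    unfolding furstenberg_map_eq
    by (intro tendsto_direction past_dir_tendsto norm_past_dir norm_rho vec_1_minus_1_cone)
qed

definition strip_energy :: "real \<Rightarrow> (int \<Rightarrow> 'm) \<Rightarrow> ennreal" where
  "strip_energy r a = strip_sum M r (code (future a)) (rho (past a))"

lemma measurable_strip_sum_pair:
  "(\<lambda>(b, c). strip_sum M r (code b) (rho c)) \<in> borel_measurable (seq_algebra \<Otimes>\<^sub>M seq_algebra)"
proof -
  have mc: "code \<in> seq_algebra \<rightarrow>\<^sub>M borel"
    using measurable_code measurable_cong_sets[OF sets_mu refl] by blast
  have "(\<lambda>p. (code (fst p), rho (snd p))) \<in> seq_algebra \<Otimes>\<^sub>M seq_algebra \<rightarrow>\<^sub>M borel \<Otimes>\<^sub>M borel"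
    by (intro measurable_Pair measurable_compose[OF measurable_fst mc]
        measurable_compose[OF measurable_snd measurable_rho])
  from measurable_compose[OF this measurable_strip_sum[OF M.sigma_finite_measure_axioms]]
  show ?thesis by (simp add: split_beta')
qed

lemma measurable_strip_energy: "strip_energy r \<in> borel_measurable seq_algebra"
  using measurable_compose[OF measurable_Pair[OF measurable_future measurable_past] measurable_strip_sum_pair]
  by (simp add: strip_energy_def[abs_def])

text \<open>Under the product law the point can be fixed. Its exceptional directions are Lebesgue
  null, hence null for the Furstenberg measure, which is the law of the direction of
  \<open>rho (past a)\<close>. \<open>future_past_null\<close> carries this over to
  \<open>\<nu>\<close>.\<close>

lemma strip_energy_finite_AE:
  assumes ac: "absolutely_continuous rp1_lebesgue (furstenberg_measure A \<nu>)"
    and s: "1 < s" and r: "0 \<le> r" "r < 2"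
  shows "measure \<nu> {a. code (future a) \<in> frostman_set 1 j \<and> strip_energy r a = \<infinity>} = 0"
proof -
  define P where "P = distr \<nu> seq_algebra past"
  have mp: "past \<in> \<nu> \<rightarrow>\<^sub>M seq_algebra"
    using measurable_past measurable_cong_sets[OF sets_nu refl] by blast
  interpret P: prob_space P unfolding P_def by (rule nu.prob_space_distr[OF mp])
  have sP: "sets P = sets seq_algebra" by (simp add: P_def)
  have smuP: "sets (\<mu> \<Otimes>\<^sub>M P) = sets (seq_algebra \<Otimes>\<^sub>M seq_algebra)"
    by (intro sets_pair_measure_cong sets_mu sP)
  define X where "X = {p. code (fst p) \<in> frostman_set 1 j} \<inter> {p. strip_sum M r (code (fst p)) (rho (snd p)) = \<infinity>}"
  have mc: "code \<in> seq_algebra \<rightarrow>\<^sub>M borel"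
    using measurable_code measurable_cong_sets[OF sets_mu refl] by blast
  have "(\<lambda>p. code (fst p)) \<in> seq_algebra \<Otimes>\<^sub>M seq_algebra \<rightarrow>\<^sub>M borel"
    by (rule measurable_compose[OF measurable_fst mc])
  from measurable_sets[OF this borel_frostman_set[of 1 j]] measurable_sets[OF measurable_strip_sum_pair[of r], of "{\<infinity>}"]
  have X: "X \<in> sets (seq_algebra \<Otimes>\<^sub>M seq_algebra)"
    unfolding X_def by (intro sets.Int) (simp_all add: vimage_def space_pair_measure split_beta')
  have sec: "emeasure P (Pair b -` X) = 0" for b
  proof (cases "code b \<in> frostman_set 1 j")
    case True
    define Z where "Z = {p. strip_sum M r (code b) (section_rp1 p) = \<infinity>}"
    have Z: "Z \<in> null_sets rp1_lebesgue"
      unfolding Z_def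
    proof (rule rp1_lebesgue_null_strip_sum[OF M.prob_space_axioms _ _ r])
      fix t :: real assume "0 < t"
      then show "measure M (cball (code b) t) \<le> real j * t" using True by (auto simp: frostman_set_def)
    qed simp
    then have "Z \<in> null_sets (furstenberg_measure A \<nu>)" using ac by (auto simp: absolutely_continuous_def)
    then have Zs: "Z \<in> sets borel" and "emeasure (distr \<nu> borel (furstenberg_map A)) Z = 0"
      by (auto simp: furstenberg_measure_def)
    then have e: "emeasure \<nu> (furstenberg_map A -` Z \<inter> space \<nu>) = 0"
      using emeasure_distr[OF measurable_furstenberg_map Zs] by simp
    have "Pair b -` X = {c. strip_sum M r (code b) (rho c) = \<infinity>}" using True by (auto simp: X_def)
    moreover have "strip_sum M r (code b) (section_rp1 (furstenberg_map A a)) = strip_sum M r (code b) (rho (past a))" for a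
      unfolding furstenberg_map_eq past_def
      using section_direction[OF norm_rho, of "\<lambda>k. a (- int k)"] by (auto simp: strip_sum_minus)
    ultimately have eq: "past -` (Pair b -` X) \<inter> space \<nu> = furstenberg_map A -` Z \<inter> space \<nu>"
      by (auto simp: Z_def)
    have "Pair b -` X \<in> sets seq_algebra" using sets_Pair1[OF X, of b] .
    then have "emeasure P (Pair b -` X) = emeasure \<nu> (past -` (Pair b -` X) \<inter> space \<nu>)"
      unfolding P_def by (intro emeasure_distr mp) auto
    then show ?thesis unfolding eq using e by simp
  next
    case False
    then have "Pair b -` X = {}" by (auto simp: X_def)
    then show ?thesis by simp
  qed
  have "emeasure (\<mu> \<Otimes>\<^sub>M P) X = 0"
    using P.emeasure_pair_measure_alt[of X \<mu>] X sec by (simp add: smuP)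
  from future_past_null[OF s X this[unfolded P_def]] show ?thesis
    by (simp add: X_def strip_energy_def)
qed

text \<open>Sequences whose point lies in a Frostman set of positive measure have finite energy up
  to a null set, so the sublevel sets of the energy cannot all be null.\<close>

lemma strip_energy_bounded_positive:
  assumes ac: "absolutely_continuous rp1_lebesgue (furstenberg_measure A \<nu>)"
    and dim: "1 < hausdorff_dim_measure M" and r: "0 \<le> r" "r < 2"
  obtains L :: nat where "0 < measure \<nu> {a. strip_energy r a \<le> of_nat L}"
proof (rule ccontr)
  assume n: "\<not> thesis"
  have s: "1 < s" by (rule affinity_dim_gt_1[OF dim])
  define G where "G L = {a. strip_energy r a \<le> of_nat L}" for L :: nat
  have Gs: "G L \<in> sets \<nu>" for L
    using measurable_sets[OF measurable_strip_energy[of r], of "{..of_nat L}"]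
    by (simp add: G_def sets_nu vimage_def)
  have G0: "measure \<nu> (G L) = 0" for L
  proof -
    have "\<not> 0 < measure \<nu> (G L)" using n that[of L] unfolding G_def by blast
    then show ?thesis using measure_nonneg[of \<nu> "G L"] by linarith
  qed
  obtain j where j: "0 < measure M (frostman_set 1 j)" by (rule frostman_set_1_positive[OF dim]) blast
  define H where "H = {a. code (future a) \<in> frostman_set 1 j}"
  define Y where "Y = {a. code (future a) \<in> frostman_set 1 j \<and> strip_energy r a = \<infinity>}"
  have mc: "code \<in> seq_algebra \<rightarrow>\<^sub>M borel"
    using measurable_code measurable_cong_sets[OF sets_mu refl] by blast
  have cs: "{b. code b \<in> frostman_set 1 j} \<in> sets seq_algebra"
    using measurable_sets[OF mc borel_frostman_set[of 1 j]] by (simp add: vimage_def)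
  have Hs: "H \<in> sets \<nu>" using future_in_sets[OF cs] by (simp add: H_def sets_nu)
  have Ys: "Y \<in> sets \<nu>"
  proof -
    have "Y = H \<inter> {a. strip_energy r a = \<infinity>}" by (auto simp: Y_def H_def)
    then show ?thesis using Hs measurable_sets[OF measurable_strip_energy[of r], of "{\<infinity>}"]
      by (simp add: sets_nu vimage_def)
  qed
  have "measure \<nu> H = measure M (frostman_set 1 j)"
    using measure_future[OF cs] by (simp add: H_def measure_M[OF borel_frostman_set])
  then have "0 < measure \<nu> H" using j by simp
  moreover have "H \<in> null_sets \<nu>"
  proof (rule null_sets_subset)
    have "Y \<in> null_sets \<nu>"
      using strip_energy_finite_AE[OF ac s r, of j] Ys
      by (simp add: Y_def null_setsI nu.emeasure_eq_measure)
    moreover have "(\<Union>L. G L) \<in> null_sets \<nu>"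
      using G0 Gs by (intro null_sets_UN) (auto intro: null_setsI simp: nu.emeasure_eq_measure)
    ultimately show "Y \<union> (\<Union>L. G L) \<in> null_sets \<nu>" by (rule null_sets.Un)
    show "H \<in> sets \<nu>" by (rule Hs)
    show "H \<subseteq> Y \<union> (\<Union>L. G L)"
    proof
      fix a assume a: "a \<in> H"
      show "a \<in> Y \<union> (\<Union>L. G L)"
      proof (cases "strip_energy r a = \<infinity>")
        case True then show ?thesis using a by (simp add: H_def Y_def)
      next
        case False
        then obtain L :: nat where "strip_energy r a \<le> of_nat L"
          using ennreal_Ex_less_of_nat[of "strip_energy r a"] by (auto simp: less_top intro: less_imp_le)
        then show ?thesis by (auto simp: G_def)
      qed
    qed
  qed
  ultimately show False by (simp add: null_setsD1 measure_def)
qed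

end

section \<open>The local dimension of the Kaenmaki measure\<close>

context two_sided
begin

text \<open>Restrict \<open>\<mu>\<close> to the cylinder of w and push it forward by dropping the
  first \<open>length w\<close> symbols. On cylinders the result is dominated by
  \<open>measure_cylinder_append_le\<close>, hence on all measurable sets.\<close>

lemma measure_cylinder_shift_le:
  assumes "1 < s"
  obtains C where "0 < C"
    "\<And>w X. X \<in> sets seq_algebra \<Longrightarrow>
       measure \<mu> (cylinder w \<inter> {b. (\<lambda>k. b (length w + k)) \<in> X}) \<le> C * measure \<mu> (cylinder w) * measure \<mu> X"
proof -
  obtain C where C: "0 < C"
    "\<And>u v. measure \<mu> (cylinder (u @ v)) \<le> C * measure \<mu> (cylinder u) * measure \<mu> (cylinder v)"
    by (rule measure_cylinder_append_le[OF assms]) blast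
  have "measure \<mu> (cylinder w \<inter> {b. (\<lambda>k. b (length w + k)) \<in> X}) \<le> (C * measure \<mu> (cylinder w)) * measure \<mu> X"
    if X: "X \<in> sets seq_algebra" for w X
  proof -
    define f where "f b = (\<lambda>k. b (length w + k))" for b :: "nat \<Rightarrow> 'm"
    define \<mu>' where "\<mu>' = density \<mu> (indicator (cylinder w))"
    define N where "N = distr \<mu>' seq_algebra f"
    have cw: "cylinder w \<in> sets \<mu>" by (simp add: sets_mu cylinder_in_sets)
    have s': "sets \<mu>' = sets seq_algebra" by (simp add: \<mu>'_def sets_mu)
    have sp': "space \<mu>' = UNIV" by (simp add: \<mu>'_def space_mu)
    have mf: "f \<in> seq_algebra \<rightarrow>\<^sub>M seq_algebra" unfolding f_def by (rule measurable_reindex)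
    have mf': "f \<in> \<mu>' \<rightarrow>\<^sub>M seq_algebra" using mf measurable_cong_sets[OF s' refl] by blast
    have em: "emeasure N Y = emeasure \<mu> (cylinder w \<inter> {b. f b \<in> Y})" if Y: "Y \<in> sets seq_algebra" for Y
    proof -
      have fY: "{b. f b \<in> Y} \<in> sets \<mu>"
        using measurable_sets[OF mf Y] by (simp add: sets_mu vimage_def)
      have "emeasure N Y = emeasure \<mu>' {b. f b \<in> Y}"
        unfolding N_def using emeasure_distr[OF mf' Y] by (simp add: sp' vimage_def)
      also have "\<dots> = emeasure \<mu> (cylinder w \<inter> {b. f b \<in> Y})"
        unfolding \<mu>'_def by (rule emeasure_restricted[OF cw fY])
      finally show ?thesis .
    qed
    have mN: "measure N Y = measure \<mu> (cylinder w \<inter> {b. f b \<in> Y})" if "Y \<in> sets seq_algebra" for Y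
      using em[OF that] by (simp add: measure_def)
    have "finite_measure N"
    proof (rule finite_measureI)
      have "space N = UNIV" by (simp add: N_def)
      then show "emeasure N (space N) \<noteq> \<infinity>" using em[OF UNIV_in_seq_algebra] by simp
    qed
    moreover have "measure N (cylinder v) \<le> (C * measure \<mu> (cylinder w)) * measure \<mu> (cylinder v)" for v
    proof -
      have "cylinder w \<inter> {b. f b \<in> cylinder v} = cylinder (w @ v)"
      proof (rule set_eqI)
        fix b
        have "b \<in> cylinder (w @ v) \<longleftrightarrow> map b [0..<length w + length v] = w @ v"
          by (simp add: cylinder_eq_prefix)
        also have "\<dots> \<longleftrightarrow> map b [0..<length w] = w \<and> map (f b) [0..<length v] = v"
          unfolding map_upt_append by (simp add: f_def)
        finally show "b \<in> cylinder w \<inter> {b. f b \<in> cylinder v} \<longleftrightarrow> b \<in> cylinder (w @ v)"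
          by (simp add: cylinder_eq_prefix)
      qed
      then show ?thesis using C(2)[of w v] by (simp add: mN[OF cylinder_in_sets])
    qed
    moreover have "sets N = sets seq_algebra" by (simp add: N_def)
    moreover have "0 \<le> C * measure \<mu> (cylinder w)" using C(1) by simp
    ultimately have "measure N X \<le> (C * measure \<mu> (cylinder w)) * measure \<mu> X"
      using cylinder_domination[OF mu.finite_measure_axioms sets_mu _ _ _ _ X] by blast
    then show ?thesis unfolding mN[OF X] by (simp add: f_def)
  qed
  then show ?thesis using that C(1) by (simp add: mult.assoc)
qed

lemma measure_strip_le:
  assumes \<epsilon>: "0 < \<epsilon>" "\<epsilon> < 1" and a: "strip_energy (2 powr (1 - \<epsilon>)) a \<le> of_nat L" and \<delta>: "0 < \<delta>"
  shows "measure M {y. \<bar>cross2 (rho (past a)) (code (future a) - y)\<bar> \<le> \<delta>} \<le> (2 * real L + 1) * \<delta> powr (1 - \<epsilon>)"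
proof -
  define e x where "e = rho (past a)" and "x = code (future a)"
  define r where "r = 2 powr (1 - \<epsilon>)"
  define Z where "Z \<delta> = {y. \<bar>cross2 e (x - y)\<bar> \<le> \<delta>}" for \<delta>
  have Zs: "Z \<delta> \<in> sets borel" for \<delta>
    unfolding Z_def cross2_def by measurable
  have "measure M (Z \<delta>) \<le> (2 * real L + 1) * \<delta> powr (1 - \<epsilon>)"
  proof (cases "\<delta> \<le> 1")
    case False
    then have "1 \<le> \<delta> powr (1 - \<epsilon>)" using \<epsilon> by (simp add: ge_one_powr_ge_zero)
    then have "1 * 1 \<le> (2 * real L + 1) * \<delta> powr (1 - \<epsilon>)" by (intro mult_mono) auto
    then show ?thesis using M.prob_le_1[of "Z \<delta>"] by linarith
  next
    case True
    \<comment> \<open>The index k = n - 1 satisfies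
      \<open>\<delta> \<le> (1/2) ^ k \<le> 2 * \<delta>\<close>, and the k-th term of the energy
      alone gives the bound. The summand 1 in \<open>2 * real L + 1\<close> covers
      \<open>\<delta> > 1\<close>.\<close>
    define n where "n = (LEAST n. (1/2) ^ n < \<delta>)"
    have ex: "\<exists>n. (1/2::real) ^ n < \<delta>" using real_arch_pow_inv[OF \<delta>, of "1/2"] by simp
    have n: "(1/2) ^ n < \<delta>" unfolding n_def by (rule LeastI_ex[OF ex])
    have "n \<noteq> 0" using n True by (cases "n = 0") auto
    then obtain k where k: "n = Suc k" using not0_implies_Suc by blast
    have "\<not> (1/2) ^ k < \<delta>"
      by (rule not_less_Least[where P = "\<lambda>n. (1/2) ^ n < \<delta>"]) (simp add: n_def[symmetric] k)
    then have k1: "\<delta> \<le> (1/2) ^ k" by simp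
    have k2: "(1/2) ^ k \<le> 2 * \<delta>" using n k by simp
    have "ennreal (r ^ k) * emeasure M (Z ((1/2) ^ k)) \<le> strip_energy r a"
      unfolding strip_energy_def strip_sum_def Z_def e_def x_def
      using sum_le_suminf[of "\<lambda>k. ennreal (r ^ k) * emeasure M {y. \<bar>cross2 (rho (past a)) (code (future a) - y)\<bar> \<le> (1/2) ^ k}" "{k}"]
      by simp
    also have "\<dots> \<le> of_nat L" using a by (simp add: r_def)
    finally have "ennreal (r ^ k * measure M (Z ((1/2) ^ k))) \<le> ennreal (real L)"
      by (simp add: M.emeasure_eq_measure ennreal_mult r_def ennreal_of_nat_eq_real_of_nat)
    then have "r ^ k * measure M (Z ((1/2) ^ k)) \<le> real L" by (simp add: ennreal_le_iff)
    moreover have rk: "((1/2) ^ k) powr (1 - \<epsilon>) = 1 / r ^ k"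
      by (simp add: r_def power_divide powr_divide powr_power powr_realpow[symmetric] powr_powr mult.commute)
    moreover have "0 < r ^ k" by (simp add: r_def)
    ultimately have "measure M (Z ((1/2) ^ k)) \<le> real L * ((1/2) ^ k) powr (1 - \<epsilon>)"
      by (simp add: field_simps)
    moreover have "measure M (Z \<delta>) \<le> measure M (Z ((1/2) ^ k))"
      using k1 Zs by (intro M.finite_measure_mono) (auto simp: Z_def)
    moreover have "real L * ((1/2) ^ k) powr (1 - \<epsilon>) \<le> real L * (2 * \<delta> powr (1 - \<epsilon>))"
    proof (rule mult_left_mono)
      have "((1/2) ^ k) powr (1 - \<epsilon>) \<le> (2 * \<delta>) powr (1 - \<epsilon>)"
        using k2 \<epsilon> by (intro powr_mono2) auto
      also have "\<dots> = 2 powr (1 - \<epsilon>) * \<delta> powr (1 - \<epsilon>)" using \<delta> by (simp add: powr_mult)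
      also have "\<dots> \<le> 2 powr 1 * \<delta> powr (1 - \<epsilon>)"
        using \<epsilon> by (intro mult_right_mono powr_mono) auto
      finally show "((1/2) ^ k) powr (1 - \<epsilon>) \<le> 2 * \<delta> powr (1 - \<epsilon>)" by simp
    qed simp
    moreover have "real L * (2 * \<delta> powr (1 - \<epsilon>)) \<le> (2 * real L + 1) * \<delta> powr (1 - \<epsilon>)"
      by (simp add: algebra_simps)
    ultimately show ?thesis by linarith
  qed
  then show ?thesis by (simp add: Z_def e_def x_def)
qed

text \<open>
  At a good time the measure of a ball of radius about \<open>width w\<close> is the measure of the cylinder
  of \<open>w\<close> times that of a strip of width \<open>width w / S w\<close>.
\<close>

lemma measure_good_ball_le:
  assumes s: "1 < s" and \<epsilon>: "0 < \<epsilon>" "\<epsilon> < 1"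
  obtains c C where "0 < c" "0 < C"
    "\<And>a n w. w = map (future a) [0..<n] \<Longrightarrow> strip_energy (2 powr (1 - \<epsilon>)) (shift_by n a) \<le> of_nat L \<Longrightarrow>
       measure M (cball (code (future a)) (c * width w)) \<le> C * width w powr (s - \<epsilon>)"
proof -
  obtain c where c: "0 < c"
    "\<And>a b n. dist (code a) (code b) \<le> c * width (map a [0..<n]) \<Longrightarrow> map b [0..<n] = map a [0..<n]"
    by (rule code_separated) blast
  obtain C1 where C1: "0 < C1" "\<And>w X. X \<in> sets seq_algebra \<Longrightarrow>
       measure \<mu> (cylinder w \<inter> {b. (\<lambda>k. b (length w + k)) \<in> X}) \<le> C1 * measure \<mu> (cylinder w) * measure \<mu> X"
    by (rule measure_cylinder_shift_le[OF s]) blast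
  obtain C2 where C2: "0 < C2" "\<And>w. measure \<mu> (cylinder w) \<le> C2 * (S w * width w powr (s - 1))"
    by (rule measure_cylinder_le[OF s]) blast
  \<comment> \<open>The factor of \<open>cross2_rho_shift_le\<close> times the radius constant c;
    the ball of radius \<open>c * width w\<close> pulls back into a strip of half-width
    \<open>K * width w / S w\<close>.\<close>
  define K where "K = 2 * (1 + kappa) * c"
  have K: "0 < K" using kappa_ge_1 c(1) by (simp add: K_def)
  define C where "C = C1 * C2 * (2 * real L + 1) * K powr (1 - \<epsilon>) * 4 powr \<epsilon>"
  have C: "0 < C" using C1 C2 K by (simp add: C_def)
  have "measure M (cball (code (future a)) (c * width w)) \<le> C * width w powr (s - \<epsilon>)"
    if w: "w = map (future a) [0..<n]" and good: "strip_energy (2 powr (1 - \<epsilon>)) (shift_by n a) \<le> of_nat L" for a n w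
  proof -
    define f where "f = future a"
    define a' where "a' = shift_by n a"
    have f': "future a' = (\<lambda>k. f (n + k))" by (simp add: a'_def f_def future_shift_by)
    define \<delta> where "\<delta> = K * width w / S w"
    have \<delta>: "0 < \<delta>" using K width_pos[of w] S_pos[of w] by (simp add: \<delta>_def)
    define Z where "Z = {y. \<bar>cross2 (rho (past a')) (code (future a') - y)\<bar> \<le> \<delta>}"
    have Zs: "Z \<in> sets borel" unfolding Z_def cross2_def by measurable
    define X where "X = {b. code b \<in> Z}"
    have X: "X \<in> sets seq_algebra"
      using measurable_sets[OF measurable_code Zs] by (simp add: X_def sets_mu space_mu vimage_def)
    have lw: "length w = n" by (simp add: w)
    have sub: "{b. code b \<in> cball (code f) (c * width w)} \<subseteq> cylinder w \<inter> {b. (\<lambda>k. b (length w + k)) \<in> X}"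
    proof
      fix b assume "b \<in> {b. code b \<in> cball (code f) (c * width w)}"
      then have b: "dist (code f) (code b) \<le> c * width w" by simp
      have bw: "map b [0..<n] = w" using c(2)[of f b n] b by (simp add: w f_def)
      define v where "v = code (future a') - code (\<lambda>k. b (n + k))"
      have "code f - code b = T w (code (future a')) - T w (code (\<lambda>k. b (n + k)))"
        using code_unfold[of f n] code_unfold[of b n] bw by (simp add: f' w f_def)
      also have "\<dots> = word_matrix A w *v v" unfolding v_def by (rule T_diff)
      finally have "norm (word_matrix A w *v v) \<le> c * width w" using b by (simp add: dist_norm)
      then have "2 * (1 + kappa) * norm (word_matrix A w *v v) / S w \<le> 2 * (1 + kappa) * (c * width w) / S w"
        using kappa_ge_1 S_pos[of w] by (intro divide_right_mono mult_left_mono) auto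
      moreover have "\<bar>cross2 (rho (past a')) v\<bar> \<le> 2 * (1 + kappa) * norm (word_matrix A w *v v) / S w"
        unfolding past_def a'_def shift_by_def
        by (rule cross2_rho_shift_le) (simp add: w future_def)
      ultimately have "\<bar>cross2 (rho (past a')) v\<bar> \<le> \<delta>" by (simp add: \<delta>_def K_def mult_ac)
      then have "(\<lambda>k. b (n + k)) \<in> X" by (simp add: X_def Z_def v_def)
      then show "b \<in> cylinder w \<inter> {b. (\<lambda>k. b (length w + k)) \<in> X}"
        using bw lw by (simp add: cylinder_eq_prefix)
    qed
    have ms: "{b. (\<lambda>k. b (length w + k)) \<in> X} \<in> sets seq_algebra"
      using measurable_sets[OF measurable_reindex X, of "\<lambda>k. length w + k"] by (simp add: vimage_def)
    have "measure M (cball (code f) (c * width w)) = measure \<mu> {b. code b \<in> cball (code f) (c * width w)}"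
      by (rule measure_M) simp
    also have "\<dots> \<le> measure \<mu> (cylinder w \<inter> {b. (\<lambda>k. b (length w + k)) \<in> X})"
      using sub ms cylinder_in_sets by (intro mu.finite_measure_mono) (auto simp: sets_mu)
    also have "\<dots> \<le> C1 * measure \<mu> (cylinder w) * measure \<mu> X" by (rule C1(2)[OF X])
    also have "measure \<mu> X = measure M Z" using measure_M[OF Zs] by (simp add: X_def)
    also have "C1 * measure \<mu> (cylinder w) * measure M Z
        \<le> C1 * (C2 * (S w * width w powr (s - 1))) * ((2 * real L + 1) * \<delta> powr (1 - \<epsilon>))"
      using C1(1) C2 S_pos[of w] measure_strip_le[OF \<epsilon> good[folded a'_def] \<delta>]
      by (intro mult_mono) (auto simp: Z_def)
    \<comment> \<open>The cylinder contributes \<open>S w\<close> and the strip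
      \<open>S w powr (\<epsilon> - 1)\<close>; what remains is \<open>S w powr \<epsilon>\<close>,
      bounded by \<open>4 powr \<epsilon>\<close>.\<close>
    also have "\<dots> = C1 * C2 * (2 * real L + 1) * K powr (1 - \<epsilon>) * (S w powr \<epsilon> * width w powr (s - \<epsilon>))"
    proof -
      have "\<delta> powr (1 - \<epsilon>) = K powr (1 - \<epsilon>) * width w powr (1 - \<epsilon>) / S w powr (1 - \<epsilon>)"
        using K width_pos[of w] S_pos[of w] by (simp add: \<delta>_def powr_mult powr_divide)
      moreover have "S w = S w powr \<epsilon> * S w powr (1 - \<epsilon>)"
        using S_pos[of w] by (simp add: powr_add[symmetric])
      then have "S w / S w powr (1 - \<epsilon>) = S w powr \<epsilon>"
        using S_pos[of w] by (simp add: divide_eq_eq)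
      moreover have "width w powr (s - 1) * width w powr (1 - \<epsilon>) = width w powr (s - \<epsilon>)"
        by (simp add: powr_add[symmetric])
      moreover have "C1 * (C2 * (S w * width w powr (s - 1))) * ((2 * real L + 1) *
          (K powr (1 - \<epsilon>) * width w powr (1 - \<epsilon>) / S w powr (1 - \<epsilon>)))
        = C1 * C2 * (2 * real L + 1) * K powr (1 - \<epsilon>) *
          ((S w / S w powr (1 - \<epsilon>)) * (width w powr (s - 1) * width w powr (1 - \<epsilon>)))"
        by simp
      ultimately show ?thesis by simp
    qed
    also have "\<dots> \<le> C1 * C2 * (2 * real L + 1) * K powr (1 - \<epsilon>) * (4 powr \<epsilon> * width w powr (s - \<epsilon>))"
      using C1 C2 S_pos[of w] S_le_4[of w] \<epsilon>
      by (intro mult_left_mono mult_right_mono powr_mono2) auto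
    finally show ?thesis by (simp add: C_def f_def mult.assoc)
  qed
  then show ?thesis using that c(1) C by blast
qed

lemma frostman_set_positive:
  assumes ac: "absolutely_continuous rp1_lebesgue (furstenberg_measure A \<nu>)"
    and dim: "1 < hausdorff_dim_measure M" and t: "0 < t" "t < s"
  shows "\<exists>j. 0 < measure M (frostman_set t j)"
proof (rule ccontr)
  assume n: "\<not> (\<exists>j. 0 < measure M (frostman_set t j))"
  have s: "1 < s" by (rule affinity_dim_gt_1[OF dim])
  \<comment> \<open>At most half of the slack s - t goes to the strip estimate;
    \<open>\<eta>\<close> spends the rest on the gaps, as
    \<open>t * (1 + \<eta>) = s - \<epsilon>\<close>.\<close>
  define \<epsilon> where "\<epsilon> = min (1/2) ((s - t) / 2)"
  have \<epsilon>: "0 < \<epsilon>" "\<epsilon> < 1" "t < s - \<epsilon>" using t by (auto simp: \<epsilon>_def min_def field_simps)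
  define \<eta> where "\<eta> = (s - \<epsilon> - t) / t"
  have \<eta>: "0 < \<eta>" "t * (1 + \<eta>) \<le> s - \<epsilon>" using \<epsilon> t by (simp_all add: \<eta>_def field_simps)
  define r where "r = 2 powr (1 - \<epsilon>)"
  have r: "0 \<le> r" "r < 2" using powr_less_mono[of "1 - \<epsilon>" 1 2] \<epsilon> by (simp_all add: r_def)
  obtain \<theta> where \<theta>: "0 < \<theta>" "\<theta> < 1" "\<And>w. S w \<le> 4 * \<theta> ^ length w" by (rule S_decay) blast
  obtain \<beta> where \<beta>: "0 < \<beta>" "\<beta> < 1" "\<And>u v. width u * \<beta> ^ length v \<le> width (u @ v)"
    by (rule width_decay_ge) blast
  have "\<theta> powr \<eta> < 1" using \<theta> \<eta> powr_less_mono2[of \<eta> \<theta> 1] by simp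
  \<comment> \<open>For this q the shrinking of \<open>width\<close> over n div q symbols is at most
    by about \<open>\<theta> powr (\<eta> * n)\<close>, the loss that \<open>radial_bound\<close>
    admits.\<close>
  then obtain q where q: "(\<theta> powr \<eta>) ^ q < \<beta>" using real_arch_pow_inv[OF \<beta>(1)] by blast
  then have q0: "0 < q" using \<beta>(2) by (cases "q = 0") auto
  obtain L :: nat where L: "0 < measure \<nu> {a. strip_energy r a \<le> of_nat L}"
    by (rule strip_energy_bounded_positive[OF ac dim r]) blast
  define G where "G = {a. strip_energy r a \<le> of_nat L}"
  have G: "G \<in> sets seq_algebra"
    using measurable_sets[OF measurable_strip_energy[of r], of "{..of_nat L}"]
    by (simp add: G_def vimage_def)
  obtain c C where cC: "0 < c" "0 < C"
    "\<And>a n w. w = map (future a) [0..<n] \<Longrightarrow> strip_energy (2 powr (1 - \<epsilon>)) (shift_by n a) \<le> of_nat L \<Longrightarrow>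
       measure M (cball (code (future a)) (c * width w)) \<le> C * width w powr (s - \<epsilon>)"
    by (rule measure_good_ball_le[OF s \<epsilon>(1,2), of L]) blast
  have key: "\<exists>j. code (future a) \<in> frostman_set t j"
    if gap: "\<And>n. n0 \<le> n \<Longrightarrow> shift_by n a \<in> G \<Longrightarrow> \<exists>k\<in>{1..n div q}. shift_by (n + k) a \<in> G"
      and io: "\<And>N. \<exists>n\<ge>N. shift_by n a \<in> G" for a n0
  proof -
    define x where "x = code (future a)"
    define b where "b n = width (map (future a) [0..<n])" for n
    have "\<exists>j::nat. \<forall>\<rho>>0. measure M (cball x \<rho>) \<le> real j * \<rho> powr t"
    proof (rule radial_bound[where b = b and \<beta> = \<beta> and \<theta> = \<theta> and q = q and \<eta> = \<eta> and c = c
          and C = C and u = "s - \<epsilon>" and I = "{n. shift_by n a \<in> G}"])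
      show "0 < b n" for n by (simp add: b_def width_pos)
      show "b n * \<beta> ^ k \<le> b (n + k)" for n k
        using \<beta>(3)[of "map (future a) [0..<n]" "map (\<lambda>j. future a (n + j)) [0..<k]"]
        unfolding b_def map_upt_append by simp
      show "b n \<le> 4 * \<theta> ^ n" for n
        using width_le_S[of "map (future a) [0..<n]"] \<theta>(3)[of "map (future a) [0..<n]"]
        by (simp add: b_def)
      show "measure M (cball x \<rho>) \<le> measure M (cball x \<rho>')" if "\<rho> \<le> \<rho>'" for \<rho> \<rho>'
        using that by (intro M.finite_measure_mono) auto
      show "measure M (cball x \<rho>) \<le> 1" for \<rho> by (rule M.prob_le_1)
      show "\<exists>n\<ge>N. n \<in> {n. shift_by n a \<in> G}" for N using io by simp
      show "\<exists>k\<in>{1..n div q}. n + k \<in> {n. shift_by n a \<in> G}" if "n0 \<le> n" "n \<in> {n. shift_by n a \<in> G}" for n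
        using gap[of n] that by simp
      show "measure M (cball x (c * b n)) \<le> C * b n powr (s - \<epsilon>)" if "n \<in> {n. shift_by n a \<in> G}" for n
        unfolding x_def b_def using that by (intro cC(3)[OF refl]) (simp add: G_def r_def)
    qed (use \<beta> \<theta> q q0 \<eta> cC t in auto)
    then show ?thesis by (simp add: frostman_set_def x_def)
  qed
  have zero: "measure M (frostman_set t j) = 0" for j
    using n measure_nonneg[of M "frostman_set t j"] by (simp add: not_less antisym)
  have null: "AE a in \<nu>. code (future a) \<notin> frostman_set t j" for j
  proof -
    define Y where "Y = {b. code b \<in> frostman_set t j}"
    have Y: "Y \<in> sets seq_algebra"
      using measurable_sets[OF measurable_code borel_frostman_set[of t j]]
      by (simp add: Y_def sets_mu space_mu vimage_def)
    have "measure \<nu> {a. future a \<in> Y} = measure \<mu> Y" by (rule measure_future[OF Y])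
    also have "\<dots> = measure M (frostman_set t j)"
      unfolding Y_def by (rule measure_M[OF borel_frostman_set, symmetric])
    finally have "measure \<nu> {a. future a \<in> Y} = 0" by (simp only: zero)
    then have "{a. future a \<in> Y} \<in> null_sets \<nu>"
      using future_in_sets[OF Y] by (simp add: null_setsI nu.emeasure_eq_measure sets_nu)
    then show ?thesis by (rule AE_I') (auto simp: Y_def)
  qed
  have "AE a in \<nu>. \<forall>j. code (future a) \<notin> frostman_set t j"
    using null by (simp add: AE_all_countable)
  \<comment> \<open>A sequence with small gaps and infinitely many returns would have its point in
    some \<open>frostman_set t j\<close>. These sets being null, almost no sequence returns
    infinitely often, although G has positive measure.\<close>
  with AE_return_gap[OF nu_shift_invariant G q0]
  have "AE a in \<nu>. \<not> (\<forall>n0. \<exists>n\<ge>n0. shift_by n a \<in> G)"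
  proof eventually_elim
    case (elim a)
    then obtain n0 where "\<And>n. n0 \<le> n \<Longrightarrow> shift_by n a \<in> G \<Longrightarrow> \<exists>k\<in>{1..n div q}. shift_by (n + k) a \<in> G"
      by blast
    then show ?case using key[of n0 a] elim(2) by blast
  qed
  then show False using infinitely_often_positive[OF nu_shift_invariant G] L by (simp add: G_def)
qed

end

theorem corollary3:
  fixes A :: "'m::finite \<Rightarrow> real^2^2"
    and d :: "'m \<Rightarrow> real^2"
    and E :: "(real^2) set"
    and \<mu> :: "(nat \<Rightarrow> 'm) measure"
    and \<nu> :: "(int \<Rightarrow> 'm) measure"
  assumes "\<And>i. invertible (A i)"
    and "\<And>i j k. 0 < A i $ j $ k"
    and "\<And>i. onorm ((*v) (A i)) < 1"
    and "is_attractor (affine_map A d) E"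
    and "disjoint_family (\<lambda>i. affine_map A d i ` E)"
    and "is_kaenmaki_measure A \<mu>"
    and "1 < hausdorff_dim_measure (distr \<mu> borel (coding_map (affine_map A d)))"
    and "is_two_sided_extension \<mu> \<nu>"
    and "absolutely_continuous rp1_lebesgue (furstenberg_measure A \<nu>)"
  shows "hausdorff_dim E = ereal (affinity_dim A) \<and> has_box_dim E (affinity_dim A)"
proof -
  interpret two_sided A d E \<mu> \<nu>
    using assms(1-6,8) by unfold_locales
  show ?thesis
    using affinity_dim_gt_1[OF assms(7)] frostman_set_positive[OF assms(9,7)]
    by (rule dimensions_of_E)
qed

end
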